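(* Let $m,t,s$ be positive integers with $t+s\ge 3$ and $m\ge 2s\ge 4$, and let $\mathcal{F}_5^S(m,t,K_{s,s})$ be the $3$-graph defined below. Then, for $n$ large enough, $$\mathrm{ex}_3\big(n,\mathcal{F}_5^S(m,t,K_{s,s})\big)\le e(T_3(n,3))+6\cdot \mathrm{ex}^{bip}_3(n/3,n/3,K_{t,s,s})+3\cdot \mathrm{ex}_3(n/3,K_{t,s,s})+o\big(n^{3-\frac{1}{s^2}}\big),$$ and $$\mathrm{ex}_3\big(n,\mathcal{F}_5^S(m,t,K_{s,s})\big)\ge e(T_3(n,3))+3\cdot \mathrm{ex}_3(\lfloor n/3\rfloor,K_{t,s,s}).$$ Moreover, when $t=1$, $$\mathrm{ex}_3\big(n,\mathcal{F}_5^S(m,1,K_{s,s})\big)\le e(T_3(n,3))+6\cdot \mathrm{ex}^{bip}_3(n/3,n/3,K_{1,s,s})+3\cdot \mathrm{ex}_3(n/3,K_{1,s,s})+o\big(n^{3-\frac{1}{s}}\big).$$ (The $o(\cdot)$ terms are as $n\to\infty$ with $m,t,s$ fixed.)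
   Context: All hypergraphs are $3$-uniform ($3$-graphs). For a $3$-graph $\mathcal{F}$, $\mathrm{ex}_3(n,\mathcal{F})$ is the maximum number of hyperedges in an $n$-vertex $3$-graph containing no copy of $\mathcal{F}$ as a subhypergraph. $T_3(n,3)$ is the complete $3$-partite $3$-graph on $n$ vertices (hyperedges are the triples meeting each part in exactly one vertex) with parts of sizes $\lfloor n/3\rfloor$ or $\lceil n/3\rceil$; $e(\cdot)$ denotes the number of hyperedges. $K_{t,s,s}$ is the complete $3$-partite $3$-graph with parts of sizes $t,s,s$. $\mathrm{ex}^{bip}_3(m,n,K_{t,s,s})$ is the maximum number of hyperedges in a $3$-graph on vertex set $A\cup B$ with $|A|=m$, $|B|=n$, $A\cap B=\emptyset$, in which every hyperedge consists of one vertex of $A$ and two vertices of $B$, and which contains no copy of $K_{t,s,s}$ whose $t$-vertex part lies in $A$ and whose other two parts lie in $B$ (equivalently, no $t$ vertices of $A$ whose link graphs all contain a common copy of $K_{s,s}$ inside $B$). $\mathcal{F}_5^S(m,t,K_{s,s})$ (for $t+s\ge 3$, $m\ge 2s$) is the $3$-graph obtained as follows: take $T_3(3m,3)$, choose two disjoint $s$-sets $S_0,S_1$ inside one of its parts, add a set $T$ of $t$ new vertices, and take all hyperedges of $T_3(3m,3)$ together with every triple consisting of one vertex of $T$, one vertex of $S_0$ and one vertex of $S_1$. *)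

theory Defs
  imports Complex_Main "HOL-Library.Landau_Symbols"
begin

text \<open>A hypergraph is a pair of a vertex set and a set of hyperedges.\<close>

type_synonym 'a hypergraph = "'a set \<times> 'a set set"

abbreviation verts :: "'a hypergraph \<Rightarrow> 'a set" where
  "verts \<equiv> fst"

abbreviation hedges :: "'a hypergraph \<Rightarrow> 'a set set" where
  "hedges \<equiv> snd"

definition three_graph :: "'a hypergraph \<Rightarrow> bool" where
  "three_graph H \<longleftrightarrow> finite (verts H) \<and> (\<forall>e\<in>hedges H. e \<subseteq> verts H \<and> card e = 3)"

text \<open>Copies are not required to be induced.\<close>

definition contains_copy :: "'a hypergraph \<Rightarrow> 'b hypergraph \<Rightarrow> bool" where
  "contains_copy H F \<longleftrightarrow>
     (\<exists>\<phi>. inj_on \<phi> (verts F) \<and> \<phi> ` verts F \<subseteq> verts H \<and> (\<forall>e\<in>hedges F. \<phi> ` e \<in> hedges H))"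

text \<open>
  Taking host vertices to be natural numbers is no restriction, since every finite hypergraph
  is isomorphic to one of this kind. The set below is bounded by \<open>n choose 3\<close>, and it is
  nonempty whenever \<open>F\<close> has at least one hyperedge.
\<close>

definition ex3 :: "nat \<Rightarrow> 'b hypergraph \<Rightarrow> nat" where
  "ex3 n F = Max {card (hedges H) | H :: nat hypergraph.
     three_graph H \<and> card (verts H) = n \<and> \<not> contains_copy H F}"

text \<open>Meant for pairwise disjoint \<open>A\<close>, \<open>B\<close>, \<open>C\<close>.\<close>

definition complete3 :: "'a set \<Rightarrow> 'a set \<Rightarrow> 'a set \<Rightarrow> 'a hypergraph" where
  "complete3 A B C = (A \<union> B \<union> C, {{a, b, c} | a b c. a \<in> A \<and> b \<in> B \<and> c \<in> C})"

definition K3 :: "nat \<Rightarrow> nat \<Rightarrow> nat \<Rightarrow> nat hypergraph" where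
  "K3 a b c = complete3 {..<a} {a..<a + b} {a + b..<a + b + c}"

text \<open>
  The parts of \<open>T\<^sub>3(n,3)\<close> are the residue classes modulo 3 in \<open>{..<n}\<close>; their sizes are
  \<open>\<lfloor>n/3\<rfloor>\<close> or \<open>\<lceil>n/3\<rceil>\<close>.
\<close>

definition turan_part :: "nat \<Rightarrow> nat \<Rightarrow> nat set" where
  "turan_part n i = {v. v < n \<and> v mod 3 = i}"

definition turan3 :: "nat \<Rightarrow> nat hypergraph" where
  "turan3 n = complete3 (turan_part n 0) (turan_part n 1) (turan_part n 2)"

text \<open>
  The 3-graph \<open>F\<^sub>5\<^sup>S(m, t, K\<^sub>s\<^sub>,\<^sub>s)\<close>, for \<open>m \<ge> 2 * s\<close>. The first part of \<open>T\<^sub>3(3m,3)\<close> consists of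
  the multiples of 3 below \<open>3 * m\<close>, so \<open>S\<^sub>0\<close> and \<open>S\<^sub>1\<close> are disjoint \<open>s\<close>-subsets of it, and the
  vertices in \<open>T\<close> are new. Other choices of \<open>S\<^sub>0\<close>, \<open>S\<^sub>1\<close>, \<open>T\<close> give isomorphic 3-graphs.
\<close>

definition F5S :: "nat \<Rightarrow> nat \<Rightarrow> nat \<Rightarrow> nat hypergraph" where
  "F5S m t s =
     (let S0 = (\<lambda>i. 3 * i) ` {..<s};
          S1 = (\<lambda>i. 3 * i) ` {s..<2 * s};
          T = {3 * m..<3 * m + t}
      in (verts (turan3 (3 * m)) \<union> T,
          hedges (turan3 (3 * m)) \<union> hedges (complete3 T S0 S1)))"

definition contains_bip_copy :: "'a set \<Rightarrow> 'a set \<Rightarrow> 'a hypergraph \<Rightarrow> nat \<Rightarrow> nat \<Rightarrow> bool" where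
  "contains_bip_copy A B H t s \<longleftrightarrow>
     (\<exists>T X Y. T \<subseteq> A \<and> X \<subseteq> B \<and> Y \<subseteq> B \<and> X \<inter> Y = {} \<and>
        card T = t \<and> card X = s \<and> card Y = s \<and> hedges (complete3 T X Y) \<subseteq> hedges H)"

text \<open>\<open>ex3_bip m n t s\<close> is \<open>ex\<^sup>b\<^sup>i\<^sup>p\<^sub>3(m, n, K\<^sub>t\<^sub>,\<^sub>s\<^sub>,\<^sub>s)\<close>.\<close>

definition ex3_bip :: "nat \<Rightarrow> nat \<Rightarrow> nat \<Rightarrow> nat \<Rightarrow> nat" where
  "ex3_bip m n t s = Max {card (hedges H) | (H :: nat hypergraph) A B.
     three_graph H \<and> verts H = A \<union> B \<and> A \<inter> B = {} \<and> card A = m \<and> card B = n \<and>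
     (\<forall>e\<in>hedges H. card (e \<inter> A) = 1 \<and> card (e \<inter> B) = 2) \<and>
     \<not> contains_bip_copy A B H t s}"

end

theory Submission
  imports Defs
begin

text \<open>
  Upper bound. The forbidden 3-graph lies in a blow-up of \<open>F\<^sub>5 = {abc, abd, cdw}\<close>, so by Erdos' box
  theorem an extremal \<open>H\<close> contains only \<open>o(n\<^sup>5)\<close> copies of \<open>F\<^sub>5\<close>. For an \<open>F\<^sub>5\<close>-free 3-graph the degree of
  \<open>c\<close> in the shadow and the codegree of \<open>ab\<close> sum to at most \<open>n\<close> for every edge \<open>abc\<close>; together with
  the convexity of \<open>1 / (u v)\<close> this makes the average codegree at least about \<open>n / 3\<close>, so the three
  neighbourhoods of the pairs of a typical edge are an almost perfect tripartition. Relative to a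
  maximum cut only boundedly many vertices lie in many non-crossing edges; the other atypical
  vertices miss more crossing edges than they have non-crossing ones, and typical vertices extend
  every non-crossing \<open>K\<^sub>t\<^sub>,\<^sub>s\<^sub>,\<^sub>s\<close> with its two \<open>s\<close>-parts in one class to a forbidden copy. The
  quadratic loss of an unbalanced partition absorbs the change of the extremal numbers.

  Lower bound. Place extremal \<open>K\<^sub>t\<^sub>,\<^sub>s\<^sub>,\<^sub>s\<close>-free 3-graphs inside the parts of \<open>T\<^sub>3(n,3)\<close>. Every edge is
  rainbow or monochromatic with respect to the parts, which forces any forbidden copy to contain a
  monochromatic \<open>K\<^sub>t\<^sub>,\<^sub>s\<^sub>,\<^sub>s\<close>.
\<close>

subsection \<open>Double counting and dense boxes\<close>

text \<open>The error term has two sources. A class exceeding n/3 by x can raise the extremal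
  numbers by O(x n^(2-g)), where g is the Kovari-Sos-Turan saving for K_{t,s,s} (1/s^2, or 1/s when
  t = 1), while it costs n x^2 / 12 crossing edges; the optimum of the difference is O(n^(3-2g)),
  hence o(n^(3-g)). The other source is O(n^2) for exceptional vertices, harmless because s \<ge> 2
  gives g \<le> 1/2. So the exceptional set must be bounded, not merely o(n), and this is obtained
  by letting it serve as one coordinate in the box theorem. Non-crossing edges at atypical vertices
  cannot be controlled through K_{t,s,s}. The number of missing crossing edges is therefore carried
  along exactly instead of being estimated, and the thresholds for typicality and for non-crossing
  degree are kept in the ratio 18, so that the missing edges pay for the non-crossing ones.\<close>

lemma power_mean_sum:
  fixes d :: "'a \<Rightarrow> real"
  assumes "finite A" "\<And>a. a \<in> A \<Longrightarrow> d a \<ge> 0" "s > 0"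
  shows "(\<Sum>a\<in>A. d a) ^ s \<le> real (card A) ^ (s - 1) * (\<Sum>a\<in>A. d a ^ s)"
proof (cases "(\<Sum>a\<in>A. d a) = 0")
  case True
  moreover have "(\<Sum>a\<in>A. d a ^ s) \<ge> 0" using assms(2) by (intro sum_nonneg) simp
  ultimately show ?thesis using assms(3) True by (simp add: zero_power)
next
  case False
  define D where "D = (\<Sum>a\<in>A. d a)"
  define k where "k = real (card A)"
  have D: "D > 0" using False assms(2) unfolding D_def
    by (metis less_eq_real_def sum_nonneg)
  have k: "k > 0" using False assms(1) unfolding k_def by (auto simp: card_gt_0_iff)
  \<comment> \<open>Bernoulli's inequality is the tangent line of x^s at x = 1, used at the ratio of
    \<open>d a\<close> to the mean D / k; summed over \<open>A\<close> the linear terms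
    cancel.\<close>
  have "1 + real s * (d a * k / D - 1) \<le> (d a * k / D) ^ s" if "a \<in> A" for a
    using Bernoulli_inequality[of "d a * k / D - 1" s] D k assms(2)[OF that] by simp
  then have "(\<Sum>a\<in>A. 1 + real s * (d a * k / D - 1)) \<le> (\<Sum>a\<in>A. (d a * k / D) ^ s)"
    by (rule sum_mono)
  also have "(\<Sum>a\<in>A. 1 + real s * (d a * k / D - 1)) = k + real s * (D * k / D - k)"
    by (simp add: sum.distrib sum_distrib_left[symmetric] sum_subtractf k_def D_def
        sum_divide_distrib[symmetric] sum_distrib_right[symmetric])
  also have "\<dots> = k" using D by simp
  also have "(\<Sum>a\<in>A. (d a * k / D) ^ s) = (\<Sum>a\<in>A. d a ^ s) * (k / D) ^ s"
    by (simp add: sum_distrib_right sum_divide_distrib power_mult_distrib power_divide)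
  finally have "k * D ^ s \<le> (\<Sum>a\<in>A. d a ^ s) * k ^ s"
    using D by (simp add: power_divide field_simps)
  also have "k ^ s = k * k ^ (s - 1)"
    using assms(3) by (simp add: power_eq_if)
  finally show ?thesis using k by (simp add: D_def k_def mult_ac)
qed

text \<open>For s \<le> d the binomial is at least (d/s)^s. The summand 1 covers d < s, where the
  binomial vanishes but d^s \<le> s^s.\<close>

lemma power_le_binomial:
  assumes "s > 0"
  shows "real d ^ s \<le> real s ^ s * (real (d choose s) + 1)"
proof (cases "s \<le> d")
  case True
  have "(real d / real s) ^ s \<le> real (d choose s)"
    using binomial_ge_n_over_k_pow_k[OF True] by simp
  then show ?thesis using assms by (simp add: power_divide field_simps) (smt (verit) zero_le_power of_nat_0_le_iff)
next
  case False
  have "real d ^ s \<le> real s ^ s" using False by (intro power_mono) auto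
  then show ?thesis by (simp add: field_simps add_increasing2)
qed

text \<open>Pairs (a, S) with S an s-subset of \<open>R a\<close> are counted from both sides, as in
  the Kovari-Sos-Turan argument. Keeping \<open>K\<close> abstract allows iteration: the same count
  gives the box theorem, the graph bound and its 3-uniform lift.\<close>

lemma double_count_subsets:
  fixes R :: "'a \<Rightarrow> 'b set"
  assumes A: "finite A" and B: "finite B" "\<And>a. a \<in> A \<Longrightarrow> R a \<subseteq> B" and s: "s > 0"
    and K: "\<And>S. S \<subseteq> B \<Longrightarrow> card S = s \<Longrightarrow> real (card {a\<in>A. S \<subseteq> R a}) \<le> K" and K0: "K \<ge> 0"
  shows "(\<Sum>a\<in>A. real (card (R a))) ^ s
     \<le> real (card A) ^ (s - 1) * (real s ^ s * (K * real (card B) ^ s + real (card A)))"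
proof -
  \<comment> \<open>The family of s-subsets of \<open>B\<close>; it has no relation to the constant
    \<open>shadow_sum\<close> defined later.\<close>
  let ?shadow_sum = "{S. S \<subseteq> B \<and> card S = s}"
  have fin: "finite ?shadow_sum" using B by auto
  have "(\<Sum>a\<in>A. real (card (R a) choose s)) = (\<Sum>a\<in>A. real (card {S\<in>?shadow_sum. S \<subseteq> R a}))"
  proof (rule sum.cong, simp)
    fix a assume a: "a \<in> A"
    have "{S\<in>?shadow_sum. S \<subseteq> R a} = {S. S \<subseteq> R a \<and> card S = s}" using B(2)[OF a] by auto
    then show "real (card (R a) choose s) = real (card {S\<in>?shadow_sum. S \<subseteq> R a})"
      using n_subsets[OF finite_subset[OF B(2)[OF a] B(1)]] by simp
  qed
  also have "\<dots> = (\<Sum>a\<in>A. \<Sum>S\<in>?shadow_sum. of_bool (S \<subseteq> R a))"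
    using fin by (intro sum.cong refl) (simp add: of_bool_def sum.If_cases Int_def)
  also have "\<dots> = (\<Sum>S\<in>?shadow_sum. \<Sum>a\<in>A. of_bool (S \<subseteq> R a))" by (rule sum.swap)
  also have "\<dots> = (\<Sum>S\<in>?shadow_sum. real (card {a\<in>A. S \<subseteq> R a}))"
    using A by (intro sum.cong refl) (simp add: of_bool_def sum.If_cases Int_def)
  also have "\<dots> \<le> (\<Sum>S\<in>?shadow_sum. K)" by (intro sum_mono K) auto
  also have "\<dots> = real (card B choose s) * K" using n_subsets[OF B(1)] by simp
  also have "\<dots> \<le> real (card B) ^ s * K"
  proof -
    have "card B choose s \<le> card B ^ s"
    proof (cases "s \<le> card B")
      case False then show ?thesis by (simp add: binomial_eq_0)
    qed (rule binomial_le_pow)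
    then show ?thesis using K0 by (intro mult_right_mono) (simp_all flip: of_nat_power)
  qed
  finally have *: "(\<Sum>a\<in>A. real (card (R a) choose s)) \<le> K * real (card B) ^ s" by (simp add: mult_ac)
  have "(\<Sum>a\<in>A. real (card (R a))) ^ s \<le> real (card A) ^ (s - 1) * (\<Sum>a\<in>A. real (card (R a)) ^ s)"
    by (rule power_mean_sum) (use A s in auto)
  also have "\<dots> \<le> real (card A) ^ (s - 1) * (\<Sum>a\<in>A. real s ^ s * (real (card (R a) choose s) + 1))"
    by (intro mult_left_mono sum_mono power_le_binomial s) auto
  also have "\<dots> = real (card A) ^ (s - 1) * (real s ^ s * ((\<Sum>a\<in>A. real (card (R a) choose s)) + real (card A)))"
    by (simp add: sum_distrib_left[symmetric] sum.distrib)
  also have "\<dots> \<le> real (card A) ^ (s - 1) * (real s ^ s * (K * real (card B) ^ s + real (card A)))"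
    using * by (intro mult_left_mono add_right_mono) auto
  finally show ?thesis .
qed

lemma box_step:
  fixes \<epsilon> :: real
  assumes e: "\<epsilon> > 0" and M: "M > 0"
  obtains \<delta> n0 where "\<delta> > 0"
    "\<And>(X :: 'a set) (Y :: 'b set) P. finite X \<Longrightarrow> finite Y \<Longrightarrow> card X \<ge> n0 \<Longrightarrow>
       \<epsilon> * real (card X) * real (card Y) \<le> real (card {(x, y). x \<in> X \<and> y \<in> Y \<and> P x y}) \<Longrightarrow>
       \<exists>S\<subseteq>X. card S = M \<and> \<delta> * real (card Y) \<le> real (card {y\<in>Y. \<forall>x\<in>S. P x y})"
proof -
  \<comment> \<open>If no M-set works, the double count bounds (\<epsilon> x)^M by two terms. The 4
    makes the first a quarter of it, and \<open>n0\<close> makes the second no larger, since 1 \<le>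
    \<delta> x^M.\<close>
  define \<delta> where "\<delta> = \<epsilon> ^ M / (4 * real M ^ M)"
  have d: "\<delta> > 0" using e M by (simp add: \<delta>_def)
  define n0 where "n0 = max M (nat \<lceil>1 / \<delta>\<rceil> + 1)"
  show thesis
  proof (rule that[OF d, of n0])
    fix X :: "'a set" and Y :: "'b set" and P
    assume X: "finite X" and Y: "finite Y" and n0: "card X \<ge> n0"
      and dens: "\<epsilon> * real (card X) * real (card Y) \<le> real (card {(x, y). x \<in> X \<and> y \<in> Y \<and> P x y})"
    show "\<exists>S\<subseteq>X. card S = M \<and> \<delta> * real (card Y) \<le> real (card {y\<in>Y. \<forall>x\<in>S. P x y})"
    proof (rule ccontr)
      assume neg: "\<not> ?thesis"
      define x where "x = real (card X)"
      define y where "y = real (card Y)"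
      have x: "x \<ge> 1" "1 / \<delta> \<le> x" using n0 unfolding n0_def x_def by linarith+
      have "card Y > 0"
      proof (rule ccontr)
        assume "\<not> card Y > 0"
        then have "card Y = 0" by simp
        moreover obtain S where "S \<subseteq> X" "card S = M" using n0 unfolding n0_def
          by (meson max.boundedE obtain_subset_with_card_n)
        ultimately show False using neg by auto
      qed
      then have y: "y > 0" by (simp add: y_def)
      define R where "R b = {a\<in>X. P a b}" for b
      have "real (card {b\<in>Y. S \<subseteq> R b}) \<le> \<delta> * y" if "S \<subseteq> X" "card S = M" for S
      proof -
        have "{b\<in>Y. S \<subseteq> R b} = {y\<in>Y. \<forall>x\<in>S. P x y}" using that by (auto simp: R_def)
        then show ?thesis using neg that by (auto simp: y_def)
      qed
      then have "(\<Sum>b\<in>Y. real (card (R b))) ^ M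
         \<le> y ^ (M - 1) * (real M ^ M * ((\<delta> * y) * x ^ M + y))"
        unfolding x_def y_def by (intro double_count_subsets) (use X Y M d in \<open>auto simp: R_def\<close>)
      also have "(\<Sum>b\<in>Y. real (card (R b))) = real (card {(x, y). x \<in> X \<and> y \<in> Y \<and> P x y})"
      proof -
        have "{(x, y). x \<in> X \<and> y \<in> Y \<and> P x y} = (\<lambda>(b, a). (a, b)) ` (SIGMA b:Y. R b)"
          by (auto simp: R_def image_iff)
        moreover have "inj_on (\<lambda>(b, a). (a, b)) (SIGMA b:Y. R b)" by (auto simp: inj_on_def)
        ultimately have "card {(x, y). x \<in> X \<and> y \<in> Y \<and> P x y} = card (SIGMA b:Y. R b)"
          by (simp add: card_image)
        then show ?thesis using X Y by (simp add: R_def)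
      qed
      finally have "(\<epsilon> * x * y) ^ M \<le> y ^ (M - 1) * (real M ^ M * ((\<delta> * y) * x ^ M + y))"
        using power_mono[OF dens, of M] e unfolding x_def y_def by simp
      also have "\<dots> = y ^ M * (real M ^ M * (\<delta> * x ^ M + 1))"
        using M by (cases M) (auto simp: algebra_simps)
      finally have "y ^ M * (\<epsilon> * x) ^ M \<le> y ^ M * (real M ^ M * (\<delta> * x ^ M + 1))"
        by (simp add: power_mult_distrib mult_ac)
      then have "(\<epsilon> * x) ^ M \<le> real M ^ M * (\<delta> * x ^ M + 1)" using y by simp
      also have "\<dots> \<le> real M ^ M * (\<delta> * x ^ M + \<delta> * x ^ M)"
      proof -
        have "x ^ 1 \<le> x ^ M" using x M by (intro power_increasing) auto
        then have "1 / \<delta> \<le> x ^ M" using x by simp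
        then have "1 \<le> \<delta> * x ^ M" using d by (simp add: field_simps)
        then show ?thesis by (intro mult_left_mono) auto
      qed
      also have "\<dots> = (\<epsilon> * x) ^ M / 2" using M by (simp add: \<delta>_def power_mult_distrib field_simps)
      finally have "(\<epsilon> * x) ^ M \<le> 0" by simp
      moreover have "(\<epsilon> * x) ^ M > 0" using e x by simp
      ultimately show False by simp
    qed
  qed
qed

text \<open>Erdos' box theorem is obtained by adding one coordinate at a time.\<close>

definition dense_forces :: "('a set \<Rightarrow> 'b set) \<Rightarrow> ('a set \<Rightarrow> ('b \<Rightarrow> bool) \<Rightarrow> bool) \<Rightarrow> bool" where
  "dense_forces Y R \<longleftrightarrow> (\<forall>\<epsilon>>0. \<exists>n0. \<forall>V P. finite V \<longrightarrow> n0 \<le> card V \<longrightarrow>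
     \<epsilon> * real (card (Y V)) \<le> real (card {y\<in>Y V. P y}) \<longrightarrow> R V P)"

lemma dense_forces_subset:
  "dense_forces (\<lambda>V. V) (\<lambda>V P. \<exists>A\<subseteq>V. card A = M \<and> (\<forall>a\<in>A. P a))"
  unfolding dense_forces_def
proof (intro allI impI, rule exI, intro allI impI)
  fix \<epsilon> :: real and V :: "'a set" and P
  assume e: "\<epsilon> > 0" and V: "finite V" "nat \<lceil>real M / \<epsilon>\<rceil> \<le> card V"
    and dens: "\<epsilon> * real (card V) \<le> real (card {p\<in>V. P p})"
  have "real M / \<epsilon> \<le> real (card V)" using V(2) by linarith
  then have "real M \<le> \<epsilon> * real (card V)" using e by (simp add: field_simps)
  then have "M \<le> card {p\<in>V. P p}" using dens by linarith
  then obtain A where "A \<subseteq> {p\<in>V. P p}" "card A = M"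
    by (meson obtain_subset_with_card_n)
  then show "\<exists>A\<subseteq>V. card A = M \<and> (\<forall>a\<in>A. P a)" by auto
qed

text \<open>The first coordinate ranges over a set \<open>W\<close> of its own, which has to be
  large only in absolute terms, not compared with \<open>V\<close>. This is what later bounds a set
  of exceptional vertices by a constant.\<close>

lemma dense_forces_over:
  fixes Y :: "'a set \<Rightarrow> 'b set"
  assumes R: "dense_forces Y R" and fin: "\<And>V. finite V \<Longrightarrow> finite (Y V)" and e: "\<epsilon> > 0" and M: "M > 0"
  obtains n0 where "\<And>(W :: 'c set) V P. finite W \<Longrightarrow> n0 \<le> card W \<Longrightarrow> finite V \<Longrightarrow> n0 \<le> card V \<Longrightarrow>
     \<epsilon> * real (card W) * real (card (Y V)) \<le> real (card {(x, y). x \<in> W \<and> y \<in> Y V \<and> P x y}) \<Longrightarrow>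
     \<exists>S\<subseteq>W. card S = M \<and> R V (\<lambda>y. \<forall>x\<in>S. P x y)"
proof -
  obtain \<delta> n1 where d: "\<delta> > 0" and n1:
    "\<And>(X :: 'c set) (Y :: 'b set) P. finite X \<Longrightarrow> finite Y \<Longrightarrow> card X \<ge> n1 \<Longrightarrow>
       \<epsilon> * real (card X) * real (card Y) \<le> real (card {(x, y). x \<in> X \<and> y \<in> Y \<and> P x y}) \<Longrightarrow>
       \<exists>S\<subseteq>X. card S = M \<and> \<delta> * real (card Y) \<le> real (card {y\<in>Y. \<forall>x\<in>S. P x y})"
    by (rule box_step[OF e M]) (rule that)
  obtain n2 where n2: "\<And>V P. finite V \<Longrightarrow> n2 \<le> card V \<Longrightarrow>
      \<delta> * real (card (Y V)) \<le> real (card {y\<in>Y V. P y}) \<Longrightarrow> R V P"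
    using R d unfolding dense_forces_def by blast
  show thesis
  proof (rule that[of "max n1 n2"])
    fix W :: "'c set" and V P
    assume *: "finite W" "max n1 n2 \<le> card W" "finite V" "max n1 n2 \<le> card V"
      "\<epsilon> * real (card W) * real (card (Y V)) \<le> real (card {(x, y). x \<in> W \<and> y \<in> Y V \<and> P x y})"
    then obtain S where "S \<subseteq> W" "card S = M"
      "\<delta> * real (card (Y V)) \<le> real (card {y\<in>Y V. \<forall>x\<in>S. P x y})"
      using n1[of W "Y V" P] fin by auto
    then show "\<exists>S\<subseteq>W. card S = M \<and> R V (\<lambda>y. \<forall>x\<in>S. P x y)"
      using n2[OF *(3)] *(4) by auto
  qed
qed

lemma dense_forces_prod:
  fixes Y :: "'a set \<Rightarrow> 'b set"
  assumes R: "dense_forces Y R" and fin: "\<And>V. finite V \<Longrightarrow> finite (Y V)" and M: "M > 0"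
  shows "dense_forces (\<lambda>V. V \<times> Y V) (\<lambda>V P. \<exists>S\<subseteq>V. card S = M \<and> R V (\<lambda>y. \<forall>x\<in>S. P (x, y)))"
  unfolding dense_forces_def
proof (intro allI impI)
  fix \<epsilon> :: real assume e: "\<epsilon> > 0"
  obtain n0 where n0: "\<And>(W :: 'a set) V P. finite W \<Longrightarrow> n0 \<le> card W \<Longrightarrow> finite V \<Longrightarrow> n0 \<le> card V \<Longrightarrow>
     \<epsilon> * real (card W) * real (card (Y V)) \<le> real (card {(x, y). x \<in> W \<and> y \<in> Y V \<and> P x y}) \<Longrightarrow>
     \<exists>S\<subseteq>W. card S = M \<and> R V (\<lambda>y. \<forall>x\<in>S. P x y)"
    by (rule dense_forces_over[OF R fin e M]) (assumption, rule that)
  show "\<exists>n0. \<forall>V P. finite V \<longrightarrow> n0 \<le> card V \<longrightarrow>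
     \<epsilon> * real (card (V \<times> Y V)) \<le> real (card {y\<in>V \<times> Y V. P y}) \<longrightarrow>
     (\<exists>S\<subseteq>V. card S = M \<and> R V (\<lambda>y. \<forall>x\<in>S. P (x, y)))"
  proof (rule exI[of _ n0], intro allI impI)
    fix V P
    assume V: "finite V" "n0 \<le> card V" and dens: "\<epsilon> * real (card (V \<times> Y V)) \<le> real (card {y\<in>V \<times> Y V. P y})"
    have "{y\<in>V \<times> Y V. P y} = {(x, y). x \<in> V \<and> y \<in> Y V \<and> P (x, y)}" by auto
    then show "\<exists>S\<subseteq>V. card S = M \<and> R V (\<lambda>y. \<forall>x\<in>S. P (x, y))"
      using n0[OF V V, of "\<lambda>x y. P (x, y)"] dens by (simp add: card_cartesian_product mult.assoc)
  qed
qed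

text \<open>The nesting of the quantifiers, innermost universal over the first coordinate, is the
  one that repeated use of \<open>dense_forces_prod\<close> produces.\<close>

definition box4 :: "nat \<Rightarrow> 'a set \<Rightarrow> ('a \<times> 'a \<times> 'a \<times> 'a \<Rightarrow> bool) \<Rightarrow> bool" where
  "box4 M V P \<longleftrightarrow> (\<exists>A\<subseteq>V. card A = M \<and> (\<exists>B\<subseteq>V. card B = M \<and> (\<exists>C\<subseteq>V. card C = M \<and> (\<exists>D\<subseteq>V. card D = M \<and>
     (\<forall>d\<in>D. \<forall>c\<in>C. \<forall>b\<in>B. \<forall>a\<in>A. P (a, b, c, d))))))"

lemma dense_forces_box2:
  "M > 0 \<Longrightarrow> dense_forces (\<lambda>V. V \<times> V)
    (\<lambda>V P. \<exists>A\<subseteq>V. card A = M \<and> (\<exists>B\<subseteq>V. card B = M \<and> (\<forall>b\<in>B. \<forall>a\<in>A. P (a, b))))"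
  by (rule dense_forces_prod[OF dense_forces_subset])

lemma dense_forces_box4: "M > 0 \<Longrightarrow> dense_forces (\<lambda>V. V \<times> V \<times> V \<times> V) (box4 M)"
  unfolding box4_def by (intro dense_forces_prod dense_forces_subset) auto

subsection \<open>Extremal numbers\<close>

locale hyper3 =
  fixes V :: "'a set" and E :: "'a set set"
  assumes fin: "finite V" and edges: "\<And>e. e \<in> E \<Longrightarrow> e \<subseteq> V \<and> card e = 3"
begin

lemma finite_E: "finite E"
  using edges fin by (intro finite_subset[of E "Pow V"]) auto

lemma card_E_le: "card E \<le> 2 ^ card V"
proof -
  have "card E \<le> card (Pow V)" using edges fin by (intro card_mono) auto
  then show ?thesis by (simp add: card_Pow fin)
qed

end

lemma three_graph_hyper3: "three_graph H \<longleftrightarrow> hyper3 (verts H) (hedges H)"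
  by (auto simp: three_graph_def hyper3_def)

lemma ex3_eq: "ex3 n F = Max {card E | V E. hyper3 (V :: nat set) E \<and> card V = n \<and> \<not> contains_copy (V, E) F}"
  unfolding ex3_def three_graph_hyper3 by (rule arg_cong[where f = Max]) auto

lemma ex3_candidates_finite:
  "finite {card E | V E. hyper3 (V :: nat set) E \<and> card V = n \<and> \<not> contains_copy (V, E) F}"
  by (rule finite_subset[of _ "{..2 ^ n}"]) (auto intro: hyper3.card_E_le)

text \<open>An edgeless 3-graph avoids \<open>F\<close> because \<open>F\<close> has an edge, so the
  maximum is over a nonempty finite set.\<close>

lemma ex3_attained:
  assumes "hedges F \<noteq> {}"
  obtains V E where "hyper3 (V :: nat set) E" "card V = n" "\<not> contains_copy (V, E) F" "card E = ex3 n F"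
proof -
  have "hyper3 {..<n} ({} :: nat set set)" by (simp add: hyper3_def)
  moreover have "\<not> contains_copy ({..<n}, {} :: nat set set) F" using assms by (auto simp: contains_copy_def)
  ultimately have "{card E | V E. hyper3 (V :: nat set) E \<and> card V = n \<and> \<not> contains_copy (V, E) F} \<noteq> {}"
    using card_lessThan[of n] by blast
  from Max_in[OF ex3_candidates_finite this] show thesis using that by (auto simp: ex3_eq)
qed

lemma contains_copy_image:
  assumes "inj_on f V" "contains_copy (f ` V, (`) f ` E) F" "\<And>e. e \<in> E \<Longrightarrow> e \<subseteq> V"
  shows "contains_copy (V, E) F"
proof -
  obtain \<phi> where \<phi>: "inj_on \<phi> (verts F)" "\<phi> ` verts F \<subseteq> f ` V" "\<And>e. e \<in> hedges F \<Longrightarrow> \<phi> ` e \<in> (`) f ` E"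
    using assms(2) by (auto simp: contains_copy_def)
  let ?g = "inv_into V f"
  have "inj_on (?g \<circ> \<phi>) (verts F)" using \<phi>
    by (intro comp_inj_on) (auto intro: inj_on_subset[OF inj_on_inv_into])
  moreover have "(?g \<circ> \<phi>) ` verts F \<subseteq> V" using \<phi>(2) inv_into_into[of _ f V] by fastforce
  moreover have "(?g \<circ> \<phi>) ` e \<in> E" if eF: "e \<in> hedges F" for e
  proof -
    obtain e' where e': "e' \<in> E" "\<phi> ` e = f ` e'" using \<phi>(3)[OF eF] by auto
    have "(?g \<circ> \<phi>) ` e = ?g ` (f ` e')" using e'(2) by (metis image_comp)
    also have "\<dots> = e'" using inv_into_image_cancel[OF assms(1) assms(3)[OF e'(1)]] .
    finally show ?thesis using e' by simp
  qed
  ultimately show ?thesis unfolding contains_copy_def by (intro exI[of _ "?g \<circ> \<phi>"]) auto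
qed

text \<open>The vertices may have any type: an injection into the naturals carries the 3-graph over,
  and copies of \<open>F\<close> can be pulled back along it.\<close>

lemma ex3_ge:
  fixes V :: "'a set"
  assumes "finite V" "\<And>e. e \<in> E \<Longrightarrow> e \<subseteq> V \<and> card e = 3" "\<not> contains_copy (V, E) F"
  shows "card E \<le> ex3 (card V) F"
proof -
  obtain f :: "'a \<Rightarrow> nat" where f: "inj_on f V"
    using assms(1) finite_imp_inj_to_nat_seg by blast
  have inj: "inj_on ((`) f) E"
    using inj_on_image_Pow[OF f] by (rule inj_on_subset) (use assms(2) in auto)
  have "hyper3 (f ` V) ((`) f ` E)"
    using assms(1,2) card_image[OF inj_on_subset[OF f]] by (auto simp: hyper3_def)
  moreover have "\<not> contains_copy (f ` V, (`) f ` E) F"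
    using contains_copy_image[OF f] assms(2,3) by blast
  ultimately have "card ((`) f ` E) \<le> ex3 (card (f ` V)) F"
    unfolding ex3_eq by (intro Max_ge ex3_candidates_finite) blast
  then show ?thesis by (simp add: card_image[OF inj] card_image[OF f])
qed

section \<open>The bipartite extremal number\<close>

definition bip_free :: "nat \<Rightarrow> nat \<Rightarrow> 'a set \<Rightarrow> 'a set \<Rightarrow> 'a set set \<Rightarrow> bool" where
  "bip_free t s A B E \<longleftrightarrow> hyper3 (A \<union> B) E \<and> A \<inter> B = {} \<and>
     (\<forall>e\<in>E. card (e \<inter> A) = 1 \<and> card (e \<inter> B) = 2) \<and> \<not> contains_bip_copy A B (A \<union> B, E) t s"

lemma ex3_bip_eq:
  "ex3_bip m n t s = Max {card E | (A :: nat set) B E. bip_free t s A B E \<and> card A = m \<and> card B = n}"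
  unfolding ex3_bip_def three_graph_hyper3 bip_free_def contains_bip_copy_def
  by (rule arg_cong[where f = Max]) auto

lemma ex3_bip_candidates_finite:
  "finite {card E | (A :: nat set) B E. bip_free t s A B E \<and> card A = m \<and> card B = n}"
proof (rule finite_subset)
  show "{card E | (A :: nat set) B E. bip_free t s A B E \<and> card A = m \<and> card B = n} \<subseteq> {..2 ^ (m + n)}"
  proof
    fix k assume "k \<in> {card E | (A :: nat set) B E. bip_free t s A B E \<and> card A = m \<and> card B = n}"
    then obtain A B :: "nat set" and E where E: "bip_free t s A B E" "card A = m" "card B = n" "k = card E" by blast
    then have "hyper3 (A \<union> B) E" by (simp add: bip_free_def)
    then have "card E \<le> 2 ^ card (A \<union> B)" by (rule hyper3.card_E_le)
    also have "\<dots> \<le> 2 ^ (card A + card B)" by (intro power_increasing card_Un_le) simp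
    finally show "k \<in> {..2 ^ (m + n)}" by (simp add: E)
  qed
qed simp

lemma complete3_edges_nonempty:
  assumes "card T > 0" "card X > 0" "card Y > 0"
  shows "hedges (complete3 T X Y) \<noteq> {}"
proof -
  obtain x y z where "x \<in> T" "y \<in> X" "z \<in> Y" using assms by (metis card_gt_0_iff ex_in_conv)
  then show ?thesis by (auto simp: complete3_def)
qed

lemma ex3_bip_attained:
  assumes "t > 0" "s > 0"
  obtains A B E where "bip_free t s (A :: nat set) B E" "card A = m" "card B = n" "card E = ex3_bip m n t s"
proof -
  let ?A = "{..<m}" and ?B = "{m..<m+n}"
  have "\<not> contains_bip_copy ?A ?B (?A \<union> ?B, {}) t s"
  proof
    assume "contains_bip_copy ?A ?B (?A \<union> ?B, {}) t s"
    then obtain T X Y :: "nat set" where "card T = t" "card X = s" "card Y = s"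
      "hedges (complete3 T X Y) \<subseteq> {}" unfolding contains_bip_copy_def by auto
    then show False using complete3_edges_nonempty[of T X Y] assms by auto
  qed
  then have "bip_free t s ?A ?B {}" by (auto simp: bip_free_def hyper3_def)
  moreover have "card ?A = m" "card ?B = n" by simp_all
  ultimately have "{card E | (A :: nat set) B E. bip_free t s A B E \<and> card A = m \<and> card B = n} \<noteq> {}" by blast
  from Max_in[OF ex3_bip_candidates_finite this] show thesis using that by (auto simp: ex3_bip_eq)
qed

lemma ex3_bip_ge:
  assumes "bip_free t s (A :: nat set) B E"
  shows "card E \<le> ex3_bip (card A) (card B) t s"
  unfolding ex3_bip_eq by (intro Max_ge ex3_bip_candidates_finite) (use assms in blast)

lemma contains_copyI_K3:
  fixes X Y T :: "'a set"
  assumes fin: "finite T" "finite X" "finite Y"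
    and c: "card T = t" "card X = s" "card Y = s"
    and sub: "T \<subseteq> V" "X \<subseteq> V" "Y \<subseteq> V"
    and disj: "T \<inter> X = {}" "T \<inter> Y = {}" "X \<inter> Y = {}"
    and E: "\<And>v x y. v \<in> T \<Longrightarrow> x \<in> X \<Longrightarrow> y \<in> Y \<Longrightarrow> {v, x, y} \<in> E"
  shows "contains_copy (V, E) (K3 t s s)"
proof -
  obtain f where f: "bij_betw f {..<t} T" using finite_same_card_bij[of "{..<t}" T] fin c by auto
  obtain g where g: "bij_betw g {t..<t+s} X" using finite_same_card_bij[of "{t..<t+s}" X] fin c by auto
  obtain k where k: "bij_betw k {t+s..<t+s+s} Y" using finite_same_card_bij[of "{t+s..<t+s+s}" Y] fin c by auto
  define \<phi> where "\<phi> i = (if i < t then f i else if i < t + s then g i else k i)" for i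
  have 1: "bij_betw \<phi> {..<t} T" using f by (rule bij_betw_cong[THEN iffD1, rotated]) (auto simp: \<phi>_def)
  have 2: "bij_betw \<phi> {t..<t+s} X" using g by (rule bij_betw_cong[THEN iffD1, rotated]) (auto simp: \<phi>_def)
  have 3: "bij_betw \<phi> {t+s..<t+s+s} Y" using k by (rule bij_betw_cong[THEN iffD1, rotated]) (auto simp: \<phi>_def)
  have "bij_betw \<phi> ({..<t} \<union> {t..<t+s} \<union> {t+s..<t+s+s}) (T \<union> X \<union> Y)"
    using disj by (intro bij_betw_combine 1 2 3) auto
  then have "inj_on \<phi> (verts (K3 t s s))" "\<phi> ` verts (K3 t s s) \<subseteq> V"
    using sub by (simp_all add: K3_def complete3_def bij_betw_def)
  moreover have "\<phi> ` e \<in> E" if eK: "e \<in> hedges (K3 t s s)" for e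
  proof -
    obtain a b c where e: "e = {a, b, c}" "a \<in> {..<t}" "b \<in> {t..<t+s}" "c \<in> {t+s..<t+s+s}"
      using eK unfolding K3_def complete3_def snd_conv mem_Collect_eq by blast
    have "{\<phi> a, \<phi> b, \<phi> c} \<in> E"
      using bij_betwE[OF 1] bij_betwE[OF 2] bij_betwE[OF 3] e(2-4) by (intro E) blast+
    then show ?thesis by (simp add: e(1))
  qed
  ultimately show ?thesis by (auto simp: contains_copy_def)
qed

section \<open>Bounds of Kovari-Sos-Turan type\<close>

lemma powr_root_bound:
  fixes x c n e :: real
  assumes "x ^ s \<le> real s ^ s * c * n powr (real s * e)" "c \<ge> 1" "n > 0" "s > 0" "x \<ge> 0"
  shows "x \<le> real s * c * n powr e"
proof -
  \<comment> \<open>Replacing c by c^s keeps the constant free of fractional powers after the s-th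
    root is taken.\<close>
  have "c \<le> c ^ s" using assms(2,4) by (simp add: self_le_power)
  have "x ^ s \<le> real s ^ s * c ^ s * n powr (real s * e)"
    by (rule order_trans[OF assms(1)]) (intro mult_right_mono mult_left_mono \<open>c \<le> c ^ s\<close>, auto)
  also have "\<dots> = (real s * c * n powr e) ^ s"
    using assms(3) by (simp add: power_mult_distrib powr_power mult.commute)
  finally show ?thesis using assms by (subst (asm) power_mono_iff) auto
qed

text \<open>The Kovari-Sos-Turan theorem for a bipartite graph in which no \<open>s\<close> vertices
  of \<open>B\<close> have \<open>t\<close> common neighbours in \<open>A\<close>. The lower order
  term of the double count is absorbed by n \<le> n^s, which turns t into t + 1.\<close>

lemma kst_bound:
  fixes R :: "'a \<Rightarrow> 'b set"
  assumes A: "finite A" "card A \<le> n" and B: "finite B" "card B \<le> n" "\<And>a. a \<in> A \<Longrightarrow> R a \<subseteq> B"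
    and s: "s > 0" and n: "n > 0"
    and K: "\<And>S. S \<subseteq> B \<Longrightarrow> card S = s \<Longrightarrow> card {a\<in>A. S \<subseteq> R a} < t"
  shows "(\<Sum>a\<in>A. real (card (R a))) \<le> real s * (real t + 1) * real n powr (2 - 1 / real s)"
proof (rule powr_root_bound)
  have "(\<Sum>a\<in>A. real (card (R a))) ^ s
     \<le> real (card A) ^ (s - 1) * (real s ^ s * (real t * real (card B) ^ s + real (card A)))"
    by (rule double_count_subsets) (use A B s K in \<open>auto intro: less_imp_le\<close>)
  also have "\<dots> \<le> real n ^ (s - 1) * (real s ^ s * (real t * real n ^ s + real n))"
    using A B by (intro mult_mono power_mono add_mono) auto
  also have "\<dots> \<le> real n ^ (s - 1) * (real s ^ s * (real t * real n ^ s + real n ^ s))"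
    using n s by (intro mult_left_mono add_left_mono) (auto intro: self_le_power)
  also have "\<dots> = real s ^ s * (real t + 1) * (real n ^ (s - 1) * real n ^ s)"
    by (simp add: algebra_simps)
  also have "real n ^ (s - 1) * real n ^ s = real n powr (real s * (2 - 1 / real s))"
  proof -
    have "real n ^ (s - 1) * real n ^ s = real n powr (real (s - 1) + real s)"
      using n by (simp add: powr_realpow[symmetric] powr_add)
    also have "real (s - 1) + real s = real s * (2 - 1 / real s)"
      using s by (simp add: of_nat_diff field_simps)
    finally show ?thesis .
  qed
  finally show "(\<Sum>a\<in>A. real (card (R a))) ^ s \<le> real s ^ s * (real t + 1) * real n powr (real s * (2 - 1 / real s))" .
qed (use n s in \<open>auto intro: sum_nonneg\<close>)

text \<open>The factor s (t + 1) is the constant of the graph bound; the added 1 absorbs the lower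
  order term of the second double count, and the outer s appears when the s-th root is
  taken.\<close>

definition kst_const :: "nat \<Rightarrow> nat \<Rightarrow> real" where
  "kst_const t s = real s * (real s * (real t + 1) + 1)"

text \<open>
  For a fixed \<open>s\<close>-set \<open>Y\<close> the pairs \<open>(a, x)\<close> with \<open>Y \<subseteq> R a x\<close> form a bipartite graph to which the
  two-dimensional bound applies; the resulting estimate is then fed into the same double count.
\<close>

lemma kst3_bound:
  fixes R :: "'a \<Rightarrow> 'b \<Rightarrow> 'b set"
  assumes A: "finite A" "card A \<le> n" and B: "finite B" "card B \<le> n" "\<And>a x. a \<in> A \<Longrightarrow> R a x \<subseteq> B"
    and s: "s > 0" and n: "n > 0"
    and K: "\<And>X Y. X \<subseteq> B \<Longrightarrow> Y \<subseteq> B \<Longrightarrow> card X = s \<Longrightarrow> card Y = s \<Longrightarrow> card {a\<in>A. \<forall>x\<in>X. Y \<subseteq> R a x} < t"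
  shows "(\<Sum>a\<in>A. \<Sum>x\<in>B. real (card (R a x))) \<le> kst_const t s * real n powr (3 - 1 / real s ^ 2)"
proof -
  define K where "K = real s * (real t + 1) * real n powr (2 - 1 / real s)"
  define R' where "R' = (\<lambda>(a, x). R a x)"
  have "(\<Sum>p\<in>A \<times> B. real (card (R' p))) \<le> real s * (real s * (real t + 1) + 1) * real n powr (3 - 1 / real s ^ 2)"
  proof (rule powr_root_bound)
    have "(\<Sum>p\<in>A \<times> B. real (card (R' p))) ^ s
       \<le> real (card (A \<times> B)) ^ (s - 1) * (real s ^ s * (K * real (card B) ^ s + real (card (A \<times> B))))"
    proof (rule double_count_subsets)
      fix Y assume Y: "Y \<subseteq> B" "card Y = s"
      have "{p\<in>A \<times> B. Y \<subseteq> R' p} = (SIGMA a:A. {x\<in>B. Y \<subseteq> R a x})" by (auto simp: R'_def)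
      then have "real (card {p\<in>A \<times> B. Y \<subseteq> R' p}) = (\<Sum>a\<in>A. real (card {x\<in>B. Y \<subseteq> R a x}))"
        using A B by simp
      also have "\<dots> \<le> K" unfolding K_def
      proof (rule kst_bound[OF A B(1,2) _ s n])
        fix X assume X: "X \<subseteq> B" "card X = s"
        have "{a\<in>A. X \<subseteq> {x\<in>B. Y \<subseteq> R a x}} = {a\<in>A. \<forall>x\<in>X. Y \<subseteq> R a x}" using X by auto
        then show "card {a\<in>A. X \<subseteq> {x\<in>B. Y \<subseteq> R a x}} < t" using K X Y by simp
      qed auto
      finally show "real (card {p\<in>A \<times> B. Y \<subseteq> R' p}) \<le> K" .
    qed (use A B s in \<open>auto simp: R'_def K_def\<close>)
    also have "\<dots> \<le> (real n ^ 2) ^ (s - 1) * (real s ^ s * (K * real n ^ s + real n ^ 2))"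
    proof -
      have "real (card (A \<times> B)) \<le> real n ^ 2"
        using A B by (auto simp: card_cartesian_product power2_eq_square intro: mult_mono)
      then show ?thesis using A B by (intro mult_mono power_mono add_mono) (auto simp: K_def)
    qed
    also have "\<dots> \<le> (real n ^ 2) ^ (s - 1) * (real s ^ s * (K * real n ^ s + real n powr (2 - 1 / real s) * real n ^ s))"
    proof -
      have "real n ^ 2 = real n powr 2" using n by simp
      also have "\<dots> \<le> real n powr (2 - 1 / real s + real s)" using n s
        by (intro powr_mono) (auto simp: field_simps intro!: order_trans[OF _ mult_mono[of 1 "real s" 1 "real s"]])
      also have "\<dots> = real n powr (2 - 1 / real s) * real n ^ s"
        using n by (simp add: powr_add powr_realpow)
      finally show ?thesis by (intro mult_left_mono add_left_mono) auto
    qed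
    also have "\<dots> = real s ^ s * (real s * (real t + 1) + 1) * ((real n ^ 2) ^ (s - 1) * (real n powr (2 - 1 / real s) * real n ^ s))"
      by (simp add: K_def algebra_simps)
    also have "(real n ^ 2) ^ (s - 1) * (real n powr (2 - 1 / real s) * real n ^ s)
        = real n powr (2 * real (s - 1) + (2 - 1 / real s + real s))"
    proof -
      have "(real n ^ 2) ^ (s - 1) = real n ^ (2 * (s - 1))" by (simp only: power_mult)
      also have "\<dots> = real n powr (2 * real (s - 1))" using n powr_realpow[of "real n" "2 * (s - 1)"] by simp
      finally show ?thesis using n by (simp only: powr_add) (simp add: powr_realpow)
    qed
    also have "2 * real (s - 1) + (2 - 1 / real s + real s) = real s * (3 - 1 / real s ^ 2)"
      using s by (simp add: of_nat_diff field_simps power2_eq_square)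
    finally show "(\<Sum>p\<in>A \<times> B. real (card (R' p))) ^ s \<le>
       real s ^ s * (real s * (real t + 1) + 1) * real n powr (real s * (3 - 1 / real s ^ 2))" .
  qed (use n s in \<open>auto intro: sum_nonneg\<close>)
  then show ?thesis by (simp add: kst_const_def R'_def sum.cartesian_product split_def)
qed

text \<open>For t = 1 every single link graph is K_{s,s}-free, so the graph bound applies to each
  link and is summed over at most \<open>n\<close> vertices. Only one application of it is involved,
  which is why the saving is 1/s rather than 1/s^2.\<close>

lemma kst3_bound_one:
  fixes R :: "'a \<Rightarrow> 'b \<Rightarrow> 'b set"
  assumes A: "finite A" "card A \<le> n" and B: "finite B" "card B \<le> n" "\<And>a x. a \<in> A \<Longrightarrow> R a x \<subseteq> B"
    and s: "s > 0" and n: "n > 0"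
    and K: "\<And>X Y. X \<subseteq> B \<Longrightarrow> Y \<subseteq> B \<Longrightarrow> card X = s \<Longrightarrow> card Y = s \<Longrightarrow> card {a\<in>A. \<forall>x\<in>X. Y \<subseteq> R a x} < 1"
  shows "(\<Sum>a\<in>A. \<Sum>x\<in>B. real (card (R a x))) \<le> kst_const s s * real n powr (3 - 1 / real s)"
proof -
  let ?b = "real s * (real s + 1) * real n powr (2 - 1 / real s)"
  have "(\<Sum>a\<in>A. \<Sum>x\<in>B. real (card (R a x))) \<le> (\<Sum>a\<in>A. ?b)"
  proof (rule sum_mono)
    fix a assume a: "a \<in> A"
    show "(\<Sum>x\<in>B. real (card (R a x))) \<le> ?b"
    proof (rule kst_bound[OF B(1,2) B(1,2) B(3)[OF a] s n])
      fix Y assume Y: "Y \<subseteq> B" "card Y = s"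
      show "card {x\<in>B. Y \<subseteq> R a x} < s"
      proof (rule ccontr)
        assume "\<not> ?thesis"
        then obtain X where X: "X \<subseteq> {x\<in>B. Y \<subseteq> R a x}" "card X = s"
          by (meson not_less obtain_subset_with_card_n)
        have "card {a\<in>A. \<forall>x\<in>X. Y \<subseteq> R a x} < 1" using X Y by (intro K) auto
        then show False using a X A by auto
      qed
    qed
  qed
  also have "\<dots> = real (card A) * ?b" by simp
  also have "\<dots> \<le> real n * ?b" using A by (intro mult_right_mono) auto
  also have "\<dots> = real s * (real s + 1) * (real n powr 1 * real n powr (2 - 1 / real s))" using n by simp
  also have "real n powr 1 * real n powr (2 - 1 / real s) = real n powr (3 - 1 / real s)"
    by (simp only: powr_add[symmetric]) simp
  also have "real s * (real s + 1) * real n powr (3 - 1 / real s) \<le> kst_const s s * real n powr (3 - 1 / real s)"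
    using s by (intro mult_right_mono) (auto simp: kst_const_def intro!: mult_left_mono)
  finally show ?thesis .
qed

lemma card_edges_le_triples:
  assumes fin: "finite A" "finite B"
    and E: "\<And>e. e \<in> E \<Longrightarrow> \<exists>v\<in>A. \<exists>x\<in>B. \<exists>y\<in>B. e = {v, x, y}"
  shows "real (card E) \<le> (\<Sum>v\<in>A. \<Sum>x\<in>B. real (card {y\<in>B. {v, x, y} \<in> E}))"
proof -
  let ?T = "SIGMA v:A. SIGMA x:B. {y\<in>B. {v, x, y} \<in> E}"
  have "E \<subseteq> (\<lambda>(v, x, y). {v, x, y}) ` ?T"
  proof
    fix e assume e: "e \<in> E"
    then obtain v x y where "v \<in> A" "x \<in> B" "y \<in> B" "e = {v, x, y}" using E by blast
    then show "e \<in> (\<lambda>(v, x, y). {v, x, y}) ` ?T" using e by (intro image_eqI[of _ _ "(v, x, y)"]) auto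
  qed
  moreover have "finite ?T" using fin by auto
  ultimately have "card E \<le> card ?T" by (meson card_image_le card_mono finite_imageI le_trans)
  also have "card ?T = (\<Sum>v\<in>A. \<Sum>x\<in>B. card {y\<in>B. {v, x, y} \<in> E})" using fin by simp
  finally show ?thesis by (simp flip: of_nat_sum)
qed

definition kst_exponent :: "nat \<Rightarrow> nat \<Rightarrow> real" where
  "kst_exponent t s = (if t = 1 then 1 / real s else 1 / real s ^ 2)"

lemma tripartite_free_bound:
  fixes R :: "'a \<Rightarrow> 'b \<Rightarrow> 'b set"
  assumes A: "finite A" "card A \<le> n" and B: "finite B" "card B \<le> n" "\<And>a x. a \<in> A \<Longrightarrow> R a x \<subseteq> B"
    and s: "s > 0" and n: "n > 0"
    and K: "\<And>X Y. X \<subseteq> B \<Longrightarrow> Y \<subseteq> B \<Longrightarrow> card X = s \<Longrightarrow> card Y = s \<Longrightarrow> card {a\<in>A. \<forall>x\<in>X. Y \<subseteq> R a x} < t"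
  shows "(\<Sum>a\<in>A. \<Sum>x\<in>B. real (card (R a x))) \<le> (kst_const t s + kst_const s s) * real n powr (3 - kst_exponent t s)"
proof (cases "t = 1")
  case True
  have "(\<Sum>a\<in>A. \<Sum>x\<in>B. real (card (R a x))) \<le> kst_const s s * real n powr (3 - kst_exponent t s)"
    using kst3_bound_one[OF A B s n] K True by (simp add: kst_exponent_def)
  also have "\<dots> \<le> (kst_const t s + kst_const s s) * real n powr (3 - kst_exponent t s)"
    by (intro mult_right_mono) (auto simp: kst_const_def)
  finally show ?thesis .
next
  case False
  have "(\<Sum>a\<in>A. \<Sum>x\<in>B. real (card (R a x))) \<le> kst_const t s * real n powr (3 - kst_exponent t s)"
    unfolding kst_exponent_def if_not_P[OF False] by (rule kst3_bound[OF A B s n K])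
  also have "\<dots> \<le> (kst_const t s + kst_const s s) * real n powr (3 - kst_exponent t s)"
    by (intro mult_right_mono) (auto simp: kst_const_def)
  finally show ?thesis .
qed

lemma K3_nonempty: "t > 0 \<Longrightarrow> s > 0 \<Longrightarrow> hedges (K3 t s s) \<noteq> {}"
  unfolding K3_def by (rule complete3_edges_nonempty) auto

text \<open>The tripartite bound is used with both sides equal to \<open>V\<close>. The sets it
  produces need not be disjoint a priori, but every {v, x, y} is an edge with three elements, which
  forces disjointness.\<close>

lemma ex3_K3_bound:
  assumes "t > 0" "s > 0" "a \<le> n" "n > 0"
  shows "real (ex3 a (K3 t s s)) \<le> (kst_const t s + kst_const s s) * real n powr (3 - kst_exponent t s)"
proof -
  obtain V E where hyp: "hyper3 (V :: nat set) E" and Va: "card V = a" and free: "\<not> contains_copy (V, E) (K3 t s s)"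
    and cE: "card E = ex3 a (K3 t s s)" using ex3_attained K3_nonempty assms(1,2) by metis
  note V = hyper3.fin[OF hyp] Va and E = hyper3.edges[OF hyp]
  have "real (card E) \<le> (\<Sum>v\<in>V. \<Sum>x\<in>V. real (card {y\<in>V. {v, x, y} \<in> E}))"
  proof (rule card_edges_le_triples)
    fix e assume "e \<in> E"
    then obtain v x y where "e = {v, x, y}" using E[of e] by (auto simp: card_3_iff)
    with E[OF \<open>e \<in> E\<close>] show "\<exists>v\<in>V. \<exists>x\<in>V. \<exists>y\<in>V. e = {v, x, y}" by auto
  qed (use V in auto)
  also have "\<dots> \<le> (kst_const t s + kst_const s s) * real n powr (3 - kst_exponent t s)"
  proof (rule tripartite_free_bound)
    fix X Y assume XY: "X \<subseteq> V" "Y \<subseteq> V" "card X = s" "card Y = s"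
    show "card {a\<in>V. \<forall>x\<in>X. Y \<subseteq> {y\<in>V. {a, x, y} \<in> E}} < t"
    proof (rule ccontr)
      assume "\<not> ?thesis"
      then obtain T where T: "T \<subseteq> {a\<in>V. \<forall>x\<in>X. Y \<subseteq> {y\<in>V. {a, x, y} \<in> E}}" "card T = t"
        by (meson not_less obtain_subset_with_card_n)
      have e: "{v, x, y} \<in> E" if "v \<in> T" "x \<in> X" "y \<in> Y" for v x y using T(1) that by auto
      have c: "card {v, x, y} = 3" if "v \<in> T" "x \<in> X" "y \<in> Y" for v x y using e[OF that] E by blast
      have ne: "T \<noteq> {}" "X \<noteq> {}" "Y \<noteq> {}" using T XY assms by auto
      have "v \<noteq> x \<and> v \<noteq> y \<and> x \<noteq> y" if "v \<in> T" "x \<in> X" "y \<in> Y" for v x y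
        using c[OF that] by (auto simp: card_insert_if split: if_splits)
      then have "T \<inter> X = {}" "T \<inter> Y = {}" "X \<inter> Y = {}" using ne by blast+
      then have "contains_copy (V, E) (K3 t s s)"
        using T XY e by (intro contains_copyI_K3[of T X Y] finite_subset[OF _ V(1)]) auto
      then show False using free by simp
    qed
  qed (use V assms in auto)
  finally show ?thesis by (simp add: cE)
qed

lemma ex3_bip_bound:
  assumes "t > 0" "s > 0" "a \<le> n" "b \<le> n" "n > 0"
  shows "real (ex3_bip a b t s) \<le> (kst_const t s + kst_const s s) * real n powr (3 - kst_exponent t s)"
proof -
  obtain A B E where H: "bip_free t s (A :: nat set) B E" "card A = a" "card B = b" and cE: "card E = ex3_bip a b t s"
    using ex3_bip_attained[OF assms(1,2)] by metis
  have hyp: "hyper3 (A \<union> B) E" using H(1) by (simp add: bip_free_def)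
  have AB: "finite A" "finite B" using hyper3.fin[OF hyp] by auto
  note E = hyper3.edges[OF hyp]
  have "real (card E) \<le> (\<Sum>v\<in>A. \<Sum>x\<in>B. real (card {y\<in>B. {v, x, y} \<in> E}))"
  proof (rule card_edges_le_triples)
    fix e assume e: "e \<in> E"
    then obtain v x y where "e \<inter> A = {v}" "e \<inter> B = {x, y}" using H(1)
      by (fastforce simp: bip_free_def card_1_singleton_iff card_2_iff)
    moreover have "e = (e \<inter> A) \<union> (e \<inter> B)" using E[OF e] by auto
    ultimately have "e = {v, x, y}" "v \<in> A" "x \<in> B" "y \<in> B" by blast+
    then show "\<exists>v\<in>A. \<exists>x\<in>B. \<exists>y\<in>B. e = {v, x, y}" by blast
  qed (use AB in auto)
  also have "\<dots> \<le> (kst_const t s + kst_const s s) * real n powr (3 - kst_exponent t s)"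
  proof (rule tripartite_free_bound)
    fix X Y assume XY: "X \<subseteq> B" "Y \<subseteq> B" "card X = s" "card Y = s"
    show "card {a\<in>A. \<forall>x\<in>X. Y \<subseteq> {y\<in>B. {a, x, y} \<in> E}} < t"
    proof (rule ccontr)
      assume "\<not> ?thesis"
      then obtain T where T: "T \<subseteq> {a\<in>A. \<forall>x\<in>X. Y \<subseteq> {y\<in>B. {a, x, y} \<in> E}}" "card T = t"
        by (meson not_less obtain_subset_with_card_n)
      have e: "{v, x, y} \<in> E" if "v \<in> T" "x \<in> X" "y \<in> Y" for v x y using T(1) that by auto
      have c: "card {v, x, y} = 3" if "v \<in> T" "x \<in> X" "y \<in> Y" for v x y using e[OF that] E by blast
      have ne: "T \<noteq> {}" using T assms by auto
      have "x \<noteq> y" if "v \<in> T" "x \<in> X" "y \<in> Y" for v x y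
        using c[OF that] by (auto simp: card_insert_if split: if_splits)
      then have "X \<inter> Y = {}" using ne by blast
      moreover have "hedges (complete3 T X Y) \<subseteq> E" using e by (auto simp: complete3_def)
      moreover have "T \<subseteq> A" using T by auto
      ultimately have "contains_bip_copy A B (A \<union> B, E) t s"
        unfolding contains_bip_copy_def snd_conv using XY T(2) by blast
      then show False using H(1) by (simp add: bip_free_def)
    qed
  qed (use AB assms H in auto)
  finally show ?thesis by (simp add: cE)
qed

text \<open>
  Deleting a vertex of least degree compares extremal numbers for \<open>n\<close> and \<open>n + 1\<close> vertices.
\<close>

lemma exists_low_degree:
  assumes "finite A" "A \<noteq> {}" "finite E"
  shows "\<exists>v\<in>A. card {e\<in>E. v \<in> e} * card A \<le> (\<Sum>e\<in>E. card (e \<inter> A))"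
proof (rule ccontr)
  assume "\<not> ?thesis"
  then have *: "\<And>v. v \<in> A \<Longrightarrow> (\<Sum>e\<in>E. card (e \<inter> A)) < card {e\<in>E. v \<in> e} * card A" by force
  have "(\<Sum>e\<in>E. card (e \<inter> A)) * card A = (\<Sum>v\<in>A. \<Sum>e\<in>E. card (e \<inter> A))" by simp
  also have "\<dots> < (\<Sum>v\<in>A. card {e\<in>E. v \<in> e} * card A)"
    using assms(1,2) * by (intro sum_strict_mono) auto
  also have "\<dots> = (\<Sum>v\<in>A. card {e\<in>E. v \<in> e}) * card A" by (simp add: sum_distrib_right)
  also have "(\<Sum>v\<in>A. card {e\<in>E. v \<in> e}) = (\<Sum>v\<in>A. \<Sum>e\<in>E. of_bool (v \<in> e))"
    using assms(3) by (intro sum.cong refl) (simp add: of_bool_def sum.If_cases Int_def)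
  also have "\<dots> = (\<Sum>e\<in>E. \<Sum>v\<in>A. of_bool (v \<in> e))" by (rule sum.swap)
  also have "\<dots> = (\<Sum>e\<in>E. card (e \<inter> A))"
    using assms(1) by (intro sum.cong refl) (simp add: of_bool_def sum.If_cases Int_def conj_commute)
  finally show False by simp
qed

section \<open>Dependence of the extremal numbers on the number of vertices\<close>

lemma contains_copy_mono:
  "contains_copy (V, E) F \<Longrightarrow> V \<subseteq> V' \<Longrightarrow> E \<subseteq> E' \<Longrightarrow> contains_copy (V', E') F"
  unfolding contains_copy_def fst_conv snd_conv by (meson subset_iff)

lemma ex3_Suc_le:
  assumes "hedges F \<noteq> {}"
  shows "real (ex3 (Suc a) F) \<le> real (ex3 a F) + 3 * real (ex3 (Suc a) F) / real (Suc a)"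
proof -
  obtain V E where hyp: "hyper3 (V :: nat set) E" and Va: "card V = Suc a" and free: "\<not> contains_copy (V, E) F"
    and cE: "card E = ex3 (Suc a) F" using ex3_attained[OF assms] by metis
  note V = hyper3.fin[OF hyp] Va and E = hyper3.edges[OF hyp]
  note fE = hyper3.finite_E[OF hyp]
  have "V \<noteq> {}" using V by auto
  then obtain v where v: "v \<in> V" "card {e\<in>E. v \<in> e} * card V \<le> (\<Sum>e\<in>E. card (e \<inter> V))"
    using exists_low_degree[OF V(1) _ fE] by blast
  have "(\<Sum>e\<in>E. card (e \<inter> V)) = (\<Sum>e\<in>E. 3)" using E by (intro sum.cong refl) (simp add: Int_absorb2)
  with v V have deg: "card {e\<in>E. v \<in> e} * Suc a \<le> 3 * card E" by simp
  have "card {e\<in>E. v \<notin> e} \<le> ex3 (card (V - {v})) F"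
  proof (rule ex3_ge)
    show "\<not> contains_copy (V - {v}, {e\<in>E. v \<notin> e}) F"
      using free contains_copy_mono[of "V - {v}" "{e\<in>E. v \<notin> e}" F V E] by auto
  qed (use V E in auto)
  moreover have "card (V - {v}) = a" using V v by simp
  moreover have "card E = card {e\<in>E. v \<notin> e} + card {e\<in>E. v \<in> e}"
    using fE by (subst card_Un_disjoint[symmetric]) (auto intro: arg_cong[where f = card])
  ultimately have "card E \<le> ex3 a F + card {e\<in>E. v \<in> e}" by simp
  moreover have "real (card {e\<in>E. v \<in> e}) \<le> 3 * real (card E) / real (Suc a)"
    using deg by (simp add: field_simps del: of_nat_Suc flip: of_nat_mult)
  ultimately show ?thesis using cE by simp
qed

text \<open>Adding an isolated vertex creates no copy, since every vertex of \<open>F\<close> lies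
  in an edge and so must be mapped to a vertex of positive degree.\<close>

lemma ex3_mono_Suc:
  assumes "hedges F \<noteq> {}" "verts F \<subseteq> \<Union>(hedges F)"
  shows "ex3 a F \<le> ex3 (Suc a) F"
proof -
  obtain V E where hyp: "hyper3 (V :: nat set) E" and Va: "card V = a" and free: "\<not> contains_copy (V, E) F"
    and cE: "card E = ex3 (a) F" using ex3_attained[OF assms(1)] by metis
  note V = hyper3.fin[OF hyp] Va and E = hyper3.edges[OF hyp]
  obtain w where w: "w \<notin> V" using V(1) ex_new_if_finite infinite_UNIV_nat by blast
  have "card E \<le> ex3 (card (insert w V)) F"
  proof (rule ex3_ge)
    show "\<not> contains_copy (insert w V, E) F"
    proof
      assume "contains_copy (insert w V, E) F"
      then obtain \<phi> where \<phi>: "inj_on \<phi> (verts F)" "\<forall>e\<in>hedges F. \<phi> ` e \<in> E"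
        by (auto simp: contains_copy_def)
      have "\<phi> ` verts F \<subseteq> V" using assms(2) \<phi>(2) E by blast
      then show False using free \<phi> by (auto simp: contains_copy_def)
    qed
  qed (use V E in auto)
  then show ?thesis using V w cE by simp
qed

lemma bip_free_subset:
  assumes "bip_free t s A B E" "A' \<subseteq> A" "B' \<subseteq> B"
  shows "bip_free t s A' B' {e\<in>E. e \<subseteq> A' \<union> B'}"
  unfolding bip_free_def
proof (intro conjI)
  have H: "hyper3 (A \<union> B) E" "A \<inter> B = {}" "\<And>e. e \<in> E \<Longrightarrow> card (e \<inter> A) = 1 \<and> card (e \<inter> B) = 2"
    "\<not> contains_bip_copy A B (A \<union> B, E) t s" using assms(1) by (auto simp: bip_free_def)
  show "hyper3 (A' \<union> B') {e\<in>E. e \<subseteq> A' \<union> B'}"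
    using H(1) assms(2,3) by (auto simp: hyper3_def intro: finite_subset)
  show "A' \<inter> B' = {}" using assms(2,3) H(2) by auto
  show "\<forall>e\<in>{e\<in>E. e \<subseteq> A' \<union> B'}. card (e \<inter> A') = 1 \<and> card (e \<inter> B') = 2"
  proof
    fix e assume e: "e \<in> {e\<in>E. e \<subseteq> A' \<union> B'}"
    then have "e \<inter> A' = e \<inter> A" "e \<inter> B' = e \<inter> B" using H(2) assms(2,3) by auto
    then show "card (e \<inter> A') = 1 \<and> card (e \<inter> B') = 2" using H(3)[of e] e by auto
  qed
  show "\<not> contains_bip_copy A' B' (A' \<union> B', {e\<in>E. e \<subseteq> A' \<union> B'}) t s"
  proof
    assume "contains_bip_copy A' B' (A' \<union> B', {e\<in>E. e \<subseteq> A' \<union> B'}) t s"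
    then obtain T X Y where "T \<subseteq> A'" "X \<subseteq> B'" "Y \<subseteq> B'" "X \<inter> Y = {}"
      "card T = t" "card X = s" "card Y = s" "hedges (complete3 T X Y) \<subseteq> {e\<in>E. e \<subseteq> A' \<union> B'}"
      unfolding contains_bip_copy_def by auto
    then have "contains_bip_copy A B (A \<union> B, E) t s" unfolding contains_bip_copy_def using assms(2,3)
      by (intro exI[of _ T] exI[of _ X] exI[of _ Y]) auto
    then show False using H(4) by simp
  qed
qed

lemma bip_delete_vertex:
  assumes "bip_free t s (A :: nat set) B E"
  shows "card E \<le> ex3_bip (card (A - {v})) (card (B - {v})) t s + card {e\<in>E. v \<in> e}"
proof -
  have H: "hyper3 (A \<union> B) E" using assms by (simp add: bip_free_def)
  have "card {e\<in>E. e \<subseteq> (A - {v}) \<union> (B - {v})} \<le> ex3_bip (card (A - {v})) (card (B - {v})) t s"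
    by (intro ex3_bip_ge bip_free_subset[OF assms]) auto
  moreover have "{e\<in>E. e \<subseteq> (A - {v}) \<union> (B - {v})} = {e\<in>E. v \<notin> e}" using hyper3.edges[OF H] by blast
  moreover have "card E = card {e\<in>E. v \<notin> e} + card {e\<in>E. v \<in> e}"
    using hyper3.finite_E[OF H] by (subst card_Un_disjoint[symmetric]) (auto intro: arg_cong[where f = card])
  ultimately show ?thesis by simp
qed

text \<open>Every edge has one vertex in \<open>A\<close> and two in \<open>B\<close>, so the
  average degree is |E|/|A| on this side and 2|E|/|B| on the other.\<close>

lemma ex3_bip_Suc_le1:
  assumes "t > 0" "s > 0"
  shows "real (ex3_bip (Suc a) b t s) \<le> real (ex3_bip a b t s) + real (ex3_bip (Suc a) b t s) / real (Suc a)"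
proof -
  obtain A B E where bf: "bip_free t s (A :: nat set) B E" and AB: "card A = Suc a" "card B = b" and cE: "card E = ex3_bip (Suc a) (b) t s"
    using ex3_bip_attained[OF assms] by metis
  have hyp: "hyper3 (A \<union> B) E" and dis: "A \<inter> B = {}" and shape: "\<And>e. e \<in> E \<Longrightarrow> card (e \<inter> A) = 1 \<and> card (e \<inter> B) = 2"
    using bf by (auto simp: bip_free_def)
  have fAB: "finite A" "finite B" using hyper3.fin[OF hyp] by auto
  have "A \<noteq> {}" using AB by auto
  then obtain v where v: "v \<in> A" "card {e\<in>E. v \<in> e} * card A \<le> (\<Sum>e\<in>E. card (e \<inter> A))"
    using exists_low_degree[OF fAB(1) _ hyper3.finite_E[OF hyp]] by blast
  have "(\<Sum>e\<in>E. card (e \<inter> A)) = (\<Sum>e\<in>E. 1)" using shape by (intro sum.cong refl) simp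
  with v AB have deg: "card {e\<in>E. v \<in> e} * Suc a \<le> card E" by simp
  have "v \<notin> B" using v dis by auto
  then have "card E \<le> ex3_bip a b t s + card {e\<in>E. v \<in> e}" using bip_delete_vertex[OF bf, of v] AB v fAB by simp
  moreover have "real (card {e\<in>E. v \<in> e}) \<le> real (card E) / real (Suc a)"
    using deg by (simp add: field_simps del: of_nat_Suc flip: of_nat_mult)
  ultimately show ?thesis using cE by simp
qed

lemma ex3_bip_Suc_le2:
  assumes "t > 0" "s > 0"
  shows "real (ex3_bip a (Suc b) t s) \<le> real (ex3_bip a b t s) + 2 * real (ex3_bip a (Suc b) t s) / real (Suc b)"
proof -
  obtain A B E where bf: "bip_free t s (A :: nat set) B E" and AB: "card A = a" "card B = Suc b" and cE: "card E = ex3_bip (a) (Suc b) t s"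
    using ex3_bip_attained[OF assms] by metis
  have hyp: "hyper3 (A \<union> B) E" and dis: "A \<inter> B = {}" and shape: "\<And>e. e \<in> E \<Longrightarrow> card (e \<inter> A) = 1 \<and> card (e \<inter> B) = 2"
    using bf by (auto simp: bip_free_def)
  have fAB: "finite A" "finite B" using hyper3.fin[OF hyp] by auto
  have "B \<noteq> {}" using AB by auto
  then obtain v where v: "v \<in> B" "card {e\<in>E. v \<in> e} * card B \<le> (\<Sum>e\<in>E. card (e \<inter> B))"
    using exists_low_degree[OF fAB(2) _ hyper3.finite_E[OF hyp]] by blast
  have "(\<Sum>e\<in>E. card (e \<inter> B)) = (\<Sum>e\<in>E. 2)" using shape by (intro sum.cong refl) simp
  with v AB have deg: "card {e\<in>E. v \<in> e} * Suc b \<le> 2 * card E" by simp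
  have "v \<notin> A" using v dis by auto
  then have "card E \<le> ex3_bip a b t s + card {e\<in>E. v \<in> e}" using bip_delete_vertex[OF bf, of v] AB v fAB by simp
  moreover have "real (card {e\<in>E. v \<in> e}) \<le> 2 * real (card E) / real (Suc b)"
    using deg by (simp add: field_simps del: of_nat_Suc flip: of_nat_mult)
  ultimately show ?thesis using cE by simp
qed

lemma ex3_bip_mono_Suc:
  assumes "t > 0" "s > 0"
  shows "ex3_bip a b t s \<le> ex3_bip (Suc a) b t s" "ex3_bip a b t s \<le> ex3_bip a (Suc b) t s"
proof -
  obtain A B E where bf: "bip_free t s (A :: nat set) B E" and AB: "card A = a" "card B = b" and cE: "card E = ex3_bip (a) (b) t s"
    using ex3_bip_attained[OF assms] by metis
  have hyp: "hyper3 (A \<union> B) E" and dis: "A \<inter> B = {}" and shape: "\<And>e. e \<in> E \<Longrightarrow> card (e \<inter> A) = 1 \<and> card (e \<inter> B) = 2"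
    using bf by (auto simp: bip_free_def)
  have fAB: "finite A" "finite B" using hyper3.fin[OF hyp] by auto
  obtain w where w: "w \<notin> A \<union> B" using hyper3.fin[OF hyp] ex_new_if_finite infinite_UNIV_nat by blast
  have ext: "bip_free t s P Q E" if PQ: "P = A \<and> Q = insert w B \<or> P = insert w A \<and> Q = B" for P Q
    unfolding bip_free_def
  proof (intro conjI ballI)
    show "hyper3 (P \<union> Q) E" using hyp PQ by (auto simp: hyper3_def)
    show "P \<inter> Q = {}" using dis w PQ by auto
    fix e assume e: "e \<in> E"
    have "e \<inter> P = e \<inter> A" "e \<inter> Q = e \<inter> B" using hyper3.edges[OF hyp e] w PQ by auto
    then show "card (e \<inter> P) = 1" "card (e \<inter> Q) = 2" using shape[OF e] by simp_all
  next
    show "\<not> contains_bip_copy P Q (P \<union> Q, E) t s"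
    proof
      assume "contains_bip_copy P Q (P \<union> Q, E) t s"
      then obtain T X Y where T: "T \<subseteq> P" "X \<subseteq> Q" "Y \<subseteq> Q" "X \<inter> Y = {}"
        "card T = t" "card X = s" "card Y = s" "hedges (complete3 T X Y) \<subseteq> E"
        unfolding contains_bip_copy_def by auto
      have e: "{v, x, y} \<subseteq> A \<union> B" if "v \<in> T" "x \<in> X" "y \<in> Y" for v x y
      proof -
        have "{v, x, y} \<in> hedges (complete3 T X Y)" using that by (auto simp: complete3_def)
        then show ?thesis using T(8) hyper3.edges[OF hyp] by blast
      qed
      obtain v0 x0 y0 where n: "v0 \<in> T" "x0 \<in> X" "y0 \<in> Y" using T(5-7) assms by (metis card_gt_0_iff ex_in_conv)
      have "w \<notin> T" "w \<notin> X" "w \<notin> Y" using e[of w x0 y0] e[of v0 w y0] e[of v0 x0 w] w n by blast+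
      then have "T \<subseteq> A" "X \<subseteq> B" "Y \<subseteq> B" using T(1-3) PQ by blast+
      then show False using bf T(4-8) unfolding bip_free_def contains_bip_copy_def snd_conv by blast
    qed
  qed
  show "ex3_bip a b t s \<le> ex3_bip (Suc a) b t s" using ex3_bip_ge[OF ext[of "insert w A" B]] cE AB fAB w by simp
  show "ex3_bip a b t s \<le> ex3_bip a (Suc b) t s" using ex3_bip_ge[OF ext[of A "insert w B"]] cE AB fAB w by simp
qed

text \<open>Below \<open>N\<close> monotonicity suffices, above \<open>N\<close> each vertex costs
  at most \<open>K\<close>. Truncated subtraction combines both cases, so that classes smaller than
  n/3 never contribute a gain.\<close>

lemma growth:
  fixes f :: "nat \<Rightarrow> nat"
  assumes mono: "\<And>b. f b \<le> f (Suc b)" and step: "\<And>b. N \<le> b \<Longrightarrow> b < n \<Longrightarrow> real (f (Suc b)) \<le> real (f b) + K"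
    and "a \<le> n"
  shows "real (f a) \<le> real (f N) + real (a - N) * K"
proof (cases "a \<le> N")
  case True
  then have "f a \<le> f N" using lift_Suc_mono_le[of f] mono by blast
  then show ?thesis using True by simp
next
  case False
  then have "N \<le> a" by simp
  then show ?thesis using \<open>a \<le> n\<close>
  proof (induction a rule: dec_induct)
    case base show ?case by simp
  next
    case (step b)
    have "real (f (Suc b)) \<le> real (f b) + K" using assms(2) step by simp
    also have "\<dots> \<le> real (f N) + real (b - N) * K + K" using step by simp
    also have "\<dots> = real (f N) + real (Suc b - N) * K" using step by (simp add: Suc_diff_le algebra_simps)
    finally show ?case .
  qed
qed

text \<open>Deleting a vertex of least degree loses at most 3 f(b+1) / (b+1). With f \<le> C n^(3-g)
  and b + 1 \<ge> n/4 this is at most 12 C n^(2-g), with 12 = 3 * 4; the condition on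
  \<open>N\<close> is met by n div 3.\<close>

lemma growth_ratio:
  fixes f :: "nat \<Rightarrow> nat"
  assumes mono: "\<And>b. f b \<le> f (Suc b)"
    and step: "\<And>b. real (f (Suc b)) \<le> real (f b) + 3 * real (f (Suc b)) / real (Suc b)"
    and bound: "\<And>b. b \<le> n \<Longrightarrow> real (f b) \<le> C * real n powr (3 - g)"
    and a: "a \<le> n" and N: "4 * (N + 1) \<ge> n" and n: "n > 0"
  shows "real (f a) \<le> real (f N) + real (a - N) * (12 * C * real n powr (2 - g))"
proof (rule growth[where f = f and n = n, OF mono _ a])
  fix b assume b: "N \<le> b" "b < n"
  have "real (f (Suc b)) \<le> C * real n powr (3 - g)" using bound b by simp
  then have "3 * real (f (Suc b)) / real (Suc b) \<le> 3 * (C * real n powr (3 - g)) / (real n / 4)"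
    using b N n by (intro frac_le) auto
  also have "\<dots> = 12 * C * (real n powr (3 - g) / real n powr 1)" using n by (simp add: field_simps)
  also have "real n powr (3 - g) / real n powr 1 = real n powr (2 - g)" by (simp only: powr_diff[symmetric]) simp
  finally show "real (f (Suc b)) \<le> real (f b) + 12 * C * real n powr (2 - g)" using step[of b] by simp
qed

lemma K3_covered:
  assumes "t > 0" "s > 0" shows "verts (K3 t s s) \<subseteq> \<Union>(hedges (K3 t s s))"
proof
  fix x assume x: "x \<in> verts (K3 t s s)"
  have "{a, b, c} \<in> hedges (K3 t s s)" if "a < t" "b \<in> {t..<t+s}" "c \<in> {t+s..<t+s+s}" for a b c
    using that by (auto simp: K3_def complete3_def)
  then have "x < t \<Longrightarrow> {x, t, t+s} \<in> hedges (K3 t s s)" "x \<in> {t..<t+s} \<Longrightarrow> {0, x, t+s} \<in> hedges (K3 t s s)"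
    "x \<in> {t+s..<t+s+s} \<Longrightarrow> {0, t, x} \<in> hedges (K3 t s s)" using assms by auto
  moreover have "x < t \<or> x \<in> {t..<t+s} \<or> x \<in> {t+s..<t+s+s}" using x by (auto simp: K3_def complete3_def)
  ultimately show "x \<in> \<Union>(hedges (K3 t s s))" by blast
qed

lemma ex3_K3_growth:
  assumes ts: "t > 0" "s > 0" and n: "n > 0" "a \<le> n" "4 * (N + 1) \<ge> n"
  shows "real (ex3 a (K3 t s s)) \<le> real (ex3 N (K3 t s s)) + real (a - N) * (12 * (kst_const t s + kst_const s s) * real n powr (2 - kst_exponent t s))"
  by (rule growth_ratio[where f = "\<lambda>a. ex3 a (K3 t s s)", OF ex3_mono_Suc ex3_Suc_le])
    (use ts n K3_nonempty K3_covered ex3_K3_bound in auto)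

text \<open>The two sizes are changed one after the other. The degree ratios 1 and 2 of the two
  sides are both weakened to the ratio 3 that \<open>growth_ratio\<close> expects.\<close>

lemma ex3_bip_growth:
  assumes ts: "t > 0" "s > 0" and n: "n > 0" "a \<le> n" "b \<le> n" "4 * (N + 1) \<ge> n" "N \<le> n"
  shows "real (ex3_bip a b t s) \<le> real (ex3_bip N N t s) + (real (a - N) + real (b - N)) * (12 * (kst_const t s + kst_const s s) * real n powr (2 - kst_exponent t s))"
proof -
  have "real (ex3_bip a b t s) \<le> real (ex3_bip N b t s) + real (a - N) * (12 * (kst_const t s + kst_const s s) * real n powr (2 - kst_exponent t s))"
  proof (rule growth_ratio[where f = "\<lambda>a. ex3_bip a b t s", OF ex3_bip_mono_Suc(1)])
    fix c show "real (ex3_bip (Suc c) b t s) \<le> real (ex3_bip c b t s) + 3 * real (ex3_bip (Suc c) b t s) / real (Suc c)"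
      by (rule order_trans[OF ex3_bip_Suc_le1[OF ts]]) (auto intro!: divide_right_mono)
  qed (use ts n ex3_bip_bound in auto)
  moreover have "real (ex3_bip N b t s) \<le> real (ex3_bip N N t s) + real (b - N) * (12 * (kst_const t s + kst_const s s) * real n powr (2 - kst_exponent t s))"
  proof (rule growth_ratio[where f = "\<lambda>b. ex3_bip N b t s", OF ex3_bip_mono_Suc(2)])
    fix c show "real (ex3_bip N (Suc c) t s) \<le> real (ex3_bip N c t s) + 3 * real (ex3_bip N (Suc c) t s) / real (Suc c)"
      by (rule order_trans[OF ex3_bip_Suc_le2[OF ts]]) (auto intro!: divide_right_mono)
  qed (use ts n ex3_bip_bound in auto)
  ultimately show ?thesis by (simp add: algebra_simps)
qed

subsection \<open>Embedding the forbidden 3-graph, and the lower bound\<close>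

lemma turan_part_bij: "i < 3 \<Longrightarrow> bij_betw (\<lambda>v. v div 3) (turan_part (3 * m) i) {..<m}"
proof (rule bij_betw_byWitness[where f' = "\<lambda>k. 3 * k + i"])
  assume i: "i < 3"
  show "\<forall>a\<in>turan_part (3 * m) i. 3 * (a div 3) + i = a" by (auto simp: turan_part_def)
  show "\<forall>k\<in>{..<m}. (3 * k + i) div 3 = k" using i by auto
  show "(\<lambda>v. v div 3) ` turan_part (3 * m) i \<subseteq> {..<m}" by (auto simp: turan_part_def)
  show "(\<lambda>k. 3 * k + i) ` {..<m} \<subseteq> turan_part (3 * m) i" using i by (auto simp: turan_part_def)
qed

lemma contains_copyI_F5S:
  fixes P0 P1 P2 :: "'a set"
  assumes fin: "finite P0" "finite P1" "finite P2" "finite T"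
    and c: "card P0 = m" "card P1 = m" "card P2 = m" "card T = t"
    and S: "S0 \<subseteq> P0" "S1 \<subseteq> P0" "S0 \<inter> S1 = {}" "card S0 = s" "card S1 = s"
    and sub: "P0 \<subseteq> V" "P1 \<subseteq> V" "P2 \<subseteq> V" "T \<subseteq> V"
    and disj: "P0 \<inter> P1 = {}" "P0 \<inter> P2 = {}" "P1 \<inter> P2 = {}" "T \<inter> (P0 \<union> P1 \<union> P2) = {}"
    and E: "\<And>a b c. a \<in> P0 \<Longrightarrow> b \<in> P1 \<Longrightarrow> c \<in> P2 \<Longrightarrow> {a, b, c} \<in> E"
    and ET: "\<And>v x y. v \<in> T \<Longrightarrow> x \<in> S0 \<Longrightarrow> y \<in> S1 \<Longrightarrow> {v, x, y} \<in> E"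
  shows "contains_copy (V, E) (F5S m t s)"
proof -
  have fS: "finite S0" "finite S1" using S fin(1) finite_subset by auto
  have m: "2 * s \<le> m"
    using card_mono[OF fin(1), of "S0 \<union> S1"] S fS c by (simp add: card_Un_disjoint)
  obtain g0 where g0: "bij_betw g0 {..<s} S0" using finite_same_card_bij[of "{..<s}" S0] fS S by auto
  obtain g1 where g1: "bij_betw g1 {s..<2*s} S1" using finite_same_card_bij[of "{s..<2*s}" S1] fS S by auto
  have "card (P0 - S0 - S1) = m - 2 * s"
  proof -
    have "card (P0 - (S0 \<union> S1)) = m - card (S0 \<union> S1)"
      using S fS c by (subst card_Diff_subset) auto
    moreover have "P0 - S0 - S1 = P0 - (S0 \<union> S1)" by auto
    ultimately show ?thesis using S fS by (simp add: card_Un_disjoint)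
  qed
  then obtain g2 where g2: "bij_betw g2 {2*s..<m} (P0 - S0 - S1)"
    using finite_same_card_bij[of "{2*s..<m}" "P0 - S0 - S1"] fin by auto
  \<comment> \<open>\<open>P0\<close> is enumerated with \<open>S0\<close> at the start and
    \<open>S1\<close> next, because \<open>F5S\<close> takes its two s-sets to be the first and the
    second \<open>s\<close> multiples of 3.\<close>
  define f0 where "f0 i = (if i < s then g0 i else if i < 2 * s then g1 i else g2 i)" for i
  have h0: "bij_betw f0 {..<s} S0" using g0 by (rule bij_betw_cong[THEN iffD1, rotated]) (auto simp: f0_def)
  have h1: "bij_betw f0 {s..<2*s} S1" using g1 by (rule bij_betw_cong[THEN iffD1, rotated]) (auto simp: f0_def)
  have h2: "bij_betw f0 {2*s..<m} (P0 - S0 - S1)" using g2 by (rule bij_betw_cong[THEN iffD1, rotated]) (auto simp: f0_def)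
  have "bij_betw f0 ({..<s} \<union> {s..<2*s} \<union> {2*s..<m}) (S0 \<union> S1 \<union> (P0 - S0 - S1))"
    using S by (intro bij_betw_combine h0 h1 h2) auto
  moreover have "{..<s} \<union> {s..<2*s} \<union> {2*s..<m} = {..<m}" using m by auto
  moreover have "S0 \<union> S1 \<union> (P0 - S0 - S1) = P0" using S by auto
  ultimately have f0: "bij_betw f0 {..<m} P0" by simp
  obtain f1 where f1: "bij_betw f1 {..<m} P1" using finite_same_card_bij[of "{..<m}" P1] fin c by auto
  obtain f2 where f2: "bij_betw f2 {..<m} P2" using finite_same_card_bij[of "{..<m}" P2] fin c by auto
  obtain fT where fT: "bij_betw fT {3*m..<3*m+t} T" using finite_same_card_bij[of "{3*m..<3*m+t}" T] fin c by auto
  define \<phi> where "\<phi> v = (if v < 3 * m then (if v mod 3 = 0 then f0 (v div 3) else if v mod 3 = 1 then f1 (v div 3) else f2 (v div 3)) else fT v)" for v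
  have p0: "bij_betw \<phi> (turan_part (3*m) 0) P0"
    using bij_betw_trans[OF turan_part_bij f0, of 0] by (rule bij_betw_cong[THEN iffD1, rotated] ) (auto simp: \<phi>_def turan_part_def)
  have p1: "bij_betw \<phi> (turan_part (3*m) 1) P1"
    using bij_betw_trans[OF turan_part_bij f1, of 1] by (rule bij_betw_cong[THEN iffD1, rotated] ) (auto simp: \<phi>_def turan_part_def)
  have p2: "bij_betw \<phi> (turan_part (3*m) 2) P2"
    using bij_betw_trans[OF turan_part_bij f2, of 2] by (rule bij_betw_cong[THEN iffD1, rotated] ) (auto simp: \<phi>_def turan_part_def)
  have pT: "bij_betw \<phi> {3*m..<3*m+t} T" using fT by (rule bij_betw_cong[THEN iffD1, rotated]) (auto simp: \<phi>_def)
  let ?W = "turan_part (3*m) 0 \<union> turan_part (3*m) 1 \<union> turan_part (3*m) 2 \<union> {3*m..<3*m+t}"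
  have W: "verts (F5S m t s) = ?W" by (auto simp: F5S_def Let_def turan3_def complete3_def)
  have "bij_betw \<phi> ?W (P0 \<union> P1 \<union> P2 \<union> T)"
    using disj by (intro bij_betw_combine p0 p1 p2 pT) auto
  then have "inj_on \<phi> (verts (F5S m t s))" "\<phi> ` verts (F5S m t s) \<subseteq> V"
    unfolding W using sub by (simp_all add: bij_betw_def)
  moreover have "\<phi> ` e \<in> E" if "e \<in> hedges (F5S m t s)" for e
  proof -
    from that consider "e \<in> hedges (turan3 (3 * m))" | "e \<in> hedges (complete3 {3 * m..<3 * m + t} ((\<lambda>i. 3 * i) ` {..<s}) ((\<lambda>i. 3 * i) ` {s..<2 * s}))"
      by (auto simp: F5S_def Let_def)
    then show ?thesis
    proof cases
      case 1
      then obtain a b c where e: "e = {a, b, c}" "a \<in> turan_part (3*m) 0" "b \<in> turan_part (3*m) 1" "c \<in> turan_part (3*m) 2"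
        unfolding turan3_def complete3_def snd_conv mem_Collect_eq by blast
      have "{\<phi> a, \<phi> b, \<phi> c} \<in> E"
        using bij_betwE[OF p0] bij_betwE[OF p1] bij_betwE[OF p2] e by (intro E) blast+
      then show ?thesis by (simp add: e(1))
    next
      case 2
      then obtain v x y where e: "e = {v, 3 * x, 3 * y}" "v \<in> {3*m..<3*m+t}" "x \<in> {..<s}" "y \<in> {s..<2*s}"
        unfolding complete3_def snd_conv mem_Collect_eq by blast
      have "\<phi> (3 * x) = f0 x" "\<phi> (3 * y) = f0 y" using e m by (auto simp: \<phi>_def)
      moreover have "f0 x \<in> S0" "f0 y \<in> S1" "\<phi> v \<in> T"
        using bij_betwE[OF h0] bij_betwE[OF h1] bij_betwE[OF pT] e by blast+
      ultimately have "{\<phi> v, \<phi> (3 * x), \<phi> (3 * y)} \<in> E" using ET by simp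
      then show ?thesis by (simp add: e(1))
    qed
  qed
  ultimately show ?thesis unfolding contains_copy_def by (intro exI[of _ \<phi>]) auto
qed

text \<open>The classes of c and d together play one part of T_3(3m,3), those of a and b the other
  two parts. Then S_0 can be chosen in the class of c and S_1 in that of d, and the edges cdw supply
  the triples through T.\<close>

lemma F5_blowup_contains_F5S:
  fixes E :: "'a set set"
  assumes E: "\<And>e. e \<in> E \<Longrightarrow> e \<subseteq> V \<and> card e = 3" and V: "finite V"
    and ms: "2 * s \<le> m" "m \<le> M" "t \<le> M" and s: "s > 0" and t: "t > 0"
    and c: "card A = M" "card B = M" "card C = M" "card D = M" "card T = M"
    and sub: "A \<subseteq> V" "B \<subseteq> V" "C \<subseteq> V" "D \<subseteq> V" "T \<subseteq> V"
    and e: "\<And>a b c. a \<in> A \<Longrightarrow> b \<in> B \<Longrightarrow> c \<in> C \<Longrightarrow> {a, b, c} \<in> E"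
      "\<And>a b d. a \<in> A \<Longrightarrow> b \<in> B \<Longrightarrow> d \<in> D \<Longrightarrow> {a, b, d} \<in> E"
      "\<And>c d v. c \<in> C \<Longrightarrow> d \<in> D \<Longrightarrow> v \<in> T \<Longrightarrow> {c, d, v} \<in> E"
    and disj: "T \<inter> A = {}" "T \<inter> B = {}"
  shows "contains_copy (V, E) (F5S m t s)"
proof -
  have d3: "x \<noteq> y \<and> y \<noteq> z \<and> x \<noteq> z" if "{x, y, z} \<in> E" for x y z
    using E[OF that] by (auto simp: card_insert_if split: if_splits)
  have ne: "A \<noteq> {}" "B \<noteq> {}" "C \<noteq> {}" "D \<noteq> {}" "T \<noteq> {}" using c ms s by auto
  \<comment> \<open>Two classes that meet a common edge of F_5 are disjoint because edges have three
    elements. Only the class of w against those of a and b escapes this, hence the assumption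
    \<open>disj\<close>.\<close>
  have dd: "A \<inter> B = {}" "A \<inter> C = {}" "A \<inter> D = {}" "B \<inter> C = {}" "B \<inter> D = {}" "C \<inter> D = {}" "C \<inter> T = {}" "D \<inter> T = {}"
    using e(1)[THEN d3] e(2)[THEN d3] e(3)[THEN d3] ne by blast+
  obtain A' where A': "A' \<subseteq> A" "card A' = m" using obtain_subset_with_card_n[of m A] c ms by auto
  obtain B' where B': "B' \<subseteq> B" "card B' = m" using obtain_subset_with_card_n[of m B] c ms by auto
  obtain C' where C': "C' \<subseteq> C" "card C' = m - s"
  proof -
    have "m - s \<le> card C" using c ms by linarith
    then show ?thesis using that obtain_subset_with_card_n by metis
  qed
  obtain S0 where S0: "S0 \<subseteq> C'" "card S0 = s"
  proof -
    have "s \<le> card C'" using C' ms by linarith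
    then show ?thesis using that obtain_subset_with_card_n by metis
  qed
  obtain S1 where S1: "S1 \<subseteq> D" "card S1 = s" using obtain_subset_with_card_n[of s D] c ms by auto
  obtain T' where T': "T' \<subseteq> T" "card T' = t" using obtain_subset_with_card_n[of t T] c ms by auto
  have f: "finite X" if "X \<subseteq> V" for X using that V finite_subset by auto
  show ?thesis
  proof (rule contains_copyI_F5S[of "C' \<union> S1" A' B' T' m t S0 S1 s])
    have "finite C'" "finite S1" using C' S1 sub by (auto intro!: f)
    moreover have "C' \<inter> S1 = {}" using C' S1 dd by auto
    ultimately show "card (C' \<union> S1) = m" using C' S1 ms by (simp add: card_Un_disjoint)
    show "{a, b, c} \<in> E" if "a \<in> C' \<union> S1" "b \<in> A'" "c \<in> B'" for a b c
    proof -
      have "{b, c, a} \<in> E" using that e(1)[of b c a] e(2)[of b c a] A' B' C' S1 by blast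
      then show ?thesis by (simp add: insert_commute)
    qed
    show "{v, x, y} \<in> E" if "v \<in> T'" "x \<in> S0" "y \<in> S1" for v x y
    proof -
      have "{x, y, v} \<in> E" using that e(3)[of x y v] T' S0 S1 C' by blast
      then show ?thesis by (simp add: insert_commute)
    qed
    show "finite (C' \<union> S1)" "finite A'" "finite B'" "finite T'"
      using A' B' C' S1 T' sub by (blast intro!: f)+
    show "card A' = m" "card B' = m" "card T' = t" "card S0 = s" "card S1 = s" by fact+
    show "S0 \<subseteq> C' \<union> S1" "S1 \<subseteq> C' \<union> S1" using S0 by auto
    show "S0 \<inter> S1 = {}" using S0(1) C'(1) S1(1) dd(6) by blast
    show "(C' \<union> S1) \<inter> A' = {}" using A'(1) C'(1) S1(1) dd(2,3) by blast
    show "(C' \<union> S1) \<inter> B' = {}" using B'(1) C'(1) S1(1) dd(4,5) by blast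
    show "A' \<inter> B' = {}" using A'(1) B'(1) dd(1) by blast
    show "T' \<inter> (C' \<union> S1 \<union> A' \<union> B') = {}"
      using A'(1) B'(1) C'(1) S1(1) T'(1) dd(7,8) disj by blast
    show "C' \<union> S1 \<subseteq> V" "A' \<subseteq> V" "B' \<subseteq> V" "T' \<subseteq> V" using A' B' C' S1 T' sub by blast+
  qed
qed

section \<open>The lower bound construction\<close>

lemma K3_free_inside:
  fixes U :: "nat set"
  assumes "finite U" "N \<le> card U" "t > 0" "s > 0"
  obtains E where "\<And>e. e \<in> E \<Longrightarrow> e \<subseteq> U \<and> card e = 3" "\<not> contains_copy (U, E) (K3 t s s)" "card E = ex3 N (K3 t s s)"
proof -
  have ne: "hedges (K3 t s s) \<noteq> {}" using K3_nonempty assms by auto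
  obtain W E where hyp: "hyper3 (W :: nat set) E" and Wc: "card W = N" and free: "\<not> contains_copy (W, E) (K3 t s s)"
    and cE: "card E = ex3 N (K3 t s s)" using ex3_attained[OF ne] by metis
  note W = hyper3.fin[OF hyp] Wc and E = hyper3.edges[OF hyp]
  obtain f where f: "inj_on f W" "f ` W \<subseteq> U"
    using card_le_inj[OF W(1) assms(1)] W(2) assms(2) by auto
  have inj: "inj_on ((`) f) E"
    using inj_on_image_Pow[OF f(1)] by (rule inj_on_subset) (use E in auto)
  show thesis
  proof (rule that[of "(`) f ` E"])
    show "e \<subseteq> U \<and> card e = 3" if "e \<in> (`) f ` E" for e
      using that E f card_image[OF inj_on_subset[OF f(1)]] by fastforce
    show "card ((`) f ` E) = ex3 N (K3 t s s)" using card_image[OF inj] cE by simp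
    show "\<not> contains_copy (U, (`) f ` E) (K3 t s s)"
    proof
      assume "contains_copy (U, (`) f ` E) (K3 t s s)"
      then obtain \<phi> where \<phi>: "inj_on \<phi> (verts (K3 t s s))" "\<forall>e\<in>hedges (K3 t s s). \<phi> ` e \<in> (`) f ` E"
        by (auto simp: contains_copy_def)
      have "\<phi> ` verts (K3 t s s) \<subseteq> f ` W" using K3_covered[OF assms(3,4)] \<phi>(2) E by blast
      then have "contains_copy (f ` W, (`) f ` E) (K3 t s s)" using \<phi> by (auto simp: contains_copy_def)
      then have "contains_copy (W, E) (K3 t s s)" by (rule contains_copy_image[OF f(1)]) (use E in auto)
      then show False using free by simp
    qed
  qed
qed

lemma card_turan_part:
  assumes "i < 3" shows "n div 3 \<le> card (turan_part n i)"
proof -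
  have "(\<lambda>k. 3 * k + i) ` {..<n div 3} \<subseteq> turan_part n i" using assms by (auto simp: turan_part_def)
  moreover have "inj_on (\<lambda>k. 3 * k + i) {..<n div 3}" by (auto simp: inj_on_def)
  moreover have "finite (turan_part n i)" by (simp add: turan_part_def)
  ultimately show ?thesis using card_inj_on_le[of "\<lambda>k. 3 * k + i" "{..<n div 3}"] by simp
qed

lemma F5S_main_edge: "a \<in> turan_part (3*m) 0 \<Longrightarrow> b \<in> turan_part (3*m) 1 \<Longrightarrow> c \<in> turan_part (3*m) 2
  \<Longrightarrow> {a, b, c} \<in> hedges (F5S m t s)"
  unfolding F5S_def Let_def turan3_def complete3_def snd_conv by (rule UnI1) blast

lemma F5S_T_edge: "v \<in> {3*m..<3*m+t} \<Longrightarrow> x \<in> (\<lambda>i. 3 * i) ` {..<s} \<Longrightarrow> y \<in> (\<lambda>i. 3 * i) ` {s..<2*s}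
  \<Longrightarrow> {v, x, y} \<in> hedges (F5S m t s)"
  unfolding F5S_def Let_def complete3_def snd_conv by (rule UnI2) blast

lemma F5S_nonempty: "m > 0 \<Longrightarrow> hedges (F5S m t s) \<noteq> {}"
proof -
  assume "m > 0"
  then have "{0, 1, 2} \<in> hedges (F5S m t s)" by (intro F5S_main_edge) (auto simp: turan_part_def)
  then show ?thesis by blast
qed

lemma turan3_edges_subset: "e \<in> hedges (turan3 n) \<Longrightarrow> e \<subseteq> {..<n} \<and> card e = 3"
proof -
  assume "e \<in> hedges (turan3 n)"
  then obtain a b c where e: "e = {a, b, c}" "a \<in> turan_part n 0" "b \<in> turan_part n 1" "c \<in> turan_part n 2"
    unfolding turan3_def complete3_def snd_conv mem_Collect_eq by blast
  then have "a \<noteq> b" "b \<noteq> c" "a \<noteq> c" by (auto simp: turan_part_def)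
  then show ?thesis using e by (auto simp: turan_part_def)
qed

text \<open>In a rainbow or monochromatic edge the colours sum to 0 modulo 3, so two of them
  determine the third. Vertices that form edges with a common pair therefore share a colour.\<close>

lemma third_colour:
  fixes a b c :: nat
  assumes "a < 3" "b < 3" "c < 3" "(a \<noteq> b \<and> b \<noteq> c \<and> a \<noteq> c) \<or> (a = b \<and> c = b)"
  shows "a = (if b = c then b else 3 - b - c)"
proof -
  have "x = 0 \<or> x = 1 \<or> x = 2" if "x < 3" for x :: nat using that by linarith
  from this[OF assms(1)] this[OF assms(2)] this[OF assms(3)] assms(4) show ?thesis by auto
qed

lemma ex3_F5S_lower:
  assumes ms: "m > 0" "2 * s \<le> m" and t: "t > 0" and s: "s > 0"
  shows "card (hedges (turan3 n)) + 3 * ex3 (n div 3) (K3 t s s) \<le> ex3 n (F5S m t s)"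
proof -
  have "\<exists>E. (\<forall>e\<in>E. e \<subseteq> turan_part n i \<and> card e = 3) \<and> \<not> contains_copy (turan_part n i, E) (K3 t s s)
    \<and> card E = ex3 (n div 3) (K3 t s s)" if "i < 3" for i
  proof -
    have f: "finite (turan_part n i)" by (simp add: turan_part_def)
    show ?thesis by (rule K3_free_inside[OF f card_turan_part[OF that] t s]) blast
  qed
  then obtain J where J: "\<And>i e. i < 3 \<Longrightarrow> e \<in> J i \<Longrightarrow> e \<subseteq> turan_part n i \<and> card e = 3"
    "\<And>i. i < 3 \<Longrightarrow> \<not> contains_copy (turan_part n i, J i) (K3 t s s)"
    "\<And>i. i < 3 \<Longrightarrow> card (J i) = ex3 (n div 3) (K3 t s s)" by metis
  define E where "E = hedges (turan3 n) \<union> (J 0 \<union> J 1 \<union> J 2)"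
  have J3: "e \<subseteq> {..<n} \<and> card e = 3 \<and> (\<forall>x\<in>e. x mod 3 = i)" if "i < 3" "e \<in> J i" for e i
    using J(1)[OF that] by (auto simp: turan_part_def)
  have E3: "e \<subseteq> {..<n} \<and> card e = 3" if "e \<in> E" for e
    using that turan3_edges_subset[of e n] J3[of 0 e] J3[of 1 e] J3[of 2 e] by (auto simp: E_def)
  have colours: "(x mod 3 \<noteq> y mod 3 \<and> y mod 3 \<noteq> z mod 3 \<and> x mod 3 \<noteq> z mod 3) \<or>
       (x mod 3 = y mod 3 \<and> z mod 3 = y mod 3 \<and> {x, y, z} \<in> J (y mod 3))" if "{x, y, z} \<in> E" for x y z
  proof -
    have "{x, y, z} \<in> hedges (turan3 n) \<or> (\<exists>i<3. {x, y, z} \<in> J i)" using that by (auto simp: E_def)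
    then show ?thesis
    proof
      assume "{x, y, z} \<in> hedges (turan3 n)"
      then obtain a b c where e: "{x, y, z} = {a, b, c}" "a \<in> turan_part n 0" "b \<in> turan_part n 1" "c \<in> turan_part n 2"
        unfolding turan3_def complete3_def snd_conv mem_Collect_eq by blast
      then have m3: "a mod 3 = 0" "b mod 3 = 1" "c mod 3 = 2" by (auto simp: turan_part_def)
      have "inj_on (\<lambda>v. v mod 3) {a, b, c}" using m3 by (auto simp: inj_on_def)
      then have inj: "inj_on (\<lambda>v. v mod 3) {x, y, z}" using e by simp
      have "card {x, y, z} = 3" using E3[OF that] by simp
      then have "x \<noteq> y" "y \<noteq> z" "x \<noteq> z" by (auto simp: card_insert_if split: if_splits)
      then show ?thesis using inj by (auto simp: inj_on_def)
    next
      assume "\<exists>i<3. {x, y, z} \<in> J i"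
      then obtain i where i: "i < 3" "{x, y, z} \<in> J i" by auto
      then have "x mod 3 = i" "y mod 3 = i" "z mod 3 = i" using J3[OF i] by auto
      then show ?thesis using i by simp
    qed
  qed
  have free: "\<not> contains_copy ({..<n}, E) (F5S m t s)"
  proof
    assume "contains_copy ({..<n}, E) (F5S m t s)"
    then obtain \<phi> where \<phi>: "inj_on \<phi> (verts (F5S m t s))" "\<phi> ` verts (F5S m t s) \<subseteq> {..<n}"
      "\<And>e. e \<in> hedges (F5S m t s) \<Longrightarrow> \<phi> ` e \<in> E" unfolding contains_copy_def by auto
    define k where "k v = \<phi> v mod 3" for v
    have k3: "k v < 3" for v by (simp add: k_def)
    \<comment> \<open>The vertices 1 and 2 represent the second and third part of the T_3(3m,3)
      inside \<open>F5S\<close>; every vertex of the first part forms an edge with this pair, so the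
      whole first part is mapped into one colour class.\<close>
    have main: "{\<phi> a, \<phi> 1, \<phi> 2} \<in> E" if "a \<in> turan_part (3*m) 0" for a
    proof -
      have "{a, 1, 2} \<in> hedges (F5S m t s)"
        using that ms(1) by (intro F5S_main_edge) (auto simp: turan_part_def)
      from \<phi>(3)[OF this] show ?thesis by simp
    qed
    have mono: "k a = (if k 1 = k 2 then k 1 else 3 - k 1 - k 2)" if "a \<in> turan_part (3*m) 0" for a
    proof -
      have "(k a \<noteq> k 1 \<and> k 1 \<noteq> k 2 \<and> k a \<noteq> k 2) \<or> (k a = k 1 \<and> k 2 = k 1)"
        using colours[OF main[OF that]] unfolding k_def by blast
      then show ?thesis by (rule third_colour[OF k3 k3 k3])
    qed
    define i where "i = (if k 1 = k 2 then k 1 else 3 - k 1 - k 2)"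
    let ?S0 = "(\<lambda>i. 3 * i) ` {..<s}" and ?S1 = "(\<lambda>i. 3 * i) ` {s..<2*s}" and ?T = "{3*m..<3*m+t}"
    have S: "?S0 \<subseteq> turan_part (3*m) 0" "?S1 \<subseteq> turan_part (3*m) 0" using ms by (auto simp: turan_part_def)
    then have kS: "\<And>x. x \<in> ?S0 \<union> ?S1 \<Longrightarrow> k x = i" using mono i_def by blast
    have "k 0 = i" using kS[of 0] s by auto
    then have i3: "i < 3" using k3[of 0] by simp
    have TE: "k v = i \<and> {\<phi> v, \<phi> x, \<phi> y} \<in> J i" if "v \<in> ?T" "x \<in> ?S0" "y \<in> ?S1" for v x y
    proof -
      have "{\<phi> v, \<phi> x, \<phi> y} \<in> E" using \<phi>(3)[OF F5S_T_edge[OF that]] by simp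
      \<comment> \<open>Since x and y share the colour \<open>i\<close>, the edge is not rainbow; it
        is monochromatic, which pulls v into the same part.\<close>
      from colours[OF this] have "k x \<noteq> k y \<or> (k v = k x \<and> {\<phi> v, \<phi> x, \<phi> y} \<in> J (k x))"
        unfolding k_def by metis
      moreover have "k x = i" "k y = i" using kS that by blast+
      ultimately show ?thesis by simp
    qed
    have inV: "?S0 \<union> ?S1 \<union> ?T \<subseteq> verts (F5S m t s)"
      using S by (auto simp: F5S_def Let_def turan3_def complete3_def)
    have inj: "inj_on \<phi> A" if "A \<subseteq> ?S0 \<union> ?S1 \<union> ?T" for A
      by (rule inj_on_subset[OF \<phi>(1)]) (rule order_trans[OF that inV])
    have kT: "k v = i" if "v \<in> ?T" for v
    proof -
      have "0 \<in> ?S0" "3 * s \<in> ?S1" using s by auto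
      then show ?thesis using TE[OF that, of 0 "3 * s"] by simp
    qed
    have col: "\<phi> x \<in> turan_part n i" if "x \<in> ?S0 \<union> ?S1 \<union> ?T" for x
    proof -
      have "k x = i" using that kS[of x] kT[of x] by (elim UnE) simp_all
      moreover have "\<phi> x \<in> {..<n}" by (rule subsetD[OF \<phi>(2)], rule imageI, rule subsetD[OF inV that])
      ultimately show ?thesis by (simp add: turan_part_def k_def)
    qed
    have dis: "\<phi> ` A \<inter> \<phi> ` B = {}" if "A \<inter> B = {}" "A \<subseteq> ?S0 \<union> ?S1 \<union> ?T" "B \<subseteq> ?S0 \<union> ?S1 \<union> ?T" for A B
      using inj_on_image_Int[OF inj[OF order_refl] that(2,3)] that(1) by auto
    have Tm: "?T \<inter> turan_part (3*m) 0 = {}" by (auto simp: turan_part_def)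
    have "contains_copy (turan_part n i, J i) (K3 t s s)"
    proof (rule contains_copyI_K3[of "\<phi> ` ?T" "\<phi> ` ?S0" "\<phi> ` ?S1"])
      show "card (\<phi> ` ?T) = t" by (subst card_image[OF inj]) auto
      show "card (\<phi> ` ?S0) = s" by (subst card_image[OF inj]) (auto simp: card_image inj_on_def)
      show "card (\<phi> ` ?S1) = s" by (subst card_image[OF inj]) (auto simp: card_image inj_on_def)
      show "\<phi> ` ?T \<subseteq> turan_part n i" "\<phi> ` ?S0 \<subseteq> turan_part n i" "\<phi> ` ?S1 \<subseteq> turan_part n i"
        by (intro image_subsetI col; simp)+
      show "\<phi> ` ?T \<inter> \<phi> ` ?S0 = {}" "\<phi> ` ?T \<inter> \<phi> ` ?S1 = {}" using S Tm by (intro dis; blast)+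
      show "\<phi> ` ?S0 \<inter> \<phi> ` ?S1 = {}" by (intro dis) auto
      show "{v, x, y} \<in> J i" if "v \<in> \<phi> ` ?T" "x \<in> \<phi> ` ?S0" "y \<in> \<phi> ` ?S1" for v x y
        using that TE by blast
    qed auto
    then show False using J(2)[OF i3] by simp
  qed
  have "card E \<le> ex3 (card {..<n}) (F5S m t s)"
    by (rule ex3_ge) (use E3 free in auto)
  moreover have "card E = card (hedges (turan3 n)) + (card (J 0) + card (J 1) + card (J 2))"
  proof -
    have fin: "finite E" using E3 by (intro finite_subset[of E "Pow {..<n}"]) auto
    have disj: "J i \<inter> J j = {}" if "i < 3" "j < 3" "i \<noteq> j" for i j
    proof (rule ccontr)
      assume "J i \<inter> J j \<noteq> {}"
      then obtain e where e: "e \<in> J i" "e \<in> J j" by blast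
      then have "e \<noteq> {}" using J3[OF that(1)] by fastforce
      then show False using J3[OF that(1) e(1)] J3[OF that(2) e(2)] that(3) by auto
    qed
    have "hedges (turan3 n) \<inter> J i = {}" if i: "i < 3" for i
    proof (rule ccontr)
      assume "\<not> ?thesis"
      then obtain e where e: "e \<in> hedges (turan3 n)" "e \<in> J i" by blast
      then obtain a b c where "e = {a, b, c}" "a \<in> turan_part n 0" "b \<in> turan_part n 1"
        unfolding turan3_def complete3_def snd_conv mem_Collect_eq by blast
      then show False using J3[OF i e(2)] by (auto simp: turan_part_def)
    qed
    then have "hedges (turan3 n) \<inter> (J 0 \<union> J 1 \<union> J 2) = {}" by (simp add: Int_Un_distrib)
    moreover have "(J 0 \<union> J 1) \<inter> J 2 = {}" "J 0 \<inter> J 1 = {}" using disj[of 0 2] disj[of 1 2] disj[of 0 1] by auto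
    ultimately show ?thesis using fin unfolding E_def by (simp add: card_Un_disjoint)
  qed
  ultimately show ?thesis using J(3) by simp
qed

section \<open>Counts over ordered tuples\<close>

lemma card_of_bool: "finite V \<Longrightarrow> real (card {v\<in>V. P v}) = (\<Sum>v\<in>V. of_bool (P v))"
  by (simp add: of_bool_def sum.If_cases Int_def)

text \<open>AM-GM for p, q and 1/(pq): the left side is the tangent plane of 1/(pq) at p = q = 1.
  With r = sqrt (p q) it reduces to 2r^3 - 3r^2 + 1 = (r - 1)^2 (2r + 1) \<ge> 0.\<close>

lemma three_term_amgm:
  fixes p q :: real
  assumes "p > 0" "q > 0"
  shows "3 - p - q \<le> 1 / (p * q)"
proof -
  define r where "r = sqrt (p * q)"
  have r: "r > 0" "r ^ 2 = p * q" using assms by (auto simp: r_def)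
  have "2 * r \<le> p + q"
    using arith_geo_mean_sqrt[of p q] assms by (simp add: r_def)
  then have "r ^ 2 * (2 * r) \<le> r ^ 2 * (p + q)" by (intro mult_left_mono) auto
  moreover have "(r - 1) ^ 2 * (2 * r + 1) \<ge> 0" using r by auto
  ultimately have "(3 - p - q) * (p * q) \<le> 1"
    unfolding r(2)[symmetric] by (simp add: algebra_simps power2_eq_square)
  then show ?thesis using assms by (simp add: field_simps)
qed

context hyper3 begin

text \<open>From here on configurations are counted as sums of indicators over ordered tuples, so
  that coordinates can be permuted by exchanging sums; each edge contributes six ordered
  triples.\<close>

definition h :: "'a \<Rightarrow> 'a \<Rightarrow> 'a \<Rightarrow> bool" where "h x y z \<longleftrightarrow> {x, y, z} \<in> E"

abbreviation "n \<equiv> real (card V)"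

lemma h_sym: "h x y z = h y x z" "h x y z = h x z y"
  by (simp_all add: h_def insert_commute)

lemma h_D: "h x y z \<Longrightarrow> x \<in> V \<and> y \<in> V \<and> z \<in> V \<and> x \<noteq> y \<and> y \<noteq> z \<and> x \<noteq> z"
  unfolding h_def by (drule edges) (auto simp: card_insert_if split: if_splits)

text \<open>Counts homomorphisms of F_5 = {abc, abd, cdw}: w may coincide with a or b. Those
  degenerate tuples number only O(n^4).\<close>

definition F5_count :: real where
  "F5_count = (\<Sum>a\<in>V. \<Sum>b\<in>V. \<Sum>c\<in>V. \<Sum>d\<in>V. \<Sum>w\<in>V. of_bool (h a b c \<and> h a b d \<and> h c d w))"

definition codeg :: "'a \<Rightarrow> 'a \<Rightarrow> real" where "codeg x y = (\<Sum>z\<in>V. of_bool (h x y z))"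

definition N_edges :: real where "N_edges = (\<Sum>x\<in>V. \<Sum>y\<in>V. \<Sum>z\<in>V. of_bool (h x y z))"

end

subsection \<open>Stability\<close>

text \<open>
  Deleting only the edges with a pair of codegree below \<open>\<eta> n\<close> makes every wedge that violates the
  \<open>F\<^sub>5\<close>-free inequalities extend to at least \<open>\<eta> n\<close> copies of \<open>F\<^sub>5\<close>; no removal lemma is needed.
  \<open>G\<close> is the resulting robust shadow, and \<open>d\<close>, \<open>g\<close> are codegrees in \<open>h'\<close> and degrees in \<open>G\<close>.
\<close>

locale hyper3_thr = hyper3 +
  fixes \<eta> :: real
  assumes eta: "\<eta> > 0" and Vpos: "card V > 0"
begin

definition G :: "'a \<Rightarrow> 'a \<Rightarrow> bool" where "G x y \<longleftrightarrow> \<eta> * n \<le> codeg x y"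

definition h' :: "'a \<Rightarrow> 'a \<Rightarrow> 'a \<Rightarrow> bool" where "h' x y z \<longleftrightarrow> h x y z \<and> G x y \<and> G y z \<and> G x z"

definition d :: "'a \<Rightarrow> 'a \<Rightarrow> real" where "d x y = (\<Sum>z\<in>V. of_bool (h' x y z))"

definition g :: "'a \<Rightarrow> real" where "g x = (\<Sum>y\<in>V. of_bool (G x y))"

definition shadow_sum :: "('a \<Rightarrow> 'a \<Rightarrow> 'a \<Rightarrow> real) \<Rightarrow> real" where
  "shadow_sum \<phi> = (\<Sum>x\<in>V. \<Sum>y\<in>V. \<Sum>z\<in>V. of_bool (h' x y z) * \<phi> x y z)"

text \<open>Without F_5, no vertex is joined both to the pair ab by an edge and to c by a shadow
  pair when abc is an edge. This counts the violations in the robust setting.\<close>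

definition overlap :: real where
  "overlap = shadow_sum (\<lambda>a b c. \<Sum>v\<in>V. of_bool (h' a b v \<and> G c v))"

abbreviation "N' \<equiv> shadow_sum (\<lambda>_ _ _. 1)"

lemma codeg_sym: "codeg x y = codeg y x" by (simp add: codeg_def h_sym(1))

lemma G_sym: "G x y = G y x" by (simp add: G_def codeg_sym)

lemma h'_sym: "h' x y z = h' y x z" "h' x y z = h' x z y"
  unfolding h'_def using h_sym G_sym by blast+

lemma h'_h: "h' x y z \<Longrightarrow> h x y z" by (simp add: h'_def)

lemma shadow_sum_swap12: "shadow_sum \<phi> = shadow_sum (\<lambda>x y z. \<phi> y x z)"
  unfolding shadow_sum_def by (subst sum.swap) (simp add: h'_sym(1))

lemma shadow_sum_swap23: "shadow_sum \<phi> = shadow_sum (\<lambda>x y z. \<phi> x z y)"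
  unfolding shadow_sum_def by (subst (2) sum.swap) (simp add: h'_sym(2))

lemma shadow_sum_mono: "(\<And>x y z. h' x y z \<Longrightarrow> \<phi> x y z \<le> \<psi> x y z) \<Longrightarrow> shadow_sum \<phi> \<le> shadow_sum \<psi>"
  unfolding shadow_sum_def by (intro sum_mono) (auto simp: of_bool_def)

lemma shadow_sum_add: "shadow_sum (\<lambda>x y z. \<phi> x y z + \<psi> x y z) = shadow_sum \<phi> + shadow_sum \<psi>"
  by (simp add: shadow_sum_def distrib_left sum.distrib)

lemma shadow_sum_diff: "shadow_sum (\<lambda>x y z. \<phi> x y z - \<psi> x y z) = shadow_sum \<phi> - shadow_sum \<psi>"
  by (simp add: shadow_sum_def right_diff_distrib sum_subtractf)

lemma shadow_sum_cmult: "shadow_sum (\<lambda>x y z. c * \<phi> x y z) = c * shadow_sum \<phi>"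
  by (simp add: shadow_sum_def sum_distrib_left mult_ac)

text \<open>An edge lost in passing to \<open>h'\<close> has a light pair, which can sit in three
  positions; for each position the light pairs carry at most \<eta> n triples each.\<close>

lemma N'_ge: "N' \<ge> N_edges - 3 * \<eta> * n ^ 3"
proof -
  define Z where "Z = (\<Sum>x\<in>V. \<Sum>y\<in>V. \<Sum>z\<in>V. of_bool (h x y z \<and> \<not> G x y) :: real)"
  have "Z \<le> (\<Sum>x\<in>V. \<Sum>y\<in>V. \<eta> * n)" unfolding Z_def
  proof (intro sum_mono)
    fix x y
    show "(\<Sum>z\<in>V. of_bool (h x y z \<and> \<not> G x y)) \<le> \<eta> * n"
    proof (cases "G x y")
      case True then show ?thesis using eta by simp
    next
      case False then show ?thesis by (simp add: G_def codeg_def)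
    qed
  qed
  also have "\<dots> = \<eta> * n ^ 3" by (simp add: power3_eq_cube)
  finally have Z: "Z \<le> \<eta> * n ^ 3" .
  have Z2: "(\<Sum>x\<in>V. \<Sum>y\<in>V. \<Sum>z\<in>V. of_bool (h x y z \<and> \<not> G x z)) = Z"
    unfolding Z_def by (subst (2) sum.swap) (simp add: h_sym(2))
  have "(\<Sum>x\<in>V. \<Sum>y\<in>V. \<Sum>z\<in>V. of_bool (h x y z \<and> \<not> G y z)) =
        (\<Sum>x\<in>V. \<Sum>y\<in>V. \<Sum>z\<in>V. of_bool (h x y z \<and> \<not> G x z) :: real)"
    by (subst sum.swap) (simp add: h_sym(1))
  with Z2 have Z3: "(\<Sum>x\<in>V. \<Sum>y\<in>V. \<Sum>z\<in>V. of_bool (h x y z \<and> \<not> G y z)) = Z" by simp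
  have "N_edges \<le> (\<Sum>x\<in>V. \<Sum>y\<in>V. \<Sum>z\<in>V. of_bool (h' x y z) * 1 + of_bool (h x y z \<and> \<not> G x y)
     + of_bool (h x y z \<and> \<not> G x z) + of_bool (h x y z \<and> \<not> G y z))"
    unfolding N_edges_def by (intro sum_mono) (auto simp: h'_def)
  also have "\<dots> = N' + Z + Z + Z"
    by (simp only: sum.distrib shadow_sum_def Z2 Z3 Z_def[symmetric])
  finally show ?thesis using Z by simp
qed

text \<open>Summing over z cancels \<open>d x y\<close>, and summing over the G-neighbours y of x
  cancels \<open>g x\<close>, which leaves at most 1 per vertex. Zero denominators are harmless
  since division by zero yields 0.\<close>

lemma sum_reciprocal: "shadow_sum (\<lambda>x y z. 1 / (g x * d x y)) \<le> n"
proof -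
  have "shadow_sum (\<lambda>x y z. 1 / (g x * d x y)) = (\<Sum>x\<in>V. \<Sum>y\<in>V. d x y * (1 / (g x * d x y)))"
    by (simp add: shadow_sum_def d_def sum_distrib_right[symmetric] sum_divide_distrib[symmetric])
  also have "\<dots> \<le> (\<Sum>x\<in>V. \<Sum>y\<in>V. of_bool (G x y) * (1 / g x))"
  proof (intro sum_mono)
    fix x y assume "x \<in> V" "y \<in> V"
    have "g x \<ge> 0" by (simp add: g_def sum_nonneg)
    show "d x y * (1 / (g x * d x y)) \<le> of_bool (G x y) * (1 / g x)"
    proof (cases "G x y")
      case True
      have "d x y * (1 / (g x * d x y)) \<le> 1 / g x"
        using \<open>g x \<ge> 0\<close> by simp
      then show ?thesis using True by simp
    next
      case False
      then have "d x y = 0" by (simp add: d_def h'_def)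
      then show ?thesis using False by simp
    qed
  qed
  also have "\<dots> = (\<Sum>x\<in>V. g x * (1 / g x))" by (simp add: g_def sum_divide_distrib[symmetric])
  also have "\<dots> \<le> (\<Sum>x\<in>V. 1)" by (intro sum_mono) simp
  finally show ?thesis by simp
qed

lemma n_pos: "n > 0" using Vpos by simp

lemma deg_pos: "h' x y z \<Longrightarrow> g x > 0 \<and> d x y > 0"
proof -
  assume hh: "h' x y z"
  then have V: "y \<in> V" "z \<in> V" using h_D h'_h by blast+
  have "G x y" using hh by (simp add: h'_def)
  then have "g x > 0" unfolding g_def using V fin by (intro sum_pos2[of V y]) auto
  moreover have "d x y > 0" unfolding d_def using V fin hh by (intro sum_pos2[of V z]) auto
  ultimately show ?thesis by simp
qed

lemma shadow_sum_g_eq: "shadow_sum (\<lambda>x y z. g z) = shadow_sum (\<lambda>x y z. g x)"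
  by (subst shadow_sum_swap23, subst shadow_sum_swap12) simp

text \<open>
  The function \<open>1 / (u v)\<close> is replaced by its tangent plane at \<open>u = 2n/3\<close>, \<open>v = n/3\<close>, the values of
  \<open>g\<close> and \<open>d\<close> in the balanced complete 3-partite 3-graph.
\<close>

lemma weighted_codegree_bound:
  "2 / 9 * n ^ 3 \<ge> 3 * N' - 3 / (2 * n) * shadow_sum (\<lambda>x y z. g x) - 3 / n * shadow_sum (\<lambda>x y z. d x y)"
proof -
  have "shadow_sum (\<lambda>x y z. 9 / (2 * n ^ 2) * (3 - 3 / (2 * n) * g x - 3 / n * d x y)) \<le> shadow_sum (\<lambda>x y z. 1 / (g x * d x y))"
  proof (rule shadow_sum_mono)
    fix x y z assume "h' x y z"
    then have p: "g x > 0" "d x y > 0" using deg_pos by auto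
    have "3 - 3 * g x / (2 * n) - 3 * d x y / n \<le> 1 / ((3 * g x / (2 * n)) * (3 * d x y / n))"
      using p n_pos by (intro three_term_amgm) auto
    then have "9 / (2 * n ^ 2) * (3 - 3 * g x / (2 * n) - 3 * d x y / n)
         \<le> 9 / (2 * n ^ 2) * (1 / ((3 * g x / (2 * n)) * (3 * d x y / n)))"
      by (intro mult_left_mono) auto
    also have "\<dots> = 1 / (g x * d x y)" using p n_pos by (simp add: field_simps power2_eq_square)
    finally show "9 / (2 * n ^ 2) * (3 - 3 / (2 * n) * g x - 3 / n * d x y) \<le> 1 / (g x * d x y)" by simp
  qed
  also have "\<dots> \<le> n" by (rule sum_reciprocal)
  finally have "9 / (2 * n ^ 2) * shadow_sum (\<lambda>x y z. 3 - 3 / (2 * n) * g x - 3 / n * d x y) \<le> n"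
    by (simp only: shadow_sum_cmult)
  then have "shadow_sum (\<lambda>x y z. 3 - 3 / (2 * n) * g x - 3 / n * d x y) \<le> 2 / 9 * n ^ 3"
    using n_pos by (simp add: field_simps power2_eq_square power3_eq_cube)
  moreover have "shadow_sum (\<lambda>x y z. 3 - 3 / (2 * n) * g x - 3 / n * d x y)
     = 3 * N' - 3 / (2 * n) * shadow_sum (\<lambda>x y z. g x) - 3 / n * shadow_sum (\<lambda>x y z. d x y)"
  proof -
    have "shadow_sum (\<lambda>x y z. 3) = 3 * N'" using shadow_sum_cmult[of 3 "\<lambda>_ _ _. 1"] by simp
    then show ?thesis by (simp only: shadow_sum_diff shadow_sum_cmult)
  qed
  ultimately show ?thesis by simp
qed

lemma inclusion_excl2:
  assumes "\<And>v. v \<in> V \<Longrightarrow> P v \<Longrightarrow> Q v \<Longrightarrow> R v"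
  shows "(\<Sum>v\<in>V. of_bool (P v)) + (\<Sum>v\<in>V. of_bool (Q v)) \<le> n + (\<Sum>v\<in>V. of_bool (R v))"
proof -
  have "(\<Sum>v\<in>V. of_bool (P v) + of_bool (Q v)) \<le> (\<Sum>v\<in>V. 1 + of_bool (R v) :: real)"
    using assms by (intro sum_mono) auto
  then show ?thesis by (simp add: sum.distrib)
qed

lemma degree_codegree_bound: "shadow_sum (\<lambda>x y z. g x) + shadow_sum (\<lambda>x y z. d x y) \<le> n * N' + overlap"
proof -
  have "shadow_sum (\<lambda>x y z. g z) + shadow_sum (\<lambda>x y z. d x y) = shadow_sum (\<lambda>x y z. g z + d x y)" by (rule shadow_sum_add[symmetric])
  also have "\<dots> \<le> shadow_sum (\<lambda>x y z. n * 1 + (\<Sum>v\<in>V. of_bool (h' x y v \<and> G z v)))"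
    unfolding g_def d_def mult_1_right by (intro shadow_sum_mono inclusion_excl2) auto
  also have "\<dots> = n * N' + overlap" by (simp only: shadow_sum_add shadow_sum_cmult overlap_def)
  finally show ?thesis by (simp add: shadow_sum_g_eq)
qed

text \<open>A violating pair cv lies in the robust shadow, so at least \<eta> n vertices w complete
  abc, abv to a copy of F_5.\<close>

lemma overlap_le: "\<eta> * n * overlap \<le> F5_count"
proof -
  have "\<eta> * n * overlap = (\<Sum>a\<in>V. \<Sum>b\<in>V. \<Sum>c\<in>V. \<Sum>v\<in>V. \<eta> * n * of_bool (h' a b c \<and> h' a b v \<and> G c v))"
    unfolding overlap_def shadow_sum_def sum_distrib_left by (intro sum.cong refl) (simp add: of_bool_conj)
  also have "\<dots> \<le> (\<Sum>a\<in>V. \<Sum>b\<in>V. \<Sum>c\<in>V. \<Sum>v\<in>V. of_bool (h a b c \<and> h a b v) * codeg c v)"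
  proof (intro sum_mono)
    fix a b c v
    have "codeg c v \<ge> 0" by (simp add: codeg_def sum_nonneg)
    then show "\<eta> * n * of_bool (h' a b c \<and> h' a b v \<and> G c v) \<le> of_bool (h a b c \<and> h a b v) * codeg c v"
      by (auto simp: h'_def G_def)
  qed
  also have "\<dots> = F5_count" unfolding F5_count_def codeg_def sum_distrib_left
    by (intro sum.cong refl) (simp flip: of_bool_conj add: conj_assoc)
  finally show ?thesis .
qed

definition inner_count :: "'a \<Rightarrow> 'a \<Rightarrow> real" where
  "inner_count x y = (\<Sum>u\<in>V. \<Sum>v\<in>V. \<Sum>w\<in>V. of_bool (h' x y u \<and> h' x y v \<and> h u v w))"

text \<open>An edge uvw with u and v both in the neighbourhood of xy forms a copy of F_5 with xyu
  and xyv. The factor n comes from the coordinate z, which \<open>inner_count x y\<close> does not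
  involve.\<close>

lemma inner_count_total: "shadow_sum (\<lambda>x y z. inner_count x y) \<le> n * F5_count"
proof -
  have "shadow_sum (\<lambda>x y z. inner_count x y) \<le> (\<Sum>x\<in>V. \<Sum>y\<in>V. \<Sum>z\<in>V. inner_count x y)"
    unfolding shadow_sum_def by (intro sum_mono) (auto simp: inner_count_def sum_nonneg)
  also have "\<dots> = n * (\<Sum>x\<in>V. \<Sum>y\<in>V. inner_count x y)" by (simp add: sum_distrib_left)
  also have "(\<Sum>x\<in>V. \<Sum>y\<in>V. inner_count x y) \<le> F5_count"
    unfolding inner_count_def F5_count_def by (intro sum_mono) (auto simp: h'_def)
  finally show ?thesis by (simp add: mult_left_mono)
qed

text \<open>
  An edge of small defect splits almost all of \<open>V\<close> into the three neighbourhoods of its pairs, each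
  containing two vertices of only few edges.
\<close>

definition defect :: "'a \<Rightarrow> 'a \<Rightarrow> 'a \<Rightarrow> real" where
  "defect x y z = n - (\<Sum>v\<in>V. of_bool (h' x y v \<or> h' y z v \<or> h' x z v))
     + (inner_count x y + inner_count y z + inner_count x z) / n ^ 2"

lemma shadow_sum_d: "shadow_sum (\<lambda>x y z. d y z) = shadow_sum (\<lambda>x y z. d x y)" "shadow_sum (\<lambda>x y z. d x z) = shadow_sum (\<lambda>x y z. d x y)"
proof -
  show 2: "shadow_sum (\<lambda>x y z. d x z) = shadow_sum (\<lambda>x y z. d x y)" by (subst shadow_sum_swap23) simp
  show "shadow_sum (\<lambda>x y z. d y z) = shadow_sum (\<lambda>x y z. d x y)" by (subst shadow_sum_swap12) (simp add: 2)
qed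

lemma shadow_sum_inner: "shadow_sum (\<lambda>x y z. inner_count y z) = shadow_sum (\<lambda>x y z. inner_count x y)"
   "shadow_sum (\<lambda>x y z. inner_count x z) = shadow_sum (\<lambda>x y z. inner_count x y)"
proof -
  show 2: "shadow_sum (\<lambda>x y z. inner_count x z) = shadow_sum (\<lambda>x y z. inner_count x y)" by (subst shadow_sum_swap23) simp
  show "shadow_sum (\<lambda>x y z. inner_count y z) = shadow_sum (\<lambda>x y z. inner_count x y)" by (subst shadow_sum_swap12) (simp add: 2)
qed

lemma shadow_sum_overlap: "shadow_sum (\<lambda>x y z. \<Sum>v\<in>V. of_bool (h' y z v \<and> G x v)) = overlap"
proof -
  have "overlap = shadow_sum (\<lambda>x y z. \<Sum>v\<in>V. of_bool (h' x z v \<and> G y v))"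
    unfolding overlap_def by (subst shadow_sum_swap23) simp
  also have "\<dots> = shadow_sum (\<lambda>x y z. \<Sum>v\<in>V. of_bool (h' y z v \<and> G x v))" by (subst shadow_sum_swap12) simp
  finally show ?thesis ..
qed

lemma defect_total:
  "shadow_sum defect \<le> n * N' - 3 * shadow_sum (\<lambda>x y z. d x y) + 3 * overlap + 3 * F5_count / n"
proof -
  let ?o1 = "\<lambda>x y z. \<Sum>v\<in>V. of_bool (h' y z v \<and> G x v) :: real"
  let ?o2 = "\<lambda>x y z. \<Sum>v\<in>V. of_bool (h' x y v \<and> G z v) :: real"
  have "shadow_sum defect \<le> shadow_sum (\<lambda>x y z. n * 1 - (d x y + d y z + d x z) + (2 * ?o1 x y z + ?o2 x y z)
     + (1 / n ^ 2) * (inner_count x y + inner_count y z + inner_count x z))"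
  proof (rule shadow_sum_mono)
    fix x y z assume "h' x y z"
    have "d x y + d y z + d x z - (2 * ?o1 x y z + ?o2 x y z) \<le> (\<Sum>v\<in>V. of_bool (h' x y v \<or> h' y z v \<or> h' x z v))"
      unfolding d_def sum.distrib[symmetric] sum_distrib_left sum_subtractf[symmetric]
    proof (rule sum_mono)
      fix v assume "v \<in> V"
      \<comment> \<open>A vertex in two of the three neighbourhoods is a violation. Both
        coincidences involving the pair yz are charged to \<open>?o1\<close>, which explains its
        coefficient 2; the remaining one is charged to \<open>?o2\<close>.\<close>
      have "h' x y v \<Longrightarrow> h' y z v \<Longrightarrow> G x v" "h' y z v \<Longrightarrow> h' x z v \<Longrightarrow> G x v" "h' x y v \<Longrightarrow> h' x z v \<Longrightarrow> G z v"
        by (auto simp: h'_def)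
      then show "of_bool (h' x y v) + of_bool (h' y z v) + of_bool (h' x z v)
         - (2 * of_bool (h' y z v \<and> G x v) + of_bool (h' x y v \<and> G z v))
         \<le> (of_bool (h' x y v \<or> h' y z v \<or> h' x z v) :: real)"
        by (auto simp: of_bool_def)
    qed
    then show "defect x y z \<le> n * 1 - (d x y + d y z + d x z) + (2 * ?o1 x y z + ?o2 x y z)
     + (1 / n ^ 2) * (inner_count x y + inner_count y z + inner_count x z)"
      by (simp add: defect_def)
  qed
  also have "\<dots> = n * N' - 3 * shadow_sum (\<lambda>x y z. d x y) + 3 * overlap + (1 / n ^ 2) * (3 * shadow_sum (\<lambda>x y z. inner_count x y))"
  proof -
    have "shadow_sum ?o2 = overlap" by (simp add: overlap_def)
    then show ?thesis by (simp only: shadow_sum_add shadow_sum_diff shadow_sum_cmult shadow_sum_overlap shadow_sum_d shadow_sum_inner)  simp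
  qed
  also have "\<dots> \<le> n * N' - 3 * shadow_sum (\<lambda>x y z. d x y) + 3 * overlap + (1 / n ^ 2) * (3 * (n * F5_count))"
    using inner_count_total by (intro add_left_mono mult_left_mono) auto
  also have "(1 / n ^ 2) * (3 * (n * F5_count)) = 3 * F5_count / n" using n_pos by (simp add: power2_eq_square)
  finally show ?thesis .
qed

text \<open>Averaging of \<open>defect\<close> over the edges of \<open>h'\<close>. In
  \<open>\<zeta>\<close>, the term with \<rho> and \<eta> is the edge deficit together with the
  deleted light pairs, 6 \<delta>/\<eta> comes from \<open>overlap\<close>, and 3 \<delta> from the
  edges inside neighbourhoods.\<close>

lemma exists_low_defect:
  assumes F: "F5_count \<le> \<delta> * n ^ 5" and N: "N_edges \<ge> (2 / 9 - \<rho>) * n ^ 3" and small: "\<rho> + 3 * \<eta> \<le> 1 / 9"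
    and zeta: "\<zeta> = 2 * (\<rho> + 3 * \<eta>) + 6 * \<delta> / \<eta> + 3 * \<delta>"
  obtains (low) x y z where "h' x y z" "defect x y z \<le> 10 * \<zeta> * n"
proof -
  let ?D = "shadow_sum (\<lambda>x y z. d x y)" and ?g = "shadow_sum (\<lambda>x y z. g x)"
  have N': "N' \<ge> (2 / 9 - \<rho> - 3 * \<eta>) * n ^ 3" using N'_ge N by (simp add: algebra_simps)
  have "\<eta> * n * overlap \<le> \<delta> * n ^ 5" using overlap_le F by simp
  then have overlap: "overlap \<le> \<delta> / \<eta> * n ^ 4" using n_pos eta by (simp add: field_simps eval_nat_numeral)
  have F': "3 * F5_count / n \<le> 3 * \<delta> * n ^ 4" using F n_pos by (simp add: field_simps eval_nat_numeral)
  have "2 / 9 * n ^ 3 * n \<ge> (3 * N' - 3 / (2 * n) * ?g - 3 / n * ?D) * n"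
    using weighted_codegree_bound n_pos by (intro mult_right_mono) auto
  moreover have "(3 * N' - 3 / (2 * n) * ?g - 3 / n * ?D) * n = 3 * n * N' - 3 / 2 * ?g - 3 * ?D"
    using n_pos by (simp add: field_simps)
  moreover have "2 / 9 * n ^ 3 * n = 2 / 9 * n ^ 4" by (simp add: eval_nat_numeral)
  ultimately have "2 / 9 * n ^ 4 \<ge> 3 * n * N' - 3 / 2 * ?g - 3 * ?D" by (simp only:)
  moreover have "?g + ?D \<le> n * N' + overlap" by (rule degree_codegree_bound)
  \<comment> \<open>Eliminating \<open>?g\<close> from the convexity bound and the degree bound. For
    N' near 2/9 n^3 the right side is about 2/27 n^4, that is, an average codegree of n/3.\<close>
  ultimately have "?D \<ge> n * N' - overlap - 4 / 27 * n ^ 4" by (simp add: field_simps)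
  then have "shadow_sum defect \<le> 4 / 9 * n ^ 4 - 2 * (n * N') + 6 * overlap + 3 * F5_count / n"
    using defect_total by simp
  also have "\<dots> \<le> 4 / 9 * n ^ 4 - 2 * (n * ((2 / 9 - \<rho> - 3 * \<eta>) * n ^ 3)) + 6 * (\<delta> / \<eta> * n ^ 4) + 3 * \<delta> * n ^ 4"
    using overlap F' mult_left_mono[OF N', of n] by simp
  also have "\<dots> = \<zeta> * n ^ 4" by (simp add: zeta algebra_simps eval_nat_numeral)
  finally have tot: "shadow_sum defect \<le> \<zeta> * n ^ 4" .
  \<comment> \<open>With more than n^3 / 10 ordered edges and total defect at most \<zeta> n^4, some
    edge has defect at most 10 \<zeta> n.\<close>
  have "1 / 10 * n ^ 3 < 1 / 9 * n ^ 3" using n_pos by simp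
  also have "\<dots> \<le> (2 / 9 - \<rho> - 3 * \<eta>) * n ^ 3" using small by (intro mult_right_mono) auto
  finally have N10: "1 / 10 * n ^ 3 < N'" using N' by simp
  show thesis
  proof (rule ccontr)
    assume neg: "\<not> thesis"
    have *: "defect x y z > 10 * \<zeta> * n" if "h' x y z" for x y z
      using neg low that by force
    have pos: "defect x y z \<ge> 0" for x y z
    proof -
      have "(\<Sum>v\<in>V. of_bool (h' x y v \<or> h' y z v \<or> h' x z v)) \<le> (\<Sum>v\<in>V. 1 :: real)" by (intro sum_mono) auto
      then show ?thesis by (simp add: defect_def inner_count_def sum_nonneg)
    qed
    have z0: "\<zeta> \<ge> 0"
    proof -
      have "0 \<le> shadow_sum defect" unfolding shadow_sum_def using pos by (intro sum_nonneg) auto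
      then have "0 \<le> \<zeta> * n ^ 4" using tot by simp
      then show ?thesis using n_pos by (simp add: zero_le_mult_iff)
    qed
    have ex: "\<exists>x y z. h' x y z"
    proof (rule ccontr)
      assume "\<nexists>x y z. h' x y z"
      then have "N' = 0" by (simp add: shadow_sum_def)
      then show False using N10 n_pos by simp
    qed
    have "shadow_sum (\<lambda>x y z. 10 * \<zeta> * n * 1) < shadow_sum defect"
    proof -
      obtain x y z where xyz: "h' x y z" using ex by blast
      then have V: "x \<in> V" "y \<in> V" "z \<in> V" using h_D h'_h by blast+
      define q where "q x y z = of_bool (h' x y z) * (defect x y z - 10 * \<zeta> * n)" for x y z
      have q: "q x y z \<ge> 0" for x y z using *[of x y z] by (auto simp: q_def)
      have "0 < q x y z" using * xyz by (simp add: q_def)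
      also have "\<dots> \<le> (\<Sum>z\<in>V. q x y z)" using V fin q by (intro member_le_sum) auto
      also have "\<dots> \<le> (\<Sum>y\<in>V. \<Sum>z\<in>V. q x y z)" using V fin q by (intro member_le_sum[of y V "\<lambda>y. \<Sum>z\<in>V. q x y z"] sum_nonneg) auto
      also have "\<dots> \<le> (\<Sum>x\<in>V. \<Sum>y\<in>V. \<Sum>z\<in>V. q x y z)" using V fin q
        by (intro member_le_sum[of x V "\<lambda>x. \<Sum>y\<in>V. \<Sum>z\<in>V. q x y z"] sum_nonneg) auto
      also have "\<dots> = shadow_sum (\<lambda>x y z. defect x y z - 10 * \<zeta> * n * 1)" by (simp add: shadow_sum_def q_def)
      also have "\<dots> = shadow_sum defect - shadow_sum (\<lambda>x y z. 10 * \<zeta> * n * 1)" by (rule shadow_sum_diff)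
      finally show ?thesis by simp
    qed
    then have "10 * \<zeta> * n * N' < \<zeta> * n ^ 4" using tot by (simp only: shadow_sum_cmult)
    moreover have "10 * \<zeta> * n * N' \<ge> 10 * \<zeta> * n * (1 / 10 * n ^ 3)" using N10 z0 n_pos by (intro mult_left_mono) auto
    ultimately show False by (simp add: eval_nat_numeral)
  qed
qed

text \<open>A vertex is coloured by a pair of a low-defect edge xyz that it extends; vertices
  extending none receive colour 2 by default. An edge containing two vertices of equal colour either
  has them in one neighbourhood, which \<open>inner_count\<close> measures, or contains a leftover
  vertex, and these are few.\<close>

lemma stability:
  assumes F: "F5_count \<le> \<delta> * n ^ 5" and N: "N_edges \<ge> (2 / 9 - \<rho>) * n ^ 3" and small: "\<rho> + 3 * \<eta> \<le> 1 / 9"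
    and zeta: "\<zeta> = 2 * (\<rho> + 3 * \<eta>) + 6 * \<delta> / \<eta> + 3 * \<delta>"
  shows "\<exists>f :: 'a \<Rightarrow> nat. (\<forall>v. f v < 3) \<and> (\<Sum>u\<in>V. \<Sum>v\<in>V. \<Sum>w\<in>V. of_bool (h u v w \<and> f u = f v)) \<le> 50 * \<zeta> * n ^ 3"
proof -
  obtain x y z where xyz: "h' x y z" and def: "defect x y z \<le> 10 * \<zeta> * n"
    using exists_low_defect[OF F N small zeta] by blast
  define R where "R v = (\<not> (h' x y v \<or> h' y z v \<or> h' x z v))" for v
  define f :: "'a \<Rightarrow> nat" where "f v = (if h' x y v then 0 else if h' y z v then 1 else 2)" for v
  have sumR: "(\<Sum>v\<in>V. of_bool (R v)) = n - (\<Sum>v\<in>V. of_bool (h' x y v \<or> h' y z v \<or> h' x z v))"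
    unfolding R_def of_bool_not_iff by (simp add: sum_subtractf)
  have ic: "inner_count a b \<ge> 0" for a b by (simp add: inner_count_def sum_nonneg)
  have R0: "(\<Sum>v\<in>V. of_bool (R v)) \<ge> (0::real)" by (simp add: sum_nonneg)
  have nn: "n ^ 2 > 0" using n_pos by simp
  let ?I = "inner_count x y + inner_count y z + inner_count x z"
  have "(\<Sum>v\<in>V. of_bool (R v)) + ?I / n ^ 2 \<le> 10 * \<zeta> * n" using def by (simp add: defect_def sumR)
  moreover have "?I / n ^ 2 \<ge> 0" using ic[of x y] ic[of y z] ic[of x z] by simp
  ultimately have R: "(\<Sum>v\<in>V. of_bool (R v)) \<le> 10 * \<zeta> * n" and "?I / n ^ 2 \<le> 10 * \<zeta> * n" using R0 by linarith+
  then have I: "?I \<le> 10 * \<zeta> * n ^ 3" using nn by (simp add: field_simps eval_nat_numeral)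
  have "(\<Sum>u\<in>V. \<Sum>v\<in>V. \<Sum>w\<in>V. of_bool (h u v w \<and> f u = f v)) \<le>
    (\<Sum>u\<in>V. \<Sum>v\<in>V. \<Sum>w\<in>V. of_bool (h' x y u \<and> h' x y v \<and> h u v w) + of_bool (h' y z u \<and> h' y z v \<and> h u v w)
      + of_bool (h' x z u \<and> h' x z v \<and> h u v w) + of_bool (R u) + (of_bool (R v) :: real))"
    by (intro sum_mono) (auto simp: f_def R_def split: if_splits)
  also have "\<dots> = ?I + (\<Sum>u\<in>V. \<Sum>v\<in>V. \<Sum>w\<in>V. of_bool (R u)) + (\<Sum>u\<in>V. \<Sum>v\<in>V. \<Sum>w\<in>V. of_bool (R v))"
    by (simp only: sum.distrib inner_count_def)
  also have "(\<Sum>u\<in>V. \<Sum>v\<in>V. \<Sum>w\<in>V. of_bool (R u)) = n ^ 2 * (\<Sum>v\<in>V. of_bool (R v))"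
    by (simp add: sum_distrib_left power2_eq_square mult.assoc)
  also have "(\<Sum>u\<in>V. \<Sum>v\<in>V. \<Sum>w\<in>V. of_bool (R v)) = n ^ 2 * (\<Sum>v\<in>V. of_bool (R v))"
    by (simp add: sum_distrib_left[symmetric] power2_eq_square)
  also have "?I + n ^ 2 * (\<Sum>v\<in>V. of_bool (R v)) + n ^ 2 * (\<Sum>v\<in>V. of_bool (R v))
      \<le> 10 * \<zeta> * n ^ 3 + n ^ 2 * (10 * \<zeta> * n) + n ^ 2 * (10 * \<zeta> * n)"
    by (intro add_mono I mult_left_mono R) auto
  also have "\<dots> = 30 * \<zeta> * n ^ 3" by (simp add: eval_nat_numeral)
  also have "\<dots> \<le> 50 * \<zeta> * n ^ 3"
  proof -
    have "0 \<le> 10 * \<zeta> * n" using R R0 by linarith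
    then have "0 \<le> \<zeta>" using n_pos by (simp add: zero_le_mult_iff)
    then show ?thesis by (intro mult_right_mono) auto
  qed
  finally show ?thesis by (intro exI[of _ f]) (auto simp: f_def)
qed

end

section \<open>Copies of F_5 through a vertex\<close>

lemma card_nonempty_ex: "card A = k \<Longrightarrow> k > 0 \<Longrightarrow> \<exists>x. x \<in> A"
  by (metis card_gt_0_iff ex_in_conv)

context hyper3 begin

text \<open>
  The conditions \<open>w \<noteq> a\<close> and \<open>w \<noteq> b\<close> exclude the degenerate copies (those inside four vertices), so
  that the boxes obtained from many such tuples are disjoint.
\<close>

definition F5_at :: "'a \<Rightarrow> 'a \<Rightarrow> 'a \<Rightarrow> 'a \<Rightarrow> 'a \<Rightarrow> bool" where
  "F5_at a b c d w \<longleftrightarrow> h a b c \<and> h a b d \<and> h c d w \<and> w \<noteq> a \<and> w \<noteq> b"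

text \<open>Apex and base are the roles w and c in F_5. A vertex with many non-crossing edges at a
  maximum cut will turn out to be heavy in one of these two roles.\<close>

definition heavy_apex :: "real \<Rightarrow> 'a set" where
  "heavy_apex \<kappa> = {w\<in>V. \<kappa> * n ^ 4 \<le> (\<Sum>a\<in>V. \<Sum>b\<in>V. \<Sum>c\<in>V. \<Sum>d\<in>V. of_bool (F5_at a b c d w))}"

definition heavy_base :: "real \<Rightarrow> 'a set" where
  "heavy_base \<kappa> = {c\<in>V. \<kappa> * n ^ 4 \<le> (\<Sum>a\<in>V. \<Sum>b\<in>V. \<Sum>d\<in>V. \<Sum>w\<in>V. of_bool (F5_at a b c d w))}"

lemma F5_boxes_contain_F5S:
  assumes ms: "2 * s \<le> m" "s > 0" "t > 0" and M: "M = m + t"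
    and c: "card A = M" "card B = M" "card C = M" "card D = M" "card T = M"
    and sub: "A \<subseteq> V" "B \<subseteq> V" "C \<subseteq> V" "D \<subseteq> V" "T \<subseteq> V"
    and e: "\<And>a b c d w. a \<in> A \<Longrightarrow> b \<in> B \<Longrightarrow> c \<in> C \<Longrightarrow> d \<in> D \<Longrightarrow> w \<in> T \<Longrightarrow> F5_at a b c d w"
  shows "contains_copy (V, E) (F5S m t s)"
proof -
  obtain a0 b0 c0 d0 w0 where ne: "a0 \<in> A" "b0 \<in> B" "c0 \<in> C" "d0 \<in> D" "w0 \<in> T"
    using c[THEN card_nonempty_ex] ms M that by (metis add_gr_0)
  have le: "m \<le> M" "t \<le> M" by (simp_all add: M)
  show ?thesis
  proof (rule F5_blowup_contains_F5S[OF edges fin ms(1) le ms(2,3) c sub])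
    show "{a, b, c} \<in> E" if "a \<in> A" "b \<in> B" "c \<in> C" for a b c
      using e[OF that ne(4,5)] by (simp add: F5_at_def h_def)
    show "{a, b, d} \<in> E" if "a \<in> A" "b \<in> B" "d \<in> D" for a b d
      using e[OF that(1,2) ne(3) that(3) ne(5)] by (simp add: F5_at_def h_def)
    show "{c, d, w} \<in> E" if "c \<in> C" "d \<in> D" "w \<in> T" for c d w
      using e[OF ne(1,2) that] by (simp add: F5_at_def h_def)
    show "T \<inter> A = {}" "T \<inter> B = {}"
      using e[OF _ ne(2-4)] e[OF ne(1) _ ne(3,4)] by (auto simp: F5_at_def)
  qed
qed

end

text \<open>The heavy set itself is taken as one coordinate of the box: as soon as it has
  \<open>n0\<close> elements, its tuples have density \<kappa> and force a blow-up of F_5. The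
  resulting bound does not depend on n.\<close>

lemma few_heavy_vertices:
  fixes \<kappa> :: real
  assumes k: "\<kappa> > 0" and ms: "2 * s \<le> m" "s > 0" "t > 0"
  obtains n0 where "n0 > 0"
    "\<And>(V :: 'a set) E. hyper3 V E \<Longrightarrow> \<not> contains_copy (V, E) (F5S m t s) \<Longrightarrow> n0 \<le> card V \<Longrightarrow>
      card (hyper3.heavy_apex V E \<kappa>) < n0 \<and> card (hyper3.heavy_base V E \<kappa>) < n0"
proof -
  have M: "m + t > 0" using ms by simp
  have fin4: "finite (V \<times> V \<times> V \<times> V)" if "finite V" for V :: "'a set" using that by simp
  obtain n0 where n0: "\<And>(W :: 'a set) (V :: 'a set) P. finite W \<Longrightarrow> n0 \<le> card W \<Longrightarrow> finite V \<Longrightarrow> n0 \<le> card V \<Longrightarrow>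
     \<kappa> * real (card W) * real (card (V \<times> V \<times> V \<times> V))
       \<le> real (card {(x, y). x \<in> W \<and> y \<in> V \<times> V \<times> V \<times> V \<and> P x y}) \<Longrightarrow>
     \<exists>S\<subseteq>W. card S = m + t \<and> box4 (m + t) V (\<lambda>y. \<forall>x\<in>S. P x y)"
    by (rule dense_forces_over[OF dense_forces_box4[OF M] fin4 k M]) (assumption, rule that)
  show thesis
  proof (rule that[of "Suc n0"])
    fix V :: "'a set" and E
    assume H: "hyper3 V E" and free: "\<not> contains_copy (V, E) (F5S m t s)" and n: "Suc n0 \<le> card V"
    interpret hyper3 V E by (rule H)
    have box: "\<exists>S\<subseteq>W. card S = m + t \<and> box4 (m + t) V (\<lambda>y. \<forall>x\<in>S. P x y)"
      if W: "W \<subseteq> V" "\<not> card W < Suc n0"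
        and dens: "\<And>w. w \<in> W \<Longrightarrow> \<kappa> * n ^ 4 \<le> (\<Sum>a\<in>V. \<Sum>b\<in>V. \<Sum>c\<in>V. \<Sum>d\<in>V. of_bool (P w (a, b, c, d)))"
      for W P
    proof (rule n0)
      let ?Y = "V \<times> V \<times> V \<times> V"
      have fW: "finite W" using W(1) fin finite_subset by auto
      have "\<kappa> * real (card W) * real (card ?Y) = (\<Sum>w\<in>W. \<kappa> * n ^ 4)"
        by (simp add: power4_eq_xxxx card_cartesian_product)
      also have "\<dots> \<le> (\<Sum>w\<in>W. real (card {p\<in>?Y. P w p}))"
      proof (rule sum_mono)
        fix w assume "w \<in> W"
        from dens[OF this] show "\<kappa> * n ^ 4 \<le> real (card {p\<in>?Y. P w p})"
          using fin by (simp add: card_of_bool sum.cartesian_product split_def del: sum_of_bool_eq)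
      qed
      also have "\<dots> = real (card (SIGMA w:W. {p\<in>?Y. P w p}))" using fW fin by simp
      also have "(SIGMA w:W. {p\<in>?Y. P w p}) = {(x, y). x \<in> W \<and> y \<in> ?Y \<and> P x y}" by auto
      finally show "\<kappa> * real (card W) * real (card ?Y) \<le> real (card {(x, y). x \<in> W \<and> y \<in> ?Y \<and> P x y})" .
      show "finite W" "finite V" "n0 \<le> card W" "n0 \<le> card V" using fW fin W n by auto
    qed
    show "card (heavy_apex \<kappa>) < Suc n0 \<and> card (heavy_base \<kappa>) < Suc n0"
    proof (intro conjI; rule ccontr)
      assume "\<not> card (heavy_apex \<kappa>) < Suc n0"
      then have "\<exists>S\<subseteq>heavy_apex \<kappa>. card S = m + t \<and> box4 (m + t) V (\<lambda>y. \<forall>x\<in>S. (\<lambda>w (a, b, c, d). F5_at a b c d w) x y)"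
        by (intro box) (auto simp: heavy_apex_def)
      then obtain S A B C D where S: "S \<subseteq> heavy_apex \<kappa>" "A \<subseteq> V" "B \<subseteq> V" "C \<subseteq> V" "D \<subseteq> V"
         "card A = m + t" "card B = m + t" "card C = m + t" "card D = m + t" "card S = m + t"
         and e: "\<forall>d\<in>D. \<forall>c\<in>C. \<forall>b\<in>B. \<forall>a\<in>A. \<forall>x\<in>S. F5_at a b c d x"
        unfolding box4_def by auto
      have "S \<subseteq> V" using S(1) by (auto simp: heavy_apex_def)
      then show False using F5_boxes_contain_F5S[OF ms refl S(6-10) S(2-5)] e free by blast
    next
      assume "\<not> card (heavy_base \<kappa>) < Suc n0"
      then have "\<exists>S\<subseteq>heavy_base \<kappa>. card S = m + t \<and> box4 (m + t) V (\<lambda>y. \<forall>x\<in>S. (\<lambda>c (a, b, d, w). F5_at a b c d w) x y)"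
        by (intro box) (auto simp: heavy_base_def)
      then obtain C A B D S where S: "C \<subseteq> heavy_base \<kappa>" "A \<subseteq> V" "B \<subseteq> V" "D \<subseteq> V" "S \<subseteq> V"
         "card A = m + t" "card B = m + t" "card C = m + t" "card D = m + t" "card S = m + t"
         and e: "\<forall>w\<in>S. \<forall>d\<in>D. \<forall>b\<in>B. \<forall>a\<in>A. \<forall>x\<in>C. F5_at a b x d w"
        unfolding box4_def by auto
      have "C \<subseteq> V" using S(1) by (auto simp: heavy_base_def)
      then show False using F5_boxes_contain_F5S[OF ms refl S(6-10) S(2,3) _ S(4,5)] e free by blast
    qed
  qed simp
qed

lemma sum_rotate3:
  fixes F :: "_ \<Rightarrow> _ \<Rightarrow> _ \<Rightarrow> real"
  shows "(\<Sum>a\<in>A. \<Sum>b\<in>B. \<Sum>w\<in>W. F a b w) = (\<Sum>w\<in>W. \<Sum>a\<in>A. \<Sum>b\<in>B. F a b w)"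
proof -
  have "(\<Sum>a\<in>A. \<Sum>b\<in>B. \<Sum>w\<in>W. F a b w) = (\<Sum>a\<in>A. \<Sum>w\<in>W. \<Sum>b\<in>B. F a b w)"
    by (intro sum.cong refl sum.swap)
  also have "\<dots> = (\<Sum>w\<in>W. \<Sum>a\<in>A. \<Sum>b\<in>B. F a b w)" by (rule sum.swap)
  finally show ?thesis .
qed

lemma sum_rotate5:
  fixes F :: "_ \<Rightarrow> _ \<Rightarrow> _ \<Rightarrow> _ \<Rightarrow> _ \<Rightarrow> real"
  shows "(\<Sum>a\<in>A. \<Sum>b\<in>B. \<Sum>c\<in>C. \<Sum>d\<in>D. \<Sum>w\<in>W. F a b c d w) = (\<Sum>w\<in>W. \<Sum>a\<in>A. \<Sum>b\<in>B. \<Sum>c\<in>C. \<Sum>d\<in>D. F a b c d w)"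
proof -
  have "(\<Sum>a\<in>A. \<Sum>b\<in>B. \<Sum>c\<in>C. \<Sum>d\<in>D. \<Sum>w\<in>W. F a b c d w) = (\<Sum>a\<in>A. \<Sum>b\<in>B. \<Sum>w\<in>W. \<Sum>c\<in>C. \<Sum>d\<in>D. F a b c d w)"
    by (intro sum.cong refl sum_rotate3)
  also have "\<dots> = (\<Sum>w\<in>W. \<Sum>a\<in>A. \<Sum>b\<in>B. \<Sum>c\<in>C. \<Sum>d\<in>D. F a b c d w)" by (rule sum_rotate3)
  finally show ?thesis .
qed

text \<open>The boundedly many heavy apexes carry at most n^4 tuples each, every other apex fewer
  than \<delta>/2 n^4, and the degenerate tuples add 2 n^4. The terms of order n^4 fit into the
  remaining \<delta>/2 n^5 once n is large.\<close>

lemma few_F5: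
  fixes \<delta> :: real
  assumes k: "\<delta> > 0" and ms: "2 * s \<le> m" "s > 0" "t > 0"
  obtains n0 where "\<And>(V :: 'a set) E. hyper3 V E \<Longrightarrow> \<not> contains_copy (V, E) (F5S m t s) \<Longrightarrow> card V \<ge> n0 \<Longrightarrow>
      hyper3.F5_count V E \<le> \<delta> * real (card V) ^ 5"
proof -
  have k2: "\<delta> / 2 > 0" using k by simp
  obtain n0 where n0: "n0 > 0"
    "\<And>(V :: 'a set) E. hyper3 V E \<Longrightarrow> \<not> contains_copy (V, E) (F5S m t s) \<Longrightarrow> n0 \<le> card V \<Longrightarrow>
      card (hyper3.heavy_apex V E (\<delta> / 2)) < n0 \<and> card (hyper3.heavy_base V E (\<delta> / 2)) < n0"
    by (rule few_heavy_vertices[OF k2 ms]) (rule that)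
  show thesis
  proof (rule that[of "max n0 (nat \<lceil>2 * (real n0 + 2) / \<delta>\<rceil>)"])
    fix V :: "'a set" and E
    assume H: "hyper3 V E" and free: "\<not> contains_copy (V, E) (F5S m t s)"
      and n: "card V \<ge> max n0 (nat \<lceil>2 * (real n0 + 2) / \<delta>\<rceil>)"
    interpret hyper3 V E by (rule H)
    have n2: "n > 0" "2 * (real n0 + 2) \<le> \<delta> * n"
    proof -
      show "n > 0" using n n0(1) by simp
      have "2 * (real n0 + 2) / \<delta> \<le> n" using n by linarith
      then show "2 * (real n0 + 2) \<le> \<delta> * n" using k by (simp add: field_simps)
    qed
    define T :: "'a \<Rightarrow> real" where "T w = (\<Sum>a\<in>V. \<Sum>b\<in>V. \<Sum>c\<in>V. \<Sum>d\<in>V. of_bool (F5_at a b c d w))" for w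
    let ?W = "{w\<in>V. \<delta> / 2 * n ^ 4 \<le> T w}"
    have W: "card ?W < n0" using n0(2)[OF H free] n by (simp add: heavy_apex_def T_def)
    have T1: "T w \<le> n ^ 4" for w
    proof -
      have "T w \<le> (\<Sum>a\<in>V. \<Sum>b\<in>V. \<Sum>c\<in>V. \<Sum>d\<in>V. 1)" unfolding T_def by (intro sum_mono) auto
      then show ?thesis by (simp add: eval_nat_numeral)
    qed
    have "F5_count = (\<Sum>w\<in>V. \<Sum>a\<in>V. \<Sum>b\<in>V. \<Sum>c\<in>V. \<Sum>d\<in>V. of_bool (h a b c \<and> h a b d \<and> h c d w))"
      unfolding F5_count_def by (rule sum_rotate5)
    also have "\<dots> \<le> (\<Sum>w\<in>V. \<Sum>a\<in>V. \<Sum>b\<in>V. \<Sum>c\<in>V. \<Sum>d\<in>V. of_bool (F5_at a b c d w) + of_bool (w = a) + of_bool (w = b))"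
      unfolding F5_at_def by (intro sum_mono) auto
    also have "\<dots> = (\<Sum>w\<in>V. T w) + 2 * n ^ 4"
    proof -
      have 1: "(\<Sum>a\<in>V. of_bool (w = a)) = (1::real)" if "w \<in> V" for w using that fin by (simp add: of_bool_def sum.delta)
      have "(\<Sum>a\<in>V. \<Sum>b\<in>V. \<Sum>c\<in>V. \<Sum>d\<in>V. of_bool (w = a)) = n ^ 3" if "w \<in> V" for w
        by (simp add: sum_distrib_left[symmetric] 1[OF that] eval_nat_numeral del: sum_of_bool_eq)
      moreover have "(\<Sum>a\<in>V. \<Sum>b\<in>V. \<Sum>c\<in>V. \<Sum>d\<in>V. of_bool (w = b)) = n ^ 3" if "w \<in> V" for w
        by (simp add: sum_distrib_left[symmetric] 1[OF that] eval_nat_numeral del: sum_of_bool_eq)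
      ultimately have "(\<Sum>w\<in>V. \<Sum>a\<in>V. \<Sum>b\<in>V. \<Sum>c\<in>V. \<Sum>d\<in>V. of_bool (F5_at a b c d w) + of_bool (w = a) + of_bool (w = b))
        = (\<Sum>w\<in>V. T w + n ^ 3 + n ^ 3)"
        by (intro sum.cong refl) (simp only: sum.distrib T_def)
      then show ?thesis by (simp add: sum.distrib eval_nat_numeral)
    qed
    also have "(\<Sum>w\<in>V. T w) \<le> (\<Sum>w\<in>V. \<delta> / 2 * n ^ 4 + of_bool (\<delta> / 2 * n ^ 4 \<le> T w) * n ^ 4)"
    proof (rule sum_mono)
      fix w
      show "T w \<le> \<delta> / 2 * n ^ 4 + of_bool (\<delta> / 2 * n ^ 4 \<le> T w) * n ^ 4"
      proof (cases "\<delta> / 2 * n ^ 4 \<le> T w")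
        case True
        have "0 \<le> \<delta> / 2 * n ^ 4" using k by simp
        then show ?thesis using T1[of w] True by simp
      qed simp
    qed
    also have "\<dots> = \<delta> / 2 * n ^ 5 + (\<Sum>w\<in>V. of_bool (\<delta> / 2 * n ^ 4 \<le> T w)) * n ^ 4"
      by (simp add: sum.distrib sum_distrib_right eval_nat_numeral del: sum_of_bool_eq sum_of_bool_mult_eq)
    also have "(\<Sum>w\<in>V. of_bool (\<delta> / 2 * n ^ 4 \<le> T w)) = real (card ?W)"
      by (rule card_of_bool[OF fin, symmetric])
    also have "\<delta> / 2 * n ^ 5 + real (card ?W) * n ^ 4 \<le> \<delta> / 2 * n ^ 5 + real n0 * n ^ 4"
      using W by (intro add_left_mono mult_right_mono) auto
    finally have "F5_count \<le> \<delta> / 2 * n ^ 5 + (real n0 + 2) * n ^ 4" by (simp add: algebra_simps)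
    also have "(real n0 + 2) * n ^ 4 \<le> \<delta> / 2 * n * n ^ 4" using n2 by (intro mult_right_mono) auto
    also have "\<delta> / 2 * n ^ 5 + \<delta> / 2 * n * n ^ 4 = \<delta> * n ^ 5" by (simp add: eval_nat_numeral)
    finally show "F5_count \<le> \<delta> * n ^ 5" by simp
  qed
qed

context hyper3 begin

lemma N_edges_ge: "6 * real (card E) \<le> N_edges"
proof -
  let ?T = "{p\<in>V \<times> V \<times> V. (case p of (x, y, z) \<Rightarrow> h x y z)}"
  have "N_edges = real (card ?T)"
    using fin by (simp add: N_edges_def card_of_bool sum.cartesian_product split_def del: sum_of_bool_eq)
  have "(\<Sum>e\<in>E. 6) \<le> (\<Sum>e\<in>E. card {p\<in>?T. (case p of (x, y, z) \<Rightarrow> {x, y, z}) = e})"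
  proof (rule sum_mono)
    fix e assume e: "e \<in> E"
    then obtain a b c where abc: "e = {a, b, c}" "a \<noteq> b" "b \<noteq> c" "a \<noteq> c"
      using edges[of e] by (auto simp: card_3_iff)
    have V: "a \<in> V" "b \<in> V" "c \<in> V" using edges[OF e] abc by auto
    let ?X = "{(a, b, c), (a, c, b), (b, a, c), (b, c, a), (c, a, b), (c, b, a)}"
    have "?X \<subseteq> {p\<in>?T. (case p of (x, y, z) \<Rightarrow> {x, y, z}) = e}"
      using e V unfolding abc h_def by (auto simp: insert_commute)
    moreover have "finite {p\<in>?T. (case p of (x, y, z) \<Rightarrow> {x, y, z}) = e}" using fin by auto
    moreover have "card ?X = 6" using abc by auto
    ultimately have "card ?X \<le> card {p\<in>?T. (case p of (x, y, z) \<Rightarrow> {x, y, z}) = e}"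
      by (intro card_mono)
    then show "6 \<le> card {p\<in>?T. (case p of (x, y, z) \<Rightarrow> {x, y, z}) = e}"
      using \<open>card ?X = 6\<close> by (simp only:)
  qed
  also have "\<dots> = card ?T"
  proof -
    have "finite ?T" using fin by simp
    moreover have "(\<lambda>(x, y, z). {x, y, z}) ` ?T \<subseteq> E" by (auto simp: h_def)
    ultimately show ?thesis
      using sum.group[of ?T E "\<lambda>(x, y, z). {x, y, z}" "\<lambda>_. 1 :: nat"] finite_E
      by (simp only: card_eq_sum)
  qed
  finally show ?thesis using \<open>N_edges = real (card ?T)\<close> by simp
qed

end

subsection \<open>Structure relative to a maximum cut\<close>

lemma colours3_cases:
  fixes i j k :: nat
  assumes "i < 3" "j < 3" "k < 3" "i \<noteq> j" "j \<noteq> k" "i \<noteq> k"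
  shows "(i, j, k) \<in> {(0,1,2), (0,2,1), (1,0,2), (1,2,0), (2,0,1), (2,1,0)}"
proof -
  have "x = 0 \<or> x = 1 \<or> x = 2" if "x < 3" for x :: nat using that by linarith
  from this[OF assms(1)] this[OF assms(2)] this[OF assms(3)] assms(4-6) show ?thesis by auto
qed

locale hyper3_col = hyper3 +
  fixes f :: "'a \<Rightarrow> nat"
  assumes f3: "f v < 3"
begin

definition part :: "nat \<Rightarrow> 'a set" where "part i = {v\<in>V. f v = i}"

abbreviation psize :: "nat \<Rightarrow> real" where "psize i \<equiv> real (card (part i))"

definition miss3 :: "nat \<Rightarrow> nat \<Rightarrow> nat \<Rightarrow> real" where
  "miss3 i j k = (\<Sum>x\<in>V. \<Sum>y\<in>V. \<Sum>z\<in>V. of_bool (f x = i \<and> f y = j \<and> f z = k \<and> \<not> h x y z))"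

text \<open>The pairs are ordered, so a missing crossing triple counts twice at each of its vertices
  and six times in the sum over all vertices, whereas \<open>miss3 0 1 2\<close> counts it
  once.\<close>

definition miss :: "'a \<Rightarrow> real" where
  "miss v = (\<Sum>y\<in>V. \<Sum>z\<in>V. of_bool (f v \<noteq> f y \<and> f y \<noteq> f z \<and> f v \<noteq> f z \<and> \<not> h v y z))"

definition cnt :: "'a \<Rightarrow> nat \<Rightarrow> nat \<Rightarrow> real" where
  "cnt b i j = (\<Sum>y\<in>V. \<Sum>z\<in>V. of_bool (f y = i \<and> f z = j \<and> h b y z))"

lemma psize_eq: "psize i = (\<Sum>v\<in>V. of_bool (f v = i))"
  unfolding part_def by (rule card_of_bool[OF fin])

lemma miss3_swap12: "miss3 i j k = miss3 j i k"
  unfolding miss3_def by (subst sum.swap) (simp add: h_sym(1) conj_ac del: sum_of_bool_eq)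

lemma miss3_swap23: "miss3 i j k = miss3 i k j"
  unfolding miss3_def by (subst (2) sum.swap) (simp add: h_sym(2) conj_ac del: sum_of_bool_eq)

lemma colour_cases: "f v = 0 \<or> f v = 1 \<or> f v = 2"
  using f3[of v] by linarith

lemma miss3_perm:
  assumes "i < 3" "j < 3" "k < 3" "i \<noteq> j" "j \<noteq> k" "i \<noteq> k"
  shows "miss3 i j k = miss3 0 1 2"
  using colours3_cases[OF assms]
proof (elim insertE emptyE; simp only: prod.inject; elim conjE; hypsubst)
  show "miss3 0 2 1 = miss3 0 1 2" by (rule miss3_swap23)
  show "miss3 1 0 2 = miss3 0 1 2" by (rule miss3_swap12)
  show "miss3 1 2 0 = miss3 0 1 2" using miss3_swap23[of 1 2 0] miss3_swap12[of 1 0 2] by simp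
  show "miss3 2 0 1 = miss3 0 1 2" using miss3_swap12[of 2 0 1] miss3_swap23[of 0 2 1] by simp
  show "miss3 2 1 0 = miss3 0 1 2" using miss3_swap12[of 2 1 0] miss3_swap23[of 1 2 0] miss3_swap12[of 1 0 2] by simp
qed

lemma miss_total: "(\<Sum>v\<in>V. miss v) = 6 * miss3 0 1 2"
proof -
  have "of_bool (f x \<noteq> f y \<and> f y \<noteq> f z \<and> f x \<noteq> f z \<and> \<not> h x y z) =
     of_bool (f x = 0 \<and> f y = 1 \<and> f z = 2 \<and> \<not> h x y z) + of_bool (f x = 0 \<and> f y = 2 \<and> f z = 1 \<and> \<not> h x y z) +
     of_bool (f x = 1 \<and> f y = 0 \<and> f z = 2 \<and> \<not> h x y z) + of_bool (f x = 1 \<and> f y = 2 \<and> f z = 0 \<and> \<not> h x y z) +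
     of_bool (f x = 2 \<and> f y = 0 \<and> f z = 1 \<and> \<not> h x y z) + (of_bool (f x = 2 \<and> f y = 1 \<and> f z = 0 \<and> \<not> h x y z) :: real)"
    for x y z
    using colour_cases[of x] colour_cases[of y] colour_cases[of z] by (elim disjE) simp_all
  then have "(\<Sum>v\<in>V. miss v) = miss3 0 1 2 + miss3 0 2 1 + miss3 1 0 2 + miss3 1 2 0 + miss3 2 0 1 + miss3 2 1 0"
    unfolding miss_def miss3_def by (simp only: sum.distrib)
  also have "\<dots> = 6 * miss3 0 1 2"
    using miss3_perm[of 0 2 1] miss3_perm[of 1 0 2] miss3_perm[of 1 2 0] miss3_perm[of 2 0 1] miss3_perm[of 2 1 0] by simp
  finally show ?thesis .
qed

lemma prod_psize:
  "psize i * psize j * psize k = (\<Sum>x\<in>V. \<Sum>y\<in>V. \<Sum>z\<in>V. of_bool (f x = i \<and> f y = j \<and> f z = k))"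
  unfolding psize_eq of_bool_conj
  by (simp add: sum_distrib_left[symmetric] sum_distrib_right[symmetric] mult.assoc del: sum_of_bool_eq sum_of_bool_mult_eq)

lemma crossing_le:
  "real (card {e\<in>E. inj_on f e}) \<le> psize 0 * psize 1 * psize 2 - miss3 0 1 2"
proof -
  let ?T = "{p\<in>V \<times> V \<times> V. (case p of (x, y, z) \<Rightarrow> f x = 0 \<and> f y = 1 \<and> f z = 2 \<and> h x y z)}"
  have "{e\<in>E. inj_on f e} \<subseteq> (\<lambda>(x, y, z). {x, y, z}) ` ?T"
  proof
    fix e assume "e \<in> {e\<in>E. inj_on f e}"
    then have e: "e \<in> E" "inj_on f e" by auto
    then have c: "card (f ` e) = 3" using edges[OF e(1)] by (simp add: card_image)
    have "f ` e \<subseteq> {0, 1, 2}" by (intro image_subsetI) (use colour_cases in simp)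
    then have "f ` e = {0, 1, 2}" using c by (intro card_subset_eq) auto
    then obtain x y z where xyz: "x \<in> e" "y \<in> e" "z \<in> e" "f x = 0" "f y = 1" "f z = 2"
      by (metis (no_types, lifting) imageE insertI1 insertI2)
    then have "card {x, y, z} = 3" by (auto simp: card_insert_if)
    moreover have "finite e" using edges[OF e(1)] by (intro card_ge_0_finite) simp
    ultimately have "{x, y, z} = e" using xyz edges[OF e(1)] by (intro card_subset_eq) auto
    then show "e \<in> (\<lambda>(x, y, z). {x, y, z}) ` ?T"
      using xyz e(1) edges[OF e(1)] by (intro image_eqI[of _ _ "(x, y, z)"]) (auto simp: h_def)
  qed
  then have "card {e\<in>E. inj_on f e} \<le> card ?T"
    using fin by (intro surj_card_le) auto
  then have "real (card {e\<in>E. inj_on f e}) \<le> real (card ?T)" by simp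
  also have "\<dots> = (\<Sum>x\<in>V. \<Sum>y\<in>V. \<Sum>z\<in>V. of_bool (f x = 0 \<and> f y = 1 \<and> f z = 2 \<and> h x y z))"
    using fin by (simp add: card_of_bool sum.cartesian_product split_def del: sum_of_bool_eq)
  also have "\<dots> = (\<Sum>x\<in>V. \<Sum>y\<in>V. \<Sum>z\<in>V. of_bool (f x = 0 \<and> f y = 1 \<and> f z = 2) - of_bool (f x = 0 \<and> f y = 1 \<and> f z = 2 \<and> \<not> h x y z))"
    by (intro sum.cong refl) auto
  also have "\<dots> = psize 0 * psize 1 * psize 2 - miss3 0 1 2"
    by (simp only: sum_subtractf prod_psize miss3_def)
  finally show ?thesis .
qed

lemma psize_sum: "psize 0 + psize 1 + psize 2 = n"
proof -
  have "(of_bool (f v = 0) + of_bool (f v = 1) + of_bool (f v = 2) :: real) = 1" for v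
    using colour_cases[of v] by auto
  then show ?thesis unfolding psize_eq sum.distrib[symmetric] by simp
qed

lemma crossing_at_vertex:
  assumes b: "b \<in> V" and ijk: "f b = i" "j < 3" "k < 3" "i \<noteq> j" "j \<noteq> k" "i \<noteq> k"
  shows "real (card {e\<in>E. b \<in> e \<and> inj_on f e}) = cnt b j k"
proof -
  let ?T = "{p\<in>V \<times> V. (case p of (y, z) \<Rightarrow> f y = j \<and> f z = k \<and> h b y z)}"
  have "bij_betw (\<lambda>(y, z). {b, y, z}) ?T {e\<in>E. b \<in> e \<and> inj_on f e}"
    unfolding bij_betw_def
  proof
    show "inj_on (\<lambda>(y, z). {b, y, z}) ?T"
    proof (rule inj_onI)
      fix p q assume pq: "p \<in> ?T" "q \<in> ?T" and eq: "(case p of (y, z) \<Rightarrow> {b, y, z}) = (case q of (y, z) \<Rightarrow> {b, y, z})"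
      obtain y z where p: "p = (y, z)" by (cases p)
      obtain u v where q: "q = (u, v)" by (cases q)
      have c: "f y = j" "f z = k" "f u = j" "f v = k" using pq p q by auto
      have s: "{b, y, z} = {b, u, v}" using eq p q by simp
      have "y \<in> {b, u, v}" "z \<in> {b, u, v}" using s by blast+
      then show "p = q" using c ijk p q by auto
    qed
    show "(\<lambda>(y, z). {b, y, z}) ` ?T = {e\<in>E. b \<in> e \<and> inj_on f e}"
    proof (intro subset_antisym subsetI)
      fix e assume "e \<in> (\<lambda>(y, z). {b, y, z}) ` ?T"
      then obtain y z where "e = {b, y, z}" "f y = j" "f z = k" "h b y z" by auto
      then show "e \<in> {e\<in>E. b \<in> e \<and> inj_on f e}" using ijk by (auto simp: h_def inj_on_def)
    next
      fix e assume "e \<in> {e\<in>E. b \<in> e \<and> inj_on f e}"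
      then have e: "e \<in> E" "b \<in> e" "inj_on f e" by auto
      have c3: "card e = 3" and "e \<subseteq> V" using edges[OF e(1)] by auto
      then have fe: "finite e" using fin finite_subset by auto
      have i3: "i < 3" using ijk(1) f3[of b] by simp
      have "f ` e \<subseteq> {..<3}" using f3 by auto
      moreover have "card (f ` e) = 3" using c3 e(3) by (simp add: card_image)
      ultimately have "f ` e = {..<3}" by (intro card_subset_eq) auto
      then have "j \<in> f ` e" "k \<in> f ` e" using ijk by auto
      then obtain y z where yz: "y \<in> e" "z \<in> e" "f y = j" "f z = k" by auto
      then have "card {b, y, z} = 3" using ijk by (auto simp: card_insert_if)
      then have "{b, y, z} = e" using yz e c3 fe by (intro card_subset_eq) auto
      then show "e \<in> (\<lambda>(y, z). {b, y, z}) ` ?T"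
        using yz e(1) \<open>e \<subseteq> V\<close> by (intro image_eqI[of _ _ "(y, z)"]) (auto simp: h_def)
    qed
  qed
  then have "real (card {e\<in>E. b \<in> e \<and> inj_on f e}) = real (card ?T)" by (simp add: bij_betw_same_card)
  also have "\<dots> = cnt b j k"
    using fin by (simp add: card_of_bool cnt_def sum.cartesian_product split_def del: sum_of_bool_eq)
  finally show ?thesis .
qed

end

context hyper3 begin

lemma exists_max_cut:
  fixes f0 :: "'a \<Rightarrow> nat"
  assumes "\<And>v. f0 v < 3"
  obtains f :: "'a \<Rightarrow> nat" where "\<And>v. f v < 3" "\<And>f' :: 'a \<Rightarrow> nat. (\<And>v. f' v < 3) \<Longrightarrow> card {e\<in>E. inj_on f' e} \<le> card {e\<in>E. inj_on f e}"
proof -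
  have "\<exists>f :: 'a \<Rightarrow> nat. (\<forall>v. f v < 3) \<and> (\<forall>f' :: 'a \<Rightarrow> nat. (\<forall>v. f' v < 3) \<longrightarrow> card {e\<in>E. inj_on f' e} \<le> card {e\<in>E. inj_on f e})"
  proof (rule ex_has_greatest_nat[of "\<lambda>f. \<forall>v. f v < 3" f0 "\<lambda>f. card {e\<in>E. inj_on f e}" "Suc (card E)"])
    show "\<forall>y. (\<forall>v. y v < 3) \<longrightarrow> card {e\<in>E. inj_on y e} < Suc (card E)"
      using finite_E by (auto intro!: card_mono less_Suc_eq_le[THEN iffD2])
  qed (use assms in auto)
  then show thesis using that by blast
qed

end

locale hyper3_cut = hyper3_col +
  assumes max_cut: "\<And>f' :: 'a \<Rightarrow> nat. (\<And>v. f' v < 3) \<Longrightarrow> card {e\<in>E. inj_on f' e} \<le> card {e\<in>E. inj_on f e}"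
begin

text \<open>Moving b to the third colour k leaves the crossing edges away from b unchanged and turns
  those at b into the edges between parts i and j; maximality of the cut forbids a gain.\<close>

lemma cut_vertex:
  assumes b: "b \<in> V" and ijk: "f b = i" "j < 3" "k < 3" "i \<noteq> j" "j \<noteq> k" "i \<noteq> k"
  shows "cnt b i j \<le> cnt b k j"
proof -
  define f' where "f' = f(b := k)"
  interpret c: hyper3_col V E f' using f3 ijk by unfold_locales (auto simp: f'_def)
  have i3: "i < 3" using f3[of b] ijk(1) by simp
  have split: "card {e\<in>E. inj_on u e} = card {e\<in>E. b \<in> e \<and> inj_on u e} + card {e\<in>E. b \<notin> e \<and> inj_on u e}" for u :: "'a \<Rightarrow> nat"
    using finite_E by (subst card_Un_disjoint[symmetric]) (auto intro: arg_cong[where f = card])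
  have "{e\<in>E. b \<notin> e \<and> inj_on f' e} = {e\<in>E. b \<notin> e \<and> inj_on f e}"
    by (auto simp: f'_def inj_on_def fun_upd_def)
  then have "card {e\<in>E. b \<in> e \<and> inj_on f' e} \<le> card {e\<in>E. b \<in> e \<and> inj_on f e}"
    using max_cut[of f'] c.f3 split[of f] split[of f'] by simp
  then have "c.cnt b i j \<le> cnt b k j"
    using crossing_at_vertex[OF b ijk(1) ijk(3,2)] c.crossing_at_vertex[OF b _ i3 ijk(2), of k] ijk
    by (simp add: f'_def)
  \<comment> \<open>Recolouring b is invisible in this count, because b is not among the other two
    vertices of an edge through b.\<close>
  moreover have "c.cnt b i j = cnt b i j"
    unfolding c.cnt_def cnt_def using h_D by (intro sum.cong refl arg_cong[where f = "of_bool :: bool \<Rightarrow> real"]) (auto simp: f'_def)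
  ultimately show ?thesis by simp
qed

end

context hyper3_col begin

definition good_part :: "real \<Rightarrow> nat \<Rightarrow> 'a set" where "good_part \<mu> i = {v\<in>V. f v = i \<and> miss v \<le> \<mu> * n ^ 2}"

text \<open>Only the two s-sets must consist of typical vertices of one part, whereas
  \<open>T\<close> is arbitrary. One condition therefore serves the edges inside a part as well as
  those with exactly two vertices in it.\<close>

definition clean :: "real \<Rightarrow> nat \<Rightarrow> nat \<Rightarrow> bool" where
  "clean \<mu> t s \<longleftrightarrow> (\<forall>i S0 S1 T. S0 \<subseteq> good_part \<mu> i \<longrightarrow> S1 \<subseteq> good_part \<mu> i \<longrightarrow> S0 \<inter> S1 = {} \<longrightarrow> T \<subseteq> V \<longrightarrow>
     card S0 = s \<longrightarrow> card S1 = s \<longrightarrow> card T = t \<longrightarrow> \<not> (\<forall>v\<in>T. \<forall>x\<in>S0. \<forall>y\<in>S1. h v x y))"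

lemma cleanD:
  assumes "clean \<mu> t s" "S0 \<subseteq> good_part \<mu> i" "S1 \<subseteq> good_part \<mu> i" "S0 \<inter> S1 = {}" "T \<subseteq> V"
    "card S0 = s" "card S1 = s" "card T = t" "\<And>v x y. v \<in> T \<Longrightarrow> x \<in> S0 \<Longrightarrow> y \<in> S1 \<Longrightarrow> h v x y"
  shows False
  using assms(1)[unfolded clean_def, rule_format, OF assms(2-8)] assms(9) by simp

lemma cnt_nonneg: "cnt b i j \<ge> 0"
  by (simp add: cnt_def sum_nonneg)

lemma bound_mono_edges:
  assumes clean: "clean \<mu> t s" and ts: "t > 0" "s > 0"
  shows "card {e\<in>E. e \<subseteq> good_part \<mu> i} \<le> ex3 (card (part i)) (K3 t s s)"
proof (rule ex3_ge)
  show "finite (part i)" using fin by (simp add: part_def)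
  show "e \<subseteq> part i \<and> card e = 3" if "e \<in> {e\<in>E. e \<subseteq> good_part \<mu> i}" for e
    using that edges[of e] by (auto simp: good_part_def part_def)
  show "\<not> contains_copy (part i, {e\<in>E. e \<subseteq> good_part \<mu> i}) (K3 t s s)"
  proof
    assume "contains_copy (part i, {e\<in>E. e \<subseteq> good_part \<mu> i}) (K3 t s s)"
    then obtain \<phi> where \<phi>: "inj_on \<phi> (verts (K3 t s s))" "\<And>e. e \<in> hedges (K3 t s s) \<Longrightarrow> \<phi> ` e \<in> E \<and> \<phi> ` e \<subseteq> good_part \<mu> i"
      by (auto simp: contains_copy_def)
    let ?A = "{..<t}" and ?B = "{t..<t+s}" and ?C = "{t+s..<t+s+s}"
    have vs: "verts (K3 t s s) = ?A \<union> ?B \<union> ?C" by (simp add: K3_def complete3_def)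
    have inj: "inj_on \<phi> ?A" "inj_on \<phi> ?B" "inj_on \<phi> ?C" using \<phi>(1) unfolding vs by (auto intro: inj_on_subset)
    have "\<phi> ` verts (K3 t s s) \<subseteq> good_part \<mu> i" using K3_covered[OF ts] \<phi>(2) by blast
    then have im: "\<phi> ` ?A \<subseteq> good_part \<mu> i" "\<phi> ` ?B \<subseteq> good_part \<mu> i" "\<phi> ` ?C \<subseteq> good_part \<mu> i" unfolding vs by auto
    have "\<phi> ` ?B \<inter> \<phi> ` ?C = {}"
    proof -
      have "\<phi> ` (?B \<inter> ?C) = \<phi> ` ?B \<inter> \<phi> ` ?C" using \<phi>(1) unfolding vs by (rule inj_on_image_Int) auto
      moreover have "?B \<inter> ?C = {}" by auto
      ultimately show ?thesis by simp
    qed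
    moreover have "h v x y" if "v \<in> \<phi> ` ?A" "x \<in> \<phi> ` ?B" "y \<in> \<phi> ` ?C" for v x y
    proof -
      obtain a b c where abc: "a \<in> ?A" "b \<in> ?B" "c \<in> ?C" "v = \<phi> a" "x = \<phi> b" "y = \<phi> c" using \<open>v \<in> \<phi> ` ?A\<close> \<open>x \<in> \<phi> ` ?B\<close> \<open>y \<in> \<phi> ` ?C\<close> by (elim imageE)
      then have "{a, b, c} \<in> hedges (K3 t s s)" unfolding K3_def complete3_def snd_conv by blast
      from \<phi>(2)[OF this] show ?thesis using abc by (simp add: h_def)
    qed
    moreover have "\<phi> ` ?A \<subseteq> V" using im(1) by (auto simp: good_part_def)
    moreover have "card (\<phi> ` ?A) = t" "card (\<phi> ` ?B) = s" "card (\<phi> ` ?C) = s" using inj by (simp_all add: card_image)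
    ultimately show False by (intro cleanD[OF clean im(2,3)])
  qed
qed

text \<open>
  A vertex \<open>b\<close> lying with many pairs inside its own part is the apex \<open>w\<close> of many copies of \<open>F\<^sub>5\<close>: the
  pair \<open>c, d\<close> from the link of \<open>b\<close> has many common crossing pairs \<open>a, b'\<close>.
\<close>

lemma crossing_bad_pairs:
  assumes h_b: "cnt b i i > \<nu> * n ^ 2" and b: "f b = i" and jk: "psize j * psize k \<ge> n ^ 2 / 30"
    and ijk: "i \<noteq> j" "j \<noteq> k" "i \<noteq> k" "j < 3" "k < 3" and miss: "miss3 0 1 2 \<le> 2 * \<epsilon> * n ^ 3" and nu: "\<nu> \<ge> 0"
  shows "(\<nu> / 30 - 4 * \<epsilon>) * n ^ 4 \<le> (\<Sum>a\<in>V. \<Sum>b'\<in>V. \<Sum>c\<in>V. \<Sum>d\<in>V.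
     of_bool (F5_at a b' c d b))" (is "_ \<le> ?S")
proof -
  have i3: "i < 3" using f3[of b] b by simp
  have m: "miss3 j k i = miss3 0 1 2" using ijk i3 by (intro miss3_perm) auto
  have "psize j * psize k * cnt b i i = (\<Sum>a\<in>V. \<Sum>b'\<in>V. \<Sum>c\<in>V. \<Sum>d\<in>V. of_bool (f a = j) * (of_bool (f b' = k) * of_bool (f c = i \<and> f d = i \<and> h b c d)))"
    unfolding psize_eq cnt_def
    by (simp add: sum_distrib_left[symmetric] sum_distrib_right[symmetric] mult.assoc del: sum_of_bool_eq sum_of_bool_mult_eq)
  also have "\<dots> \<le> (\<Sum>a\<in>V. \<Sum>b'\<in>V. \<Sum>c\<in>V. \<Sum>d\<in>V. of_bool (F5_at a b' c d b)
     + of_bool (f a = j \<and> f b' = k \<and> f c = i \<and> \<not> h a b' c) + of_bool (f a = j \<and> f b' = k \<and> f d = i \<and> \<not> h a b' d))"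
  proof (intro sum_mono)
    fix a b' c d
    have "h c d b = h b c d" by (metis h_sym)
    then show "of_bool (f a = j) * (of_bool (f b' = k) * of_bool (f c = i \<and> f d = i \<and> h b c d))
       \<le> of_bool (F5_at a b' c d b)
     + of_bool (f a = j \<and> f b' = k \<and> f c = i \<and> \<not> h a b' c) + (of_bool (f a = j \<and> f b' = k \<and> f d = i \<and> \<not> h a b' d) :: real)"
      using b ijk by (auto simp: F5_at_def)
  qed
  also have "\<dots> = ?S + n * miss3 j k i + n * miss3 j k i"
  proof -
    have 1: "(\<Sum>a\<in>V. \<Sum>b'\<in>V. \<Sum>c\<in>V. \<Sum>d\<in>V. of_bool (f a = j \<and> f b' = k \<and> f c = i \<and> \<not> h a b' c)) = n * miss3 j k i"
      by (simp add: miss3_def sum_distrib_left del: sum_of_bool_eq sum_of_bool_mult_eq)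
    have 2: "(\<Sum>a\<in>V. \<Sum>b'\<in>V. \<Sum>c\<in>V. \<Sum>d\<in>V. of_bool (f a = j \<and> f b' = k \<and> f d = i \<and> \<not> h a b' d)) = n * miss3 j k i"
      by (simp add: miss3_def sum_distrib_left del: sum_of_bool_eq sum_of_bool_mult_eq)
    show ?thesis by (simp only: sum.distrib 1 2)
  qed
  finally have "psize j * psize k * cnt b i i \<le> ?S + 2 * n * miss3 0 1 2" by (simp add: m)
  moreover have "psize j * psize k * cnt b i i \<ge> (n ^ 2 / 30) * (\<nu> * n ^ 2)"
    using jk h_b nu by (intro mult_mono) auto
  moreover have "2 * n * miss3 0 1 2 \<le> 2 * n * (2 * \<epsilon> * n ^ 3)" using miss by (intro mult_left_mono) auto
  ultimately show ?thesis by (simp add: algebra_simps eval_nat_numeral)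
qed

end

text \<open>
  If \<open>b\<close> has many pairs between its own part \<open>i\<close> and part \<open>j\<close>, then by maximality of the cut it also
  has many pairs between \<open>j\<close> and the third part \<open>k\<close>. Taking \<open>a, b'\<close> from the former and \<open>d, w\<close> from
  the latter, \<open>b\<close> is a base vertex of many copies of \<open>F\<^sub>5\<close>.
\<close>

lemma (in hyper3_cut) cut_bad_pairs:
  assumes h_b: "cnt b i j > \<nu> * n ^ 2" and bV: "b \<in> V" and b: "f b = i"
    and ijk: "i \<noteq> j" "j \<noteq> k" "i \<noteq> k" "j < 3" "k < 3" and miss: "miss3 0 1 2 \<le> 2 * \<epsilon> * n ^ 3" and nu: "\<nu> \<ge> 0"
  shows "(\<nu> ^ 2 - 2 * \<epsilon>) * n ^ 4 - n ^ 3 \<le> (\<Sum>a\<in>V. \<Sum>b'\<in>V. \<Sum>d\<in>V. \<Sum>w\<in>V.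
     of_bool (F5_at a b' b d w))" (is "_ \<le> ?S")
proof -
  have i3: "i < 3" using f3[of b] b by simp
  have m: "miss3 i j k = miss3 0 1 2" using ijk i3 by (intro miss3_perm) auto
  have "cnt b i j * cnt b k j = (\<Sum>a\<in>V. \<Sum>b'\<in>V. \<Sum>d\<in>V. \<Sum>w\<in>V. of_bool (f a = i \<and> f b' = j \<and> h b a b') * of_bool (f d = k \<and> f w = j \<and> h b d w))"
    unfolding cnt_def
    by (simp add: sum_distrib_left[symmetric] sum_distrib_right[symmetric] mult.assoc del: sum_of_bool_eq sum_of_bool_mult_eq)
  \<comment> \<open>The triple a, b', d is crossing, so its failure is paid by \<open>miss3\<close>.
    Since a and w have different colours, the only degenerate case is w = b', which costs
    n^3.\<close>
  also have "\<dots> \<le> (\<Sum>a\<in>V. \<Sum>b'\<in>V. \<Sum>d\<in>V. \<Sum>w\<in>V. of_bool (F5_at a b' b d w)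
     + of_bool (f a = i \<and> f b' = j \<and> f d = k \<and> \<not> h a b' d) + of_bool (w = b'))"
  proof (intro sum_mono)
    fix a b' d w
    have "h a b' b = h b a b'" by (metis h_sym)
    then show "of_bool (f a = i \<and> f b' = j \<and> h b a b') * of_bool (f d = k \<and> f w = j \<and> h b d w)
       \<le> of_bool (F5_at a b' b d w)
     + of_bool (f a = i \<and> f b' = j \<and> f d = k \<and> \<not> h a b' d) + (of_bool (w = b') :: real)"
      using b ijk by (auto simp: F5_at_def)
  qed
  also have "\<dots> = ?S + n * miss3 i j k + n ^ 3"
  proof -
    have 1: "(\<Sum>a\<in>V. \<Sum>b'\<in>V. \<Sum>d\<in>V. \<Sum>w\<in>V. of_bool (f a = i \<and> f b' = j \<and> f d = k \<and> \<not> h a b' d)) = n * miss3 i j k"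
      by (simp add: miss3_def sum_distrib_left del: sum_of_bool_eq sum_of_bool_mult_eq)
    have "(\<Sum>w\<in>V. of_bool (w = b')) = (1::real)" if "b' \<in> V" for b' using that fin by (simp add: of_bool_def sum.delta')
    then have 2: "(\<Sum>a\<in>V. \<Sum>b'\<in>V. \<Sum>d\<in>V. \<Sum>w\<in>V. of_bool (w = b')) = n ^ 3"
      by (simp add: eval_nat_numeral del: sum_of_bool_eq sum_of_bool_mult_eq)
    show ?thesis by (simp only: sum.distrib 1 2)
  qed
  finally have "cnt b i j * cnt b k j \<le> ?S + n * miss3 0 1 2 + n ^ 3" by (simp add: m)
  moreover have "cnt b i j * cnt b k j \<ge> (\<nu> * n ^ 2) * (\<nu> * n ^ 2)"
    using h_b nu cut_vertex[OF bV b ijk(4,5,1-3)] by (intro mult_mono) (auto intro: cnt_nonneg)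
  moreover have "n * miss3 0 1 2 \<le> n * (2 * \<epsilon> * n ^ 3)" using miss by (intro mult_left_mono) auto
  ultimately show ?thesis by (simp add: algebra_simps eval_nat_numeral)
qed

section \<open>Atypical vertices and the classification of edges\<close>

context hyper3_col begin

definition bad_deg :: "'a \<Rightarrow> real" where "bad_deg b = (\<Sum>y\<in>V. \<Sum>z\<in>V. of_bool (f y = f b \<and> h b y z))"

lemma bad_deg_eq: "bad_deg b = cnt b (f b) 0 + cnt b (f b) 1 + cnt b (f b) 2"
proof -
  have "(of_bool (f y = f b \<and> h b y z) :: real) = of_bool (f y = f b \<and> f z = 0 \<and> h b y z)
     + of_bool (f y = f b \<and> f z = 1 \<and> h b y z) + of_bool (f y = f b \<and> f z = 2 \<and> h b y z)" for y z
    using colour_cases[of z] by auto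
  then show ?thesis unfolding bad_deg_def cnt_def by (simp only: sum.distrib)
qed

lemma bad_deg_le: "bad_deg b \<le> n ^ 2"
proof -
  have "bad_deg b \<le> (\<Sum>y\<in>V. \<Sum>z\<in>V. 1)" unfolding bad_deg_def by (intro sum_mono) auto
  then show ?thesis by (simp add: power2_eq_square)
qed

definition not_good :: "real \<Rightarrow> 'a set" where "not_good \<mu> = {v\<in>V. \<not> miss v \<le> \<mu> * n ^ 2}"

text \<open>Markov's inequality for \<open>miss\<close>. Read in the other direction, each atypical
  vertex accounts for at least \<mu> n^2 / 6 missing crossing triples, the budget from which its
  non-crossing edges are paid.\<close>

lemma card_not_good: "real (card (not_good \<mu>)) * (\<mu> * n ^ 2) \<le> 6 * miss3 0 1 2"
proof -
  have "real (card (not_good \<mu>)) * (\<mu> * n ^ 2) = (\<Sum>v\<in>not_good \<mu>. \<mu> * n ^ 2)" by simp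
  also have "\<dots> \<le> (\<Sum>v\<in>not_good \<mu>. miss v)" by (intro sum_mono) (auto simp: not_good_def)
  also have "\<dots> \<le> (\<Sum>v\<in>V. miss v)" using fin
    by (intro sum_mono2) (auto simp: not_good_def miss_def sum_nonneg)
  finally show ?thesis by (simp add: miss_total)
qed

definition bad_edges :: "real \<Rightarrow> 'a set set" where
  "bad_edges \<mu> = {e\<in>E. \<exists>b\<in>not_good \<mu>. \<exists>y z. e = {b, y, z} \<and> f y = f b}"

definition bip_edges :: "real \<Rightarrow> nat \<Rightarrow> nat \<Rightarrow> 'a set set" where
  "bip_edges \<mu> i j = {e\<in>E. \<exists>x\<in>good_part \<mu> i. \<exists>y\<in>good_part \<mu> i. \<exists>z\<in>part j. e = {x, y, z}}"

lemma card_bad_edges: "real (card (bad_edges \<mu>)) \<le> (\<Sum>b\<in>not_good \<mu>. bad_deg b)"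
proof -
  let ?T = "SIGMA b:not_good \<mu>. {p\<in>V \<times> V. (case p of (y, z) \<Rightarrow> f y = f b \<and> h b y z)}"
  have fB: "finite (not_good \<mu>)" using fin by (simp add: not_good_def)
  have "bad_edges \<mu> \<subseteq> (\<lambda>(b, y, z). {b, y, z}) ` ?T"
  proof
    fix e assume "e \<in> bad_edges \<mu>"
    then obtain b y z where e: "e \<in> E" "b \<in> not_good \<mu>" "e = {b, y, z}" "f y = f b" by (auto simp: bad_edges_def)
    moreover have "y \<in> V" "z \<in> V" using e edges[OF e(1)] by auto
    ultimately show "e \<in> (\<lambda>(b, y, z). {b, y, z}) ` ?T" by (intro image_eqI[of _ _ "(b, y, z)"]) (auto simp: h_def)
  qed
  then have "card (bad_edges \<mu>) \<le> card ?T" using fin fB by (intro surj_card_le finite_SigmaI) auto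
  then have "real (card (bad_edges \<mu>)) \<le> real (card ?T)" by simp
  also have "\<dots> = (\<Sum>b\<in>not_good \<mu>. real (card {p\<in>V \<times> V. (case p of (y, z) \<Rightarrow> f y = f b \<and> h b y z)}))"
    using fin fB by (subst card_SigmaI) auto
  also have "\<dots> = (\<Sum>b\<in>not_good \<mu>. bad_deg b)"
    using fin by (intro sum.cong refl) (simp add: card_of_bool bad_deg_def sum.cartesian_product split_def del: sum_of_bool_eq)
  finally show ?thesis .
qed

text \<open>Outside \<open>W\<close> a vertex has at most \<nu> n^2 non-crossing pairs for each of
  the three colours of the remaining vertex, hence 3 \<nu> n^2 in total; inside \<open>W\<close> the
  trivial bound n^2 is used.\<close>

lemma bad_edges_bound:
  assumes W: "W = {b\<in>V. \<exists>j<3. cnt b (f b) j > \<nu> * n ^ 2}" and nu: "\<nu> \<ge> 0"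
  shows "real (card (bad_edges \<mu>)) \<le> real (card W) * n ^ 2 + real (card (not_good \<mu>)) * (3 * \<nu> * n ^ 2)"
proof -
  have fB: "finite (not_good \<mu>)" and BV: "not_good \<mu> \<subseteq> V" and fW: "finite W" using fin by (auto simp: not_good_def W)
  have "(\<Sum>b\<in>not_good \<mu>. bad_deg b) \<le> (\<Sum>b\<in>not_good \<mu>. of_bool (b \<in> W) * n ^ 2 + 3 * \<nu> * n ^ 2)"
  proof (rule sum_mono)
    fix b assume b: "b \<in> not_good \<mu>"
    show "bad_deg b \<le> of_bool (b \<in> W) * n ^ 2 + 3 * \<nu> * n ^ 2"
    proof (cases "b \<in> W")
      case True
      have "0 \<le> 3 * \<nu> * n ^ 2" using nu by simp
      then show ?thesis using True bad_deg_le[of b] by simp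
    next
      case False
      moreover have "b \<in> V" using b BV by auto
      ultimately have "\<not> (\<exists>j<3. cnt b (f b) j > \<nu> * n ^ 2)" by (simp add: W)
      then have "cnt b (f b) j \<le> \<nu> * n ^ 2" if "j < 3" for j using that by (meson not_less)
      then have "cnt b (f b) 0 \<le> \<nu> * n ^ 2" "cnt b (f b) 1 \<le> \<nu> * n ^ 2" "cnt b (f b) 2 \<le> \<nu> * n ^ 2" by auto
      then show ?thesis using False by (simp add: bad_deg_eq)
    qed
  qed
  also have "\<dots> = (\<Sum>b\<in>not_good \<mu>. of_bool (b \<in> W)) * n ^ 2 + real (card (not_good \<mu>)) * (3 * \<nu> * n ^ 2)"
    by (simp add: sum.distrib sum_distrib_right del: sum_of_bool_eq sum_of_bool_mult_eq)
  also have "(\<Sum>b\<in>not_good \<mu>. of_bool (b \<in> W)) = real (card {b\<in>not_good \<mu>. b \<in> W})" by (rule card_of_bool[OF fB, symmetric])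
  also have "real (card {b\<in>not_good \<mu>. b \<in> W}) * n ^ 2 + real (card (not_good \<mu>)) * (3 * \<nu> * n ^ 2)
     \<le> real (card W) * n ^ 2 + real (card (not_good \<mu>)) * (3 * \<nu> * n ^ 2)"
  proof -
    have "card {b\<in>not_good \<mu>. b \<in> W} \<le> card W" using fW by (intro card_mono) auto
    then show ?thesis by (intro add_right_mono mult_right_mono) auto
  qed
  finally show ?thesis using card_bad_edges[of \<mu>] by linarith
qed

text \<open>A non-crossing edge that is not in \<open>bad_edges\<close> has two typical vertices of
  one colour. If the third vertex shares that colour it must be typical as well; if not, it may be
  atypical, which is why \<open>bip_edges\<close> restricts only two of the vertices.\<close>

lemma edge_classification:
  "E \<subseteq> {e\<in>E. inj_on f e} \<union> (\<Union>i\<in>{..<3}. {e\<in>E. e \<subseteq> good_part \<mu> i})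
     \<union> (\<Union>p\<in>{(i, j). i < 3 \<and> j < 3 \<and> i \<noteq> j}. bip_edges \<mu> (fst p) (snd p)) \<union> bad_edges \<mu>"
proof
  fix e assume e: "e \<in> E"
  have good_part: "v \<in> good_part \<mu> (f v) \<or> v \<in> not_good \<mu>" if "v \<in> V" for v using that by (auto simp: good_part_def not_good_def)
  show "e \<in> {e\<in>E. inj_on f e} \<union> (\<Union>i\<in>{..<3}. {e\<in>E. e \<subseteq> good_part \<mu> i})
     \<union> (\<Union>p\<in>{(i, j). i < 3 \<and> j < 3 \<and> i \<noteq> j}. bip_edges \<mu> (fst p) (snd p)) \<union> bad_edges \<mu>"
  proof (cases "inj_on f e \<or> e \<in> bad_edges \<mu>")
    case True then show ?thesis using e by auto
  next
    case False
    then obtain x y where xy: "x \<in> e" "y \<in> e" "x \<noteq> y" "f x = f y" by (auto simp: inj_on_def)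
    have fe: "finite e" "card e = 3" "e \<subseteq> V" using edges[OF e] finite_subset[OF _ fin] by auto
    have "card (e - {x, y}) = 1" using xy fe by (subst card_Diff_subset) auto
    then obtain z where z: "e - {x, y} = {z}" by (auto simp: card_1_singleton_iff)
    then have ez: "e = {x, y, z}" "z \<noteq> x" "z \<noteq> y" using xy by auto
    have V: "x \<in> V" "y \<in> V" "z \<in> V" using fe ez by auto
    have nb: "\<not> (b \<in> not_good \<mu> \<and> e = {b, u, v} \<and> f u = f b)" for b u v
      using False e by (auto simp: bad_edges_def)
    have "x \<in> good_part \<mu> (f x)" using good_part[OF V(1)] nb[of x y z] ez xy by auto
    moreover have "y \<in> good_part \<mu> (f x)" using good_part[OF V(2)] nb[of y x z] ez xy by (auto simp: insert_commute)
    ultimately have g: "x \<in> good_part \<mu> (f x)" "y \<in> good_part \<mu> (f x)" .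
    show ?thesis
    proof (cases "f z = f x")
      case True
      then have "z \<in> good_part \<mu> (f x)" using good_part[OF V(3)] nb[of z x y] ez xy by (auto simp: insert_commute)
      then have "e \<in> {e\<in>E. e \<subseteq> good_part \<mu> (f x)}" using g ez e by auto
      then show ?thesis using f3[of x] by blast
    next
      case False
      have "z \<in> part (f z)" using V by (simp add: part_def)
      then have "e \<in> bip_edges \<mu> (fst (f x, f z)) (snd (f x, f z))" using g ez e unfolding bip_edges_def by auto
      moreover have "(f x, f z) \<in> {(i, j). i < 3 \<and> j < 3 \<and> i \<noteq> j}" using f3 False by auto
      ultimately show ?thesis by blast
    qed
  qed
qed

end

text \<open>The s-sets of a copy lie in part i, and every vertex of part i on an edge of
  \<open>bip_edges\<close> is typical; such a copy would thus contradict cleanness.\<close>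

lemma bound_bip_edges:
  fixes V :: "nat set"
  assumes H: "hyper3_col V E f" and clean: "hyper3_col.clean V E f \<mu> t s" and ts: "t > 0" "s > 0" and ij: "i \<noteq> j"
  shows "card (hyper3_col.bip_edges V E f \<mu> i j) \<le>
    ex3_bip (card (hyper3_col.part V f j)) (card (hyper3_col.part V f i)) t s"
proof -
  interpret hyper3_col V E f by (rule H)
  have gpi: "good_part \<mu> i \<subseteq> part i" by (auto simp: good_part_def part_def)
  have dis: "part j \<inter> part i = {}" using ij by (auto simp: part_def)
  have eb: "\<exists>x y z. x \<in> good_part \<mu> i \<and> y \<in> good_part \<mu> i \<and> z \<in> part j \<and> x \<noteq> y \<and> e = {x, y, z}" if eb: "e \<in> bip_edges \<mu> i j" for e
  proof -
    obtain x y z where xyz: "x \<in> good_part \<mu> i" "y \<in> good_part \<mu> i" "z \<in> part j" "e = {x, y, z}" "e \<in> E"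
      using eb unfolding bip_edges_def by blast
    then have "h x y z" by (simp add: h_def)
    then show ?thesis using xyz h_D by blast
  qed
  have "bip_free t s (part j) (part i) (bip_edges \<mu> i j)"
    unfolding bip_free_def
  proof (intro conjI ballI)
    show "part j \<inter> part i = {}" by (rule dis)
    have parts: "e \<subseteq> part j \<union> part i \<and> card (e \<inter> part j) = 1 \<and> card (e \<inter> part i) = 2" if e1: "e \<in> bip_edges \<mu> i j" for e
    proof -
      obtain x y z where xyz: "x \<in> good_part \<mu> i" "y \<in> good_part \<mu> i" "z \<in> part j" "x \<noteq> y" "e = {x, y, z}" using eb[OF e1] by blast
      have m: "x \<in> part i" "y \<in> part i" "z \<notin> part i" "x \<notin> part j" "y \<notin> part j" using xyz gpi dis by auto
      have "e \<inter> part j = {z}" "e \<inter> part i = {x, y}" using m xyz by auto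
      then show ?thesis using m xyz by auto
    qed
    show "hyper3 (part j \<union> part i) (bip_edges \<mu> i j)"
    proof
      show "finite (part j \<union> part i)" using fin by (simp add: part_def)
      show "e \<subseteq> part j \<union> part i \<and> card e = 3" if "e \<in> bip_edges \<mu> i j" for e
        using parts[OF that] edges[of e] that by (simp add: bip_edges_def)
    qed
    show "card (e \<inter> part j) = 1" "card (e \<inter> part i) = 2" if "e \<in> bip_edges \<mu> i j" for e
      using parts[OF that] by simp_all
    show "\<not> contains_bip_copy (part j) (part i) (part j \<union> part i, bip_edges \<mu> i j) t s"
    proof
      assume "contains_bip_copy (part j) (part i) (part j \<union> part i, bip_edges \<mu> i j) t s"
      then obtain T X Y where T: "T \<subseteq> part j" "X \<subseteq> part i" "Y \<subseteq> part i" "X \<inter> Y = {}"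
        "card T = t" "card X = s" "card Y = s" "hedges (complete3 T X Y) \<subseteq> bip_edges \<mu> i j"
        unfolding contains_bip_copy_def by auto
      have e: "{v, x, y} \<in> bip_edges \<mu> i j" if "v \<in> T" "x \<in> X" "y \<in> Y" for v x y
        using T(8) that unfolding complete3_def snd_conv by blast
      obtain v0 where v0: "v0 \<in> T" using T(5) ts card_nonempty_ex by metis
      obtain x0 where x0: "x0 \<in> X" using T(6) ts card_nonempty_ex by metis
      obtain y0 where y0: "y0 \<in> Y" using T(7) ts card_nonempty_ex by metis
      have ing: "p \<in> good_part \<mu> i" if pe: "e \<in> bip_edges \<mu> i j" "p \<in> e" and pi: "p \<in> part i" for p e
      proof -
        obtain x y z where "x \<in> good_part \<mu> i" "y \<in> good_part \<mu> i" "z \<in> part j" "e = {x, y, z}" using eb[OF pe(1)] by blast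
        then show ?thesis using pe(2) pi dis by auto
      qed
      have X: "X \<subseteq> good_part \<mu> i"
      proof
        fix x assume x: "x \<in> X"
        show "x \<in> good_part \<mu> i" by (rule ing[OF e[OF v0 x y0]]) (use x T(2) in auto)
      qed
      have Y: "Y \<subseteq> good_part \<mu> i"
      proof
        fix y assume y: "y \<in> Y"
        show "y \<in> good_part \<mu> i" by (rule ing[OF e[OF v0 x0 y]]) (use y T(3) in auto)
      qed
      have "T \<subseteq> V" using T(1) by (auto simp: part_def)
      moreover have "\<forall>v\<in>T. \<forall>x\<in>X. \<forall>y\<in>Y. h v x y" using e by (auto simp: h_def bip_edges_def)
      ultimately show False using T(4-7) by (intro cleanD[OF clean X Y]) auto
    qed
  qed
  then show ?thesis by (rule ex3_bip_ge)
qed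

text \<open>The product bc is largest for b = c. The resulting cubic in a equals n^3 / 27 minus (a -
  n/3)^2 times n/12 + (n - a)/4, and the nonnegative second part of the factor is dropped.\<close>

lemma product_bound:
  fixes a b c n :: real
  assumes "a \<ge> 0" "b \<ge> 0" "c \<ge> 0" "a + b + c = n"
  shows "a * b * c \<le> n ^ 3 / 27 - n * (a - n / 3) ^ 2 / 12"
proof -
  have "0 \<le> (b - c) ^ 2" by simp
  then have "4 * (b * c) \<le> (b + c) ^ 2" by (simp add: power2_eq_square algebra_simps)
  moreover have "b + c = n - a" using assms(4) by simp
  ultimately have "b * c \<le> (n - a) ^ 2 / 4" by simp
  then have "a * (b * c) \<le> a * ((n - a) ^ 2 / 4)" using assms by (intro mult_left_mono) auto
  also have "\<dots> = n ^ 3 / 27 - n * (a - n / 3) ^ 2 / 12 - (a - n / 3) ^ 2 / 4 * (n - a)"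
    by (simp add: field_simps power2_eq_square power3_eq_cube)
  also have "\<dots> \<le> n ^ 3 / 27 - n * (a - n / 3) ^ 2 / 12" using assms by simp
  finally show ?thesis by (simp add: mult.assoc)
qed

text \<open>A K_{t,s,s} violating cleanness extends to \<open>F5S\<close>: \<open>S0\<close> and
  \<open>S1\<close> are completed to \<open>m\<close> typical vertices of their part avoiding
  \<open>T\<close>, and their links still share a positive proportion of the pairs between the other
  two parts. The box theorem for pairs finds the two remaining parts there.\<close>

lemma clean_of_free:
  assumes ms: "2 * s \<le> m" "s > 0" "t > 0"
  obtains n0 where "\<And>(V :: 'a set) E f. hyper3_col V E f \<Longrightarrow> \<not> contains_copy (V, E) (F5S m t s) \<Longrightarrow> card V \<ge> n0 \<Longrightarrow>
     \<forall>j<3. \<forall>k<3. j \<noteq> k \<longrightarrow> real (card V) ^ 2 / 30 \<le> real (card (hyper3_col.part V f j)) * real (card (hyper3_col.part V f k)) \<Longrightarrow>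
     \<forall>i<3. m + t \<le> card (hyper3_col.good_part V E f (1 / (100 * real m)) i) \<Longrightarrow> hyper3_col.clean V E f (1 / (100 * real m)) t s"
proof -
  have m: "m > 0" using ms by simp
  have "(1 / 100 :: real) > 0" by simp
  then obtain n1 where n1: "\<And>(V :: 'a set) P. finite V \<Longrightarrow> n1 \<le> card V \<Longrightarrow>
       (1 / 100) * real (card (V \<times> V)) \<le> real (card {p\<in>V \<times> V. P p}) \<Longrightarrow>
       \<exists>A\<subseteq>V. card A = m \<and> (\<exists>B\<subseteq>V. card B = m \<and> (\<forall>b\<in>B. \<forall>a\<in>A. P (a, b)))"
    using dense_forces_box2[OF m] unfolding dense_forces_def by blast
  show thesis
  proof (rule that[of "max n1 (150 * t)"])
    fix V :: "'a set" and E f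
    let ?\<mu> = "1 / (100 * real m)"
    assume H: "hyper3_col V E f" and free: "\<not> contains_copy (V, E) (F5S m t s)" and n: "card V \<ge> max n1 (150 * t)"
    interpret hyper3_col V E f by (rule H)
    assume jk: "\<forall>j<3. \<forall>k<3. j \<noteq> k \<longrightarrow> n ^ 2 / 30 \<le> psize j * psize k" and g: "\<forall>i<3. m + t \<le> card (good_part ?\<mu> i)"
    show "clean ?\<mu> t s"
    proof (rule ccontr)
      assume "\<not> clean ?\<mu> t s"
      then obtain i S0 S1 T where S: "S0 \<subseteq> good_part ?\<mu> i" "S1 \<subseteq> good_part ?\<mu> i" "S0 \<inter> S1 = {}" "T \<subseteq> V"
        "card S0 = s" "card S1 = s" "card T = t" and hS: "\<forall>v\<in>T. \<forall>x\<in>S0. \<forall>y\<in>S1. h v x y"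
        unfolding clean_def by blast
      obtain x0 where x0: "x0 \<in> S0" using card_nonempty_ex[OF S(5)] ms by auto
      obtain y0 where y0: "y0 \<in> S1" using card_nonempty_ex[OF S(6)] ms by auto
      have i3: "i < 3" using x0 S(1) f3[of x0] by (auto simp: good_part_def)
      have TS: "T \<inter> (S0 \<union> S1) = {}" using hS h_D x0 y0 by blast
      have fgp: "finite (good_part ?\<mu> i)" using fin by (simp add: good_part_def)
      note fin' = fgp finite_subset[OF S(1) fgp] finite_subset[OF S(2) fgp] finite_subset[OF S(4) fin]
      let ?R = "good_part ?\<mu> i - T - (S0 \<union> S1)"
      have "m + t \<le> card (good_part ?\<mu> i)" using g i3 by simp
      also have "\<dots> \<le> card (?R \<union> T \<union> (S0 \<union> S1))" using fin' by (intro card_mono) auto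
      also have "\<dots> \<le> card ?R + t + (s + s)"
        using card_Un_le[of "?R \<union> T" "S0 \<union> S1"] card_Un_le[of ?R T] card_Un_le[of S0 S1] S by linarith
      finally have "m - 2 * s \<le> card ?R" by simp
      then obtain Q where Q: "Q \<subseteq> ?R" "card Q = m - 2 * s" by (meson obtain_subset_with_card_n)
      define P0 where "P0 = S0 \<union> S1 \<union> Q"
      have fQ: "finite Q" using Q(1) fin' finite_subset by blast
      have P0c: "card P0 = m"
      proof -
        have "card P0 = card (S0 \<union> S1) + card Q" unfolding P0_def using fin' fQ Q by (intro card_Un_disjoint) auto
        then show ?thesis using S fin' Q ms by (simp add: card_Un_disjoint)
      qed
      have P0: "P0 \<subseteq> good_part ?\<mu> i" "T \<inter> P0 = {}" using S(1,2) Q(1) TS by (auto simp: P0_def)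
      have fP0: "finite P0" using fin' fQ by (simp add: P0_def)
      obtain j k where jk3: "j < 3" "k < 3" "i \<noteq> j" "j \<noteq> k" "i \<noteq> k"
      proof -
        have "i = 0 \<or> i = 1 \<or> i = 2" using i3 by linarith
        then show thesis using that[of 1 2] that[of 0 2] that[of 0 1] by (elim disjE) simp_all
      qed
      let ?Z = "\<lambda>(y, z). f y = j \<and> f z = k \<and> y \<notin> T \<and> z \<notin> T \<and> (\<forall>p\<in>P0. h p y z)"
      \<comment> \<open>Out of n^2 / 30 pairs, at most n^2 / 100 are missed by the \<open>m\<close>
        typical vertices together, and at most 2 t n \<le> n^2 / 75 meet \<open>T\<close>. This
        leaves n^2 / 100, the density to which the box theorem was instantiated.\<close>
      have "n ^ 2 / 30 \<le> psize j * psize k" using jk jk3 by simp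
      also have "\<dots> = (\<Sum>y\<in>V. \<Sum>z\<in>V. of_bool (f y = j) * of_bool (f z = k))"
        unfolding psize_eq by (rule sum_product)
      also have "\<dots> \<le> (\<Sum>y\<in>V. \<Sum>z\<in>V. of_bool (?Z (y, z)) + of_bool (y \<in> T) + of_bool (z \<in> T) +
          (\<Sum>p\<in>P0. of_bool (f p \<noteq> f y \<and> f y \<noteq> f z \<and> f p \<noteq> f z \<and> \<not> h p y z)))"
      proof (intro sum_mono)
        fix y z
        let ?q = "\<lambda>p. of_bool (f p \<noteq> f y \<and> f y \<noteq> f z \<and> f p \<noteq> f z \<and> \<not> h p y z) :: real"
        have q0: "0 \<le> sum ?q P0" by (simp add: sum_nonneg)
        show "of_bool (f y = j) * of_bool (f z = k) \<le> of_bool (?Z (y, z)) + of_bool (y \<in> T) + of_bool (z \<in> T) + sum ?q P0"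
        proof (cases "f y = j \<and> f z = k \<and> (\<exists>p\<in>P0. \<not> h p y z)")
          case True
          then obtain p where p: "p \<in> P0" "\<not> h p y z" by auto
          have "f p = i" using p P0(1) by (auto simp: good_part_def)
          then have "?q p = 1" using True p jk3 by auto
          then have "1 \<le> sum ?q P0" using member_le_sum[of p P0 ?q] p fP0 by simp
          moreover have "of_bool (f y = j) * of_bool (f z = k) \<le> (1::real)" by auto
          moreover have "0 \<le> of_bool (?Z (y, z)) + of_bool (y \<in> T) + (of_bool (z \<in> T) :: real)" by simp
          ultimately show ?thesis by linarith
        next
          case False
          then show ?thesis using q0 by (cases "y \<in> T"; cases "z \<in> T") (auto simp del: sum_of_bool_eq)
        qed
      qed
      also have "\<dots> = (\<Sum>y\<in>V. \<Sum>z\<in>V. of_bool (?Z (y, z))) + real t * n + real t * n + (\<Sum>p\<in>P0. miss p)"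
      proof -
        have "(\<Sum>y\<in>V. of_bool (y \<in> T)) = real t"
        proof -
          have "{y\<in>V. y \<in> T} = T" using S(4) by auto
          then show ?thesis using card_of_bool[OF fin, of "\<lambda>y. y \<in> T"] S(7) by simp
        qed
        then have 1: "(\<Sum>y\<in>V. \<Sum>z\<in>V. of_bool (z \<in> T)) = real t * n"
           "(\<Sum>y\<in>V. \<Sum>z\<in>V. of_bool (y \<in> T)) = real t * n"
          by (simp_all add: sum_distrib_left[symmetric] del: sum_of_bool_eq sum_of_bool_mult_eq)
        have 2: "(\<Sum>y\<in>V. \<Sum>z\<in>V. \<Sum>p\<in>P0. of_bool (f p \<noteq> f y \<and> f y \<noteq> f z \<and> f p \<noteq> f z \<and> \<not> h p y z)) = (\<Sum>p\<in>P0. miss p)"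
          unfolding miss_def by (rule sum_rotate3)
        show ?thesis by (simp only: sum.distrib 1 2)
      qed
      also have "(\<Sum>p\<in>P0. miss p) \<le> (\<Sum>p\<in>P0. ?\<mu> * n ^ 2)" using P0(1) by (intro sum_mono) (auto simp: good_part_def)
      also have "(\<Sum>p\<in>P0. ?\<mu> * n ^ 2) = n ^ 2 / 100" using P0c m by simp
      finally have "n ^ 2 / 30 \<le> (\<Sum>y\<in>V. \<Sum>z\<in>V. of_bool (?Z (y, z))) + 2 * real t * n + n ^ 2 / 100" by simp
      moreover have "2 * real t * n \<le> n ^ 2 / 75"
      proof -
        have "150 * real t \<le> n" using n by simp
        then have "150 * real t * n \<le> n * n" by (intro mult_right_mono) auto
        then show ?thesis by (simp add: power2_eq_square)
      qed
      ultimately have "1 / 100 * n ^ 2 \<le> (\<Sum>y\<in>V. \<Sum>z\<in>V. of_bool (?Z (y, z)))" by simp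
      also have "\<dots> = real (card {p\<in>V \<times> V. ?Z p})"
        using fin by (simp add: card_of_bool sum.cartesian_product split_def del: sum_of_bool_eq)
      finally obtain P1 P2 where P12: "P1 \<subseteq> V" "P2 \<subseteq> V" "card P1 = m" "card P2 = m" and Z: "\<forall>a\<in>P1. \<forall>b\<in>P2. ?Z (a, b)"
        using n1[OF fin, of ?Z] n by (auto simp: card_cartesian_product power2_eq_square)
      have ne: "\<exists>x. x \<in> P1" "\<exists>x. x \<in> P2" "\<exists>x. x \<in> P0" using P12 P0c m card_nonempty_ex by blast+
      have fP: "finite P1" "finite P2" using P12 fin finite_subset by auto
      have c1: "\<And>y. y \<in> P1 \<Longrightarrow> f y = j \<and> y \<notin> T" "\<And>z. z \<in> P2 \<Longrightarrow> f z = k \<and> z \<notin> T" "\<And>x. x \<in> P0 \<Longrightarrow> f x = i"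
        using Z ne P0(1) by (auto simp: good_part_def)
      have "contains_copy (V, E) (F5S m t s)"
      proof (rule contains_copyI_F5S[OF fP0 fP fin'(4) P0c P12(3,4) S(7) _ _ S(3) S(5,6) _ P12(1,2) S(4)])
        show "S0 \<subseteq> P0" "S1 \<subseteq> P0" by (auto simp: P0_def)
        show "P0 \<subseteq> V" using P0(1) by (auto simp: good_part_def)
        show "P0 \<inter> P1 = {}" "P0 \<inter> P2 = {}" "P1 \<inter> P2 = {}" using c1 jk3 by fastforce+
        show "T \<inter> (P0 \<union> P1 \<union> P2) = {}" using P0(2) c1 by auto
        show "{a, b, c} \<in> E" if "a \<in> P0" "b \<in> P1" "c \<in> P2" for a b c using Z that by (auto simp: h_def)
        show "{v, x, y} \<in> E" if "v \<in> T" "x \<in> S0" "y \<in> S1" for v x y using hS that by (auto simp: h_def)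
      qed
      then show False using free by simp
    qed
  qed
qed

lemma (in hyper3) noncrossing_le:
  "real (card {e\<in>E. \<not> inj_on f e}) \<le> (\<Sum>u\<in>V. \<Sum>v\<in>V. \<Sum>w\<in>V. of_bool (h u v w \<and> f u = f v))"
proof -
  let ?T = "{p\<in>V \<times> V \<times> V. (case p of (x, y, z) \<Rightarrow> h x y z \<and> f x = f y)}"
  have "{e\<in>E. \<not> inj_on f e} \<subseteq> (\<lambda>(x, y, z). {x, y, z}) ` ?T"
  proof
    fix e assume "e \<in> {e\<in>E. \<not> inj_on f e}"
    then have e: "e \<in> E" "\<not> inj_on f e" by auto
    then obtain x y where xy: "x \<in> e" "y \<in> e" "x \<noteq> y" "f x = f y" by (auto simp: inj_on_def)
    have fe: "finite e" "card e = 3" "e \<subseteq> V" using edges[OF e(1)] finite_subset[OF _ fin] by auto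
    have "card (e - {x, y}) = 1" using xy fe by (subst card_Diff_subset) auto
    then obtain z where z: "e - {x, y} = {z}" by (auto simp: card_1_singleton_iff)
    then have ez: "e = {x, y, z}" using xy by auto
    then show "e \<in> (\<lambda>(x, y, z). {x, y, z}) ` ?T"
      using xy e(1) fe by (intro image_eqI[of _ _ "(x, y, z)"]) (auto simp: h_def)
  qed
  then have "card {e\<in>E. \<not> inj_on f e} \<le> card ?T" using fin by (intro surj_card_le) auto
  then have "real (card {e\<in>E. \<not> inj_on f e}) \<le> real (card ?T)" by simp
  also have "\<dots> = (\<Sum>u\<in>V. \<Sum>v\<in>V. \<Sum>w\<in>V. of_bool (h u v w \<and> f u = f v))"
    using fin by (simp add: card_of_bool sum.cartesian_product split_def del: sum_of_bool_eq)
  finally show ?thesis .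
qed

lemma third_colour_exists:
  fixes i j :: nat
  assumes "i < 3" "j < 3"
  obtains k where "k < 3" "i \<noteq> k" "j \<noteq> k"
proof -
  have "\<exists>k\<in>{0, 1, 2::nat}. i \<noteq> k \<and> j \<noteq> k"
  proof -
    have "i = 0 \<or> i = 1 \<or> i = 2" "j = 0 \<or> j = 1 \<or> j = 2" using assms by linarith+
    then show ?thesis by (elim disjE) auto
  qed
  then obtain k where "k \<in> {0, 1, 2}" "i \<noteq> k" "j \<noteq> k" by blast
  then show thesis by (intro that[of k]) auto
qed

text \<open>Many pairs inside the own part make b a heavy apex; many pairs between the own part and
  another make it a heavy base. The value of \<epsilon> keeps both counts above \<nu>^2 / 60, and
  the bound on n absorbs the degenerate n^3.\<close>

lemma (in hyper3_cut) heavy_classification: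
  assumes jk: "\<forall>j<3. \<forall>k<3. j \<noteq> k \<longrightarrow> n ^ 2 / 30 \<le> psize j * psize k"
    and miss: "miss3 0 1 2 \<le> 2 * \<epsilon> * n ^ 3" and nu: "\<nu> > 0" "\<nu> \<le> 1" and eps: "\<epsilon> = \<nu> ^ 2 / 400" and n: "n \<ge> 2 / \<nu> ^ 2"
  shows "{b\<in>V. \<exists>j<3. cnt b (f b) j > \<nu> * n ^ 2} \<subseteq> heavy_apex (\<nu> ^ 2 / 60) \<union> heavy_base (\<nu> ^ 2 / 60)"
proof
  fix b assume "b \<in> {b\<in>V. \<exists>j<3. cnt b (f b) j > \<nu> * n ^ 2}"
  then obtain j where b: "b \<in> V" and j: "j < 3" and c: "cnt b (f b) j > \<nu> * n ^ 2" by auto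
  have n0: "n > 0" using n nu(1) by (smt (verit) divide_pos_pos zero_less_power)
  show "b \<in> heavy_apex (\<nu> ^ 2 / 60) \<union> heavy_base (\<nu> ^ 2 / 60)"
  proof (cases "j = f b")
    case True
    obtain k where k: "k < 3" "f b \<noteq> k" using third_colour_exists[OF f3 f3, of b b] by metis
    obtain l where l: "l < 3" "f b \<noteq> l" "k \<noteq> l" using third_colour_exists[OF f3 k(1), of b] by metis
    have "\<nu> ^ 2 \<le> \<nu>" using nu by (simp add: power2_eq_square mult_left_le)
    then have "\<nu> ^ 2 / 60 \<le> \<nu> / 30 - 4 * \<epsilon>" unfolding eps using nu(1) by (simp add: field_simps)
    then have "\<nu> ^ 2 / 60 * n ^ 4 \<le> (\<nu> / 30 - 4 * \<epsilon>) * n ^ 4" by (intro mult_right_mono) auto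
    also have "\<dots> \<le> (\<Sum>a\<in>V. \<Sum>b'\<in>V. \<Sum>c\<in>V. \<Sum>d\<in>V. of_bool (F5_at a b' c d b))"
      by (rule crossing_bad_pairs[where i = "f b" and j = k and k = l]) (use c True jk k l miss nu in auto)
    finally show ?thesis using b by (simp add: heavy_apex_def)
  next
    case False
    obtain k where k: "k < 3" "f b \<noteq> k" "j \<noteq> k" using third_colour_exists[OF f3 j, of b] by metis
    have "2 \<le> \<nu> ^ 2 * n" using n nu(1) by (simp add: field_simps)
    then have "2 * n ^ 3 \<le> (\<nu> ^ 2 * n) * n ^ 3" by (intro mult_right_mono) auto
    then have "n ^ 3 \<le> \<nu> ^ 2 / 2 * n ^ 4" by (simp add: eval_nat_numeral)
    moreover have "\<nu> ^ 2 / 60 * n ^ 4 \<le> (\<nu> ^ 2 - 2 * \<epsilon> - \<nu> ^ 2 / 2) * n ^ 4"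
      unfolding eps by (intro mult_right_mono) (auto simp: field_simps)
    ultimately have "\<nu> ^ 2 / 60 * n ^ 4 \<le> (\<nu> ^ 2 - 2 * \<epsilon>) * n ^ 4 - n ^ 3" by (simp add: algebra_simps)
    also have "\<dots> \<le> (\<Sum>a\<in>V. \<Sum>b'\<in>V. \<Sum>d\<in>V. \<Sum>w\<in>V. of_bool (F5_at a b' b d w))"
      by (rule cut_bad_pairs[where i = "f b" and j = j and k = k]) (use c b False j k miss nu in auto)
    finally show ?thesis using b by (simp add: heavy_base_def)
  qed
qed

section \<open>Combining the edge classes\<close>

definition partition_bound :: "nat \<Rightarrow> nat \<Rightarrow> (nat \<Rightarrow> nat) \<Rightarrow> real" where
  "partition_bound t s a = real (a 0) * real (a 1) * real (a 2) + (\<Sum>i\<in>{..<3}. real (ex3 (a i) (K3 t s s)))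
     + (\<Sum>p\<in>{(i, j). i < 3 \<and> j < 3 \<and> i \<noteq> j}. real (ex3_bip (a (snd p)) (a (fst p)) t s))"

text \<open>The crossing edges fall short of the product of the part sizes by
  \<open>miss3 0 1 2\<close>, and the bad edges outside \<open>W\<close> number at most the same
  quantity. The two cancel, so only the O(n^2) edges at the boundedly many vertices of
  \<open>W\<close> remain.\<close>

lemma exact_structure:
  assumes ms: "2 * s \<le> m" "s > 0" "t > 0"
  obtains C n0 where "C \<ge> 0" "\<And>(V :: nat set) E. hyper3 V E \<Longrightarrow> \<not> contains_copy (V, E) (F5S m t s) \<Longrightarrow> card V \<ge> n0 \<Longrightarrow>
     real (card V) ^ 3 / 27 - real (card V) ^ 2 \<le> real (card E) \<Longrightarrow>
     \<exists>a :: nat \<Rightarrow> nat. a 0 + a 1 + a 2 = card V \<and>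
       real (card E) \<le> partition_bound t s a + C * real (card V) ^ 2"
proof -
  have m: "m > 0" using ms by simp
  \<comment> \<open>\<mu> lets m typical vertices miss at most n^2 / 100 pairs together. The choice
    \<nu> = \<mu> / 18 makes the non-crossing degree 3 \<nu> n^2 of an atypical vertex a sixth of
    its missing degree \<mu> n^2, which matches the factor 6 in \<open>miss_total\<close>.\<close>
  define \<nu> where "\<nu> = 1 / (1800 * real m)"
  define \<mu> where "\<mu> = 1 / (100 * real m)"
  \<comment> \<open>\<epsilon> is the value required by \<open>heavy_classification\<close>. With
    \<delta> = \<eta>^2 the parameter of the stability lemma is at most 8 \<eta> + 6 \<eta> + 3
    \<eta> = 17 \<eta>, and 50 * 17 \<eta> stays below \<epsilon> = 1000 \<eta>.\<close>
  define \<epsilon> where "\<epsilon> = \<nu> ^ 2 / 400"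
  define \<eta> where "\<eta> = \<epsilon> / 1000"
  define \<delta> where "\<delta> = \<eta> ^ 2"
  have nu: "\<nu> > 0" "\<nu> \<le> 1" using m by (auto simp: \<nu>_def)
  have mu: "\<mu> = 18 * \<nu>" "\<mu> > 0" using m by (auto simp: \<mu>_def \<nu>_def)
  have "\<nu> \<le> 1 / 10" using m by (auto simp: \<nu>_def field_simps)
  then have nu2: "\<nu> ^ 2 \<le> 1 / 10" using nu mult_mono[of \<nu> "1 / 10" \<nu> 1] by (simp add: power2_eq_square)
  have eps: "\<epsilon> > 0" "\<epsilon> \<le> 1 / 4000" using nu nu2 by (auto simp: \<epsilon>_def)
  have eta: "\<eta> > 0" "\<eta> \<le> 1 / 400000" using eps by (auto simp: \<eta>_def)
  have delta: "\<delta> > 0" using eta by (simp add: \<delta>_def)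
  have kappa: "\<nu> ^ 2 / 60 > 0" using nu by simp
  obtain n1 where n1: "\<And>(V :: nat set) E. hyper3 V E \<Longrightarrow> \<not> contains_copy (V, E) (F5S m t s) \<Longrightarrow> card V \<ge> n1 \<Longrightarrow>
      hyper3.F5_count V E \<le> \<delta> * real (card V) ^ 5" by (rule few_F5[OF delta ms]) (rule that)
  obtain n2 where n2: "n2 > 0"
    "\<And>(V :: nat set) E. hyper3 V E \<Longrightarrow> \<not> contains_copy (V, E) (F5S m t s) \<Longrightarrow> n2 \<le> card V \<Longrightarrow>
      card (hyper3.heavy_apex V E (\<nu> ^ 2 / 60)) < n2 \<and> card (hyper3.heavy_base V E (\<nu> ^ 2 / 60)) < n2"
    by (rule few_heavy_vertices[OF kappa ms]) (rule that)
  obtain n3 where n3: "\<And>(V :: nat set) E f. hyper3_col V E f \<Longrightarrow> \<not> contains_copy (V, E) (F5S m t s) \<Longrightarrow> card V \<ge> n3 \<Longrightarrow>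
     \<forall>j<3. \<forall>k<3. j \<noteq> k \<longrightarrow> real (card V) ^ 2 / 30 \<le> real (card (hyper3_col.part V f j)) * real (card (hyper3_col.part V f k)) \<Longrightarrow>
     \<forall>i<3. m + t \<le> card (hyper3_col.good_part V E f (1 / (100 * real m)) i) \<Longrightarrow> hyper3_col.clean V E f (1 / (100 * real m)) t s"
    by (rule clean_of_free[OF ms]) (rule that)
  define n0 where "n0 = n1 + n2 + n3 + nat \<lceil>6 / \<eta>\<rceil> + nat \<lceil>1 / \<epsilon>\<rceil> + 60 * (m + t) + nat \<lceil>2 / \<nu> ^ 2\<rceil> + 1"
  show thesis
  proof (rule that[of "2 * real n2" n0])
    fix V :: "nat set" and E
    assume H: "hyper3 V E" and free: "\<not> contains_copy (V, E) (F5S m t s)" and n: "card V \<ge> n0"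
      and big: "real (card V) ^ 3 / 27 - real (card V) ^ 2 \<le> real (card E)"
    interpret hyper3 V E by (rule H)
    have nb: "card V \<ge> n1" "card V \<ge> n2" "card V \<ge> n3" "6 / \<eta> \<le> n" "1 / \<epsilon> \<le> n" "60 * real (m + t) \<le> n" "2 / \<nu> ^ 2 \<le> n" "card V > 0"
      using n unfolding n0_def by linarith+
    have n0: "n > 0" using nb(8) by simp
    interpret T: hyper3_thr V E \<eta> using eta nb by unfold_locales auto
    have sq: "n ^ 2 \<le> \<epsilon> * n ^ 3"
    proof -
      have "1 \<le> \<epsilon> * n" using nb(5) eps by (simp add: field_simps)
      then have "1 * n ^ 2 \<le> (\<epsilon> * n) * n ^ 2" by (intro mult_right_mono) auto
      then show ?thesis by (simp add: eval_nat_numeral)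
    qed
    have "\<exists>f :: nat \<Rightarrow> nat. (\<forall>v. f v < 3) \<and> (\<Sum>u\<in>V. \<Sum>v\<in>V. \<Sum>w\<in>V. of_bool (h u v w \<and> f u = f v)) \<le> 50 * (17 * \<eta>) * n ^ 3"
    proof -
      define \<zeta> where "\<zeta> = 2 * (\<eta> + 3 * \<eta>) + 6 * \<delta> / \<eta> + 3 * \<delta>"
      have N: "(2 / 9 - \<eta>) * n ^ 3 \<le> N_edges"
      proof -
        have "6 \<le> \<eta> * n" using nb(4) eta by (simp add: field_simps)
        then have "6 * n ^ 2 \<le> (\<eta> * n) * n ^ 2" by (intro mult_right_mono) auto
        then have "(2 / 9 - \<eta>) * n ^ 3 \<le> 6 * (n ^ 3 / 27 - n ^ 2)" by (simp add: algebra_simps eval_nat_numeral)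
        also have "\<dots> \<le> 6 * real (card E)" using big by simp
        also have "\<dots> \<le> N_edges" by (rule N_edges_ge)
        finally show ?thesis .
      qed
      have "\<eta> + 3 * \<eta> \<le> 1 / 9" using eta by simp
      from T.stability[OF n1[OF H free nb(1)] N this \<zeta>_def]
      obtain f :: "nat \<Rightarrow> nat" where f: "\<forall>v. f v < 3" "(\<Sum>u\<in>V. \<Sum>v\<in>V. \<Sum>w\<in>V. of_bool (h u v w \<and> f u = f v)) \<le> 50 * \<zeta> * n ^ 3" by blast
      have "\<zeta> \<le> 17 * \<eta>"
      proof -
        have "6 * \<delta> / \<eta> = 6 * \<eta>" using eta by (simp add: \<delta>_def power2_eq_square)
        moreover have "\<delta> \<le> \<eta>" unfolding \<delta>_def using eta by (simp add: power2_eq_square mult_left_le)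
        ultimately show ?thesis by (simp add: \<zeta>_def)
      qed
      then have "50 * \<zeta> * n ^ 3 \<le> 50 * (17 * \<eta>) * n ^ 3" by (intro mult_right_mono) auto
      then show ?thesis using f by (intro exI[of _ f]) auto
    qed
    then obtain f0 :: "nat \<Rightarrow> nat" where f0: "\<And>v. f0 v < 3"
      "(\<Sum>u\<in>V. \<Sum>v\<in>V. \<Sum>w\<in>V. of_bool (h u v w \<and> f0 u = f0 v)) \<le> 50 * (17 * \<eta>) * n ^ 3" by blast
    have "50 * (17 * \<eta>) * n ^ 3 \<le> \<epsilon> * n ^ 3" unfolding \<eta>_def using eps by (intro mult_right_mono) auto
    then have non0: "real (card {e\<in>E. \<not> inj_on f0 e}) \<le> \<epsilon> * n ^ 3" using f0(2) noncrossing_le[of f0] by linarith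
    obtain f :: "nat \<Rightarrow> nat" where f: "\<And>v. f v < 3" "\<And>f' :: nat \<Rightarrow> nat. (\<And>v. f' v < 3) \<Longrightarrow> card {e\<in>E. inj_on f' e} \<le> card {e\<in>E. inj_on f e}"
      using exists_max_cut[of f0] f0(1) by blast
    interpret c: hyper3_cut V E f using f by unfold_locales auto
    have "card E = card {e\<in>E. inj_on f0 e} + card {e\<in>E. \<not> inj_on f0 e}"
      using finite_E by (subst card_Un_disjoint[symmetric]) (auto intro: arg_cong[where f = card])
    then have cross: "real (card E) - \<epsilon> * n ^ 3 \<le> real (card {e\<in>E. inj_on f e})"
      using non0 f(2)[of f0] f0(1) by simp
    let ?M = "c.miss3 0 1 2" and ?pr = "c.psize 0 * c.psize 1 * c.psize 2"
    have pr: "?pr \<le> n ^ 3 / 27"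
    proof -
      have "?pr \<le> n ^ 3 / 27 - n * (c.psize 0 - n / 3) ^ 2 / 12"
        by (rule product_bound) (use c.psize_sum in auto)
      then show ?thesis by (smt (verit) n0 divide_nonneg_pos mult_nonneg_nonneg zero_le_power2)
    qed
    \<comment> \<open>One \<epsilon> n^3 is the number of non-crossing edges, the other dominates
      the n^2 in the hypothesis. Comparison with the maximum n^3 / 27 of the product then bounds the
      missing triples as well as the imbalance of the parts.\<close>
    have lo: "n ^ 3 / 27 - 2 * \<epsilon> * n ^ 3 \<le> ?pr - ?M" using cross big sq c.crossing_le by simp
    have M0: "?M \<ge> 0" by (simp add: c.miss3_def sum_nonneg)
    have M: "?M \<le> 2 * \<epsilon> * n ^ 3" using lo pr by simp
    have pr30: "n ^ 3 / 30 \<le> ?pr"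
    proof -
      have "2 * \<epsilon> * n ^ 3 \<le> 2 * (1 / 4000) * n ^ 3" using eps by (intro mult_right_mono mult_left_mono) auto
      moreover have "0 \<le> n ^ 3" by simp
      ultimately show ?thesis using lo M0 by linarith
    qed
    have ple: "c.psize i \<le> n" for i using fin by (auto simp: c.part_def intro!: card_mono)
    have perm: "?pr = c.psize i * c.psize j * c.psize k" if "i < 3" "j < 3" "k < 3" "i \<noteq> j" "j \<noteq> k" "i \<noteq> k" for i j k
      using colours3_cases[OF that] by auto
    have jk: "n ^ 2 / 30 \<le> c.psize j * c.psize k" if jk3: "j < 3" "k < 3" "j \<noteq> k" for j k
    proof -
      obtain i where i: "i < 3" "j \<noteq> i" "k \<noteq> i" using third_colour_exists[OF jk3(1,2)] by metis
      have "n ^ 3 / 30 \<le> c.psize j * c.psize k * c.psize i" using pr30 perm[OF jk3(1,2) i(1) jk3(3) i(3,2)] by simp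
      also have "\<dots> \<le> c.psize j * c.psize k * n" using ple[of i] by (intro mult_left_mono) auto
      finally have "n * (n ^ 2 / 30) \<le> n * (c.psize j * c.psize k)" by (simp add: eval_nat_numeral mult_ac)
      then show ?thesis using n0 by (simp only: mult_le_cancel_left_pos)
    qed
    have p30: "n / 30 \<le> c.psize i" if i3: "i < 3" for i
    proof -
      obtain j where j: "j < 3" "i \<noteq> j" using third_colour_exists[OF i3 i3] by metis
      have "n ^ 2 / 30 \<le> c.psize i * c.psize j" using jk i3 j by simp
      also have "\<dots> \<le> c.psize i * n" using ple by (intro mult_left_mono) auto
      finally have "n * (n / 30) \<le> n * c.psize i" by (simp add: power2_eq_square mult_ac)
      then show ?thesis using n0 by (simp only: mult_le_cancel_left_pos)
    qed
    \<comment> \<open>Parts have at least n/30 vertices, so n/60 atypical ones leave n/60 \<ge> m +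
      t typical ones in each part.\<close>
    have ng: "real (card (c.not_good \<mu>)) \<le> n / 60"
    proof -
      have "real (card (c.not_good \<mu>)) * (\<mu> * n ^ 2) \<le> 6 * (2 * \<epsilon> * n ^ 3)" using c.card_not_good[of \<mu>] M by linarith
      also have "\<dots> \<le> (n / 60) * (\<mu> * n ^ 2)"
      proof -
        have "\<nu> * \<nu> \<le> \<nu> * 1" using nu by (intro mult_left_mono) auto
        then have "12 * \<epsilon> \<le> \<mu> / 60" unfolding \<epsilon>_def mu(1) using nu by (simp add: power2_eq_square)
        then have "12 * \<epsilon> * n ^ 3 \<le> \<mu> / 60 * n ^ 3" by (intro mult_right_mono) auto
        then show ?thesis by (simp add: eval_nat_numeral mult_ac)
      qed
      finally show ?thesis using mu n0 by (simp add: mult_le_cancel_right)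
    qed
    have good_part: "m + t \<le> card (c.good_part \<mu> i)" if "i < 3" for i
    proof -
      have "c.part i \<subseteq> c.good_part \<mu> i \<union> c.not_good \<mu>" by (auto simp: c.part_def c.good_part_def c.not_good_def)
      then have "card (c.part i) \<le> card (c.good_part \<mu> i) + card (c.not_good \<mu>)"
        using fin by (intro order_trans[OF card_mono card_Un_le]) (auto simp: c.good_part_def c.not_good_def)
      then have "n / 30 \<le> real (card (c.good_part \<mu> i)) + n / 60" using p30[OF that] ng by linarith
      then have "real (m + t) \<le> real (card (c.good_part \<mu> i))" using nb(6) by (simp add: field_simps)
      then show ?thesis by (simp only: of_nat_le_iff)
    qed
    have cl: "c.clean \<mu> t s"
      unfolding \<mu>_def by (rule n3[OF c.hyper3_col_axioms free nb(3)]) (use jk good_part in \<open>auto simp: \<mu>_def\<close>)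
    define W where "W = {b\<in>V. \<exists>j<3. c.cnt b (f b) j > \<nu> * n ^ 2}"
    have W: "real (card W) \<le> 2 * real n2"
    proof -
      have "W \<subseteq> heavy_apex (\<nu> ^ 2 / 60) \<union> heavy_base (\<nu> ^ 2 / 60)" unfolding W_def
        by (rule c.heavy_classification[OF _ M nu \<epsilon>_def nb(7)]) (use jk in auto)
      then have "card W \<le> card (heavy_apex (\<nu> ^ 2 / 60)) + card (heavy_base (\<nu> ^ 2 / 60))"
        using fin by (intro order_trans[OF card_mono card_Un_le]) (auto simp: heavy_apex_def heavy_base_def)
      moreover note n2(2)[OF H free nb(2)]
      ultimately show ?thesis by simp
    qed
    let ?I = "{(i, j). i < (3::nat) \<and> j < (3::nat) \<and> i \<noteq> j}"
    have fI: "finite ?I" by (rule finite_subset[of _ "{..<3} \<times> {..<3}"]) auto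
    let ?E1 = "{e\<in>E. inj_on f e}" and ?E2 = "\<Union>i\<in>{..<3}. {e\<in>E. e \<subseteq> c.good_part \<mu> i}"
      and ?E3 = "\<Union>p\<in>?I. c.bip_edges \<mu> (fst p) (snd p)" and ?E4 = "c.bad_edges \<mu>"
    have fin4: "finite ?E1" "finite ?E2" "finite ?E3" "finite ?E4"
      using finite_E by (auto intro: finite_subset[of _ E] simp: c.bip_edges_def c.bad_edges_def)
    have "card E \<le> card (?E1 \<union> ?E2 \<union> ?E3 \<union> ?E4)" using fin4 c.edge_classification[of \<mu>] by (intro card_mono) auto
    also have "\<dots> \<le> card ?E1 + card ?E2 + card ?E3 + card ?E4"
      using card_Un_le[of "?E1 \<union> ?E2 \<union> ?E3" ?E4] card_Un_le[of "?E1 \<union> ?E2" ?E3] card_Un_le[of ?E1 ?E2] by linarith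
    finally have "real (card E) \<le> real (card ?E1) + real (card ?E2) + real (card ?E3) + real (card ?E4)"
      by (simp flip: of_nat_add)
    moreover have "real (card ?E1) \<le> ?pr - ?M" by (rule c.crossing_le)
    moreover have "real (card ?E2) \<le> (\<Sum>i\<in>{..<3}. real (ex3 (card (c.part i)) (K3 t s s)))"
    proof -
      have "card ?E2 \<le> (\<Sum>i\<in>{..<3}. card {e\<in>E. e \<subseteq> c.good_part \<mu> i})" by (rule card_UN_le) simp
      also have "\<dots> \<le> (\<Sum>i\<in>{..<3}. ex3 (card (c.part i)) (K3 t s s))"
        by (intro sum_mono c.bound_mono_edges cl ms)
      finally show ?thesis by (simp flip: of_nat_sum)
    qed
    moreover have "real (card ?E3) \<le> (\<Sum>p\<in>?I. real (ex3_bip (card (c.part (snd p))) (card (c.part (fst p))) t s))"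
    proof -
      have "card ?E3 \<le> (\<Sum>p\<in>?I. card (c.bip_edges \<mu> (fst p) (snd p)))" by (rule card_UN_le[OF fI])
      also have "\<dots> \<le> (\<Sum>p\<in>?I. ex3_bip (card (c.part (snd p))) (card (c.part (fst p))) t s)"
        by (intro sum_mono bound_bip_edges[OF c.hyper3_col_axioms cl ms(3,2)]) auto
      finally show ?thesis by (simp flip: of_nat_sum)
    qed
    moreover have "real (card ?E4) \<le> 2 * real n2 * n ^ 2 + ?M"
    proof -
      have "real (card ?E4) \<le> real (card W) * n ^ 2 + real (card (c.not_good \<mu>)) * (3 * \<nu> * n ^ 2)"
        using nu by (intro c.bad_edges_bound W_def) auto
      \<comment> \<open>Here the ratio 18 between \<mu> and \<nu> pays off: the sum is at most
        \<open>?M\<close>, precisely what the crossing edges lack.\<close>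
      also have "real (card (c.not_good \<mu>)) * (3 * \<nu> * n ^ 2) = real (card (c.not_good \<mu>)) * (\<mu> * n ^ 2) / 6"
        by (simp add: mu(1))
      also have "\<dots> \<le> ?M" using c.card_not_good[of \<mu>] by simp
      also have "real (card W) * n ^ 2 \<le> 2 * real n2 * n ^ 2" using W by (intro mult_right_mono) auto
      finally show ?thesis by simp
    qed
    ultimately have "real (card E) \<le> partition_bound t s (\<lambda>i. card (c.part i)) + 2 * real n2 * n ^ 2"
      unfolding partition_bound_def by linarith
    moreover have "card (c.part 0) + card (c.part 1) + card (c.part 2) = card V"
      using c.psize_sum by (simp flip: of_nat_add)
    ultimately show "\<exists>a :: nat \<Rightarrow> nat. a 0 + a 1 + a 2 = card V \<and>
       real (card E) \<le> partition_bound t s a + 2 * real n2 * n ^ 2"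
      by (intro exI[of _ "\<lambda>i. card (c.part i)"]) simp
  qed simp
qed

subsection \<open>The upper bound\<close>

lemma card_turan3_ge: "(n div 3) ^ 3 \<le> card (hedges (turan3 n))"
proof -
  let ?P = "turan_part n 0 \<times> turan_part n 1 \<times> turan_part n 2"
  have fin: "finite (turan_part n i)" for i by (simp add: turan_part_def)
  have "inj_on (\<lambda>(a, b, c). {a, b, c}) ?P"
  proof (rule inj_onI)
    fix p q assume pq: "p \<in> ?P" "q \<in> ?P" and eq: "(case p of (a, b, c) \<Rightarrow> {a, b, c}) = (case q of (a, b, c) \<Rightarrow> {a, b, c})"
    obtain a b c where p: "p = (a, b, c)" by (cases p)
    obtain x y z where q: "q = (x, y, z)" by (cases q)
    have m: "a mod 3 = 0" "b mod 3 = 1" "c mod 3 = 2" "x mod 3 = 0" "y mod 3 = 1" "z mod 3 = 2"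
      using pq p q by (auto simp: turan_part_def)
    have "{a, b, c} = {x, y, z}" using eq p q by simp
    then have "a \<in> {x, y, z}" "b \<in> {x, y, z}" "c \<in> {x, y, z}" by blast+
    then show "p = q" using m p q by auto
  qed
  moreover have "(\<lambda>(a, b, c). {a, b, c}) ` ?P \<subseteq> hedges (turan3 n)"
    by (auto simp: turan3_def complete3_def)
  moreover have "finite (hedges (turan3 n))"
  proof (rule finite_subset)
    show "hedges (turan3 n) \<subseteq> Pow {..<n}" using turan3_edges_subset by blast
  qed simp
  ultimately have "card ?P \<le> card (hedges (turan3 n))" by (rule card_inj_on_le)
  moreover have "card ?P = card (turan_part n 0) * (card (turan_part n 1) * card (turan_part n 2))"
    by (simp add: card_cartesian_product)
  moreover have "(n div 3) * ((n div 3) * (n div 3)) \<le> card (turan_part n 0) * (card (turan_part n 1) * card (turan_part n 2))"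
    by (intro mult_le_mono card_turan_part) auto
  ultimately show ?thesis by (simp add: power3_eq_cube)
qed

lemma real_div3_bound: "real n \<le> 3 * real (n div 3) + 2"
proof -
  have "n \<le> 3 * (n div 3) + 2" using div_mult_mod_eq[of n 3] mod_less_divisor[of 3 n] by linarith
  then have "real n \<le> real (3 * (n div 3) + 2)" by (simp only: of_nat_le_iff)
  then show ?thesis by (simp only: of_nat_add of_nat_mult of_nat_numeral)
qed

text \<open>Rounding costs only O(n^2), below the allowed error, so n^3 / 27 and the size of
  T_3(n,3) may be interchanged in the upper bound.\<close>

lemma card_turan3_ge_real: "real n ^ 3 / 27 - real n ^ 2 \<le> real (card (hedges (turan3 n)))"
proof (cases "n \<ge> 2")
  case True
  have "(real n - 2) / 3 \<le> real (n div 3)" using real_div3_bound[of n] by argo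
  then have "((real n - 2) / 3) ^ 3 \<le> real (n div 3) ^ 3" using True by (intro power_mono) auto
  also have "\<dots> = real ((n div 3) ^ 3)" by simp
  also have "\<dots> \<le> real (card (hedges (turan3 n)))" using card_turan3_ge[of n] by (simp del: of_nat_power)
  finally have "((real n - 2) / 3) ^ 3 \<le> real (card (hedges (turan3 n)))" .
  moreover have "((real n - 2) / 3) ^ 3 = real n ^ 3 / 27 - 6 / 27 * real n ^ 2 + 12 / 27 * real n - 8 / 27"
    by (simp add: power3_eq_cube power2_eq_square field_simps)
  moreover have "0 \<le> real n ^ 2" by simp
  ultimately show ?thesis using True by linarith
next
  case False
  then have "n = 0 \<or> n = 1" by auto
  then have "real n ^ 3 / 27 - real n ^ 2 \<le> 0" by auto
  then show ?thesis by linarith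
qed

lemma off_diagonal_pairs3: "{(i, j). i < (3::nat) \<and> j < (3::nat) \<and> i \<noteq> j} = {(0,1), (0,2), (1,0), (1,2), (2,0), (2,1)}"
  (is "?L = ?R")
proof
  show "?R \<subseteq> ?L" by simp
  show "?L \<subseteq> ?R"
  proof
    fix p assume "p \<in> ?L"
    then obtain i j where p: "p = (i, j)" "i < 3" "j < 3" "i \<noteq> j" by auto
    have "i = 0 \<or> i = 1 \<or> i = 2" "j = 0 \<or> j = 1 \<or> j = 2" using p by linarith+
    then show "p \<in> ?R" using p(1,4) by (elim disjE) simp_all
  qed
qed

text \<open>Let x be the excess of the largest class over n/3. Each of the three terms F gains at
  most (x + 1) K and each of the six terms G at most 2 (x + 1) K, while the product loses n x^2 /
  12. The 1 in x + 1 is the rounding in \<open>N\<close>.\<close>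

lemma unbalanced_loss:
  fixes a :: "nat \<Rightarrow> nat"
  assumes sum: "a 0 + a 1 + a 2 = n" and n: "n > 0" and N: "N = n div 3"
    and f: "\<And>i. i < 3 \<Longrightarrow> F i \<le> f0 + real (a i - N) * K"
    and g: "\<And>i j. i < 3 \<Longrightarrow> j < 3 \<Longrightarrow> G j i \<le> g0 + (real (a j - N) + real (a i - N)) * K" and K: "K \<ge> 0"
  shows "real (a 0) * real (a 1) * real (a 2) + (\<Sum>i\<in>{..<3}. F i) + (\<Sum>p\<in>{(i, j). i < 3 \<and> j < 3 \<and> i \<noteq> j}. G (snd p) (fst p))
    \<le> real n ^ 3 / 27 + 6 * g0 + 3 * f0 + 675 * K ^ 2 / real n + 15 * K"
proof -
  define x where "x = Max {real (a 0), real (a 1), real (a 2)} - real n / 3"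
  have mx: "real (a i) - real n / 3 \<le> x" if "i < 3" for i
  proof -
    have "i = 0 \<or> i = 1 \<or> i = 2" using that by linarith
    then show ?thesis by (auto simp: x_def)
  qed
  have s: "real (a 0) + real (a 1) + real (a 2) = real n" using sum by (simp flip: of_nat_add)
  have x0: "x \<ge> 0" using mx[of 0] mx[of 1] mx[of 2] s by simp
  have "Max {real (a 0), real (a 1), real (a 2)} \<in> {real (a 0), real (a 1), real (a 2)}" by (rule Max_in) auto
  then have "real (a 0) - real n / 3 = x \<or> real (a 1) - real n / 3 = x \<or> real (a 2) - real n / 3 = x" by (auto simp: x_def)
  then have pr: "real (a 0) * real (a 1) * real (a 2) \<le> real n ^ 3 / 27 - real n * x ^ 2 / 12"
  proof (elim disjE)
    assume "real (a 0) - real n / 3 = x"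
    then show ?thesis using product_bound[of "real (a 0)" "real (a 1)" "real (a 2)" "real n"] s by simp
  next
    assume "real (a 1) - real n / 3 = x"
    then show ?thesis using product_bound[of "real (a 1)" "real (a 0)" "real (a 2)" "real n"] s by (simp add: mult_ac)
  next
    assume "real (a 2) - real n / 3 = x"
    then show ?thesis using product_bound[of "real (a 2)" "real (a 0)" "real (a 1)" "real n"] s by (simp add: mult_ac)
  qed
  have d: "real (a i - N) \<le> x + 1" if "i < 3" for i
  proof (cases "N \<le> a i")
    case True
    have "real n / 3 - 1 \<le> real N" unfolding N using real_div3_bound[of n] by argo
    then show ?thesis using mx[OF that] True by (simp add: of_nat_diff)
  qed (use x0 in simp)
  have f': "F i \<le> f0 + (x + 1) * K" if "i < 3" for i
    using f[OF that] mult_right_mono[OF d[OF that] K] by linarith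
  have g': "G j i \<le> g0 + 2 * ((x + 1) * K)" if "i < 3" "j < 3" for i j
    using g[OF that] mult_right_mono[OF d[OF that(1)] K] mult_right_mono[OF d[OF that(2)] K] by (simp add: distrib_right)
  have "(\<Sum>i\<in>{..<3}. F i) \<le> (\<Sum>i\<in>{..<3::nat}. f0 + (x + 1) * K)" by (intro sum_mono f') auto
  then have 1: "(\<Sum>i\<in>{..<3}. F i) \<le> 3 * f0 + 3 * ((x + 1) * K)" by simp
  have "(\<Sum>p\<in>{(i, j). i < 3 \<and> j < 3 \<and> i \<noteq> j}. G (snd p) (fst p)) \<le> (\<Sum>p\<in>{(i::nat, j::nat). i < 3 \<and> j < 3 \<and> i \<noteq> j}. g0 + 2 * ((x + 1) * K))"
    by (intro sum_mono g') auto
  then have 2: "(\<Sum>p\<in>{(i, j). i < 3 \<and> j < 3 \<and> i \<noteq> j}. G (snd p) (fst p)) \<le> 6 * g0 + 12 * ((x + 1) * K)"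
    by (simp add: off_diagonal_pairs3)
  \<comment> \<open>Completing the square; the maximum is attained at x = 90 K / n.\<close>
  have 3: "15 * x * K - real n * x ^ 2 / 12 \<le> 675 * K ^ 2 / real n"
  proof -
    have "0 \<le> (real n * x - 90 * K) ^ 2 / (12 * real n)" using n by simp
    also have "\<dots> = real n * x ^ 2 / 12 - 15 * x * K + 675 * K ^ 2 / real n"
      using n by (simp add: power2_eq_square field_simps)
    finally show ?thesis by simp
  qed
  have "real (a 0) * real (a 1) * real (a 2) + (\<Sum>i\<in>{..<3}. F i) + (\<Sum>p\<in>{(i, j). i < 3 \<and> j < 3 \<and> i \<noteq> j}. G (snd p) (fst p))
    \<le> real n ^ 3 / 27 + 6 * g0 + 3 * f0 + (15 * x * K - real n * x ^ 2 / 12) + 15 * K"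
    using pr 1 2 by (simp add: algebra_simps)
  then show ?thesis using 3 by linarith
qed

lemma kst_exponent_bounds: "s \<ge> 2 \<Longrightarrow> kst_exponent t s > 0 \<and> 1 / real s ^ 2 \<le> kst_exponent t s \<and> kst_exponent t s \<le> 1 / 2"
proof -
  assume s: "s \<ge> 2"
  have "1 / real s ^ 2 \<le> 1 / real s" using s by (simp add: field_simps power2_eq_square)
  moreover have "1 / real s \<le> 1 / 2" using s by (simp add: field_simps)
  moreover have "1 / real s ^ 2 > 0" using s by simp
  moreover have "kst_exponent t s = 1 / real s \<or> kst_exponent t s = 1 / real s ^ 2" by (simp add: kst_exponent_def)
  ultimately show ?thesis by linarith
qed

lemma ex3_F5S_upper:
  assumes ms: "2 * s \<le> m" "s \<ge> 2" "t > 0"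
  obtains A B where "\<forall>\<^sub>F n in sequentially. real (ex3 n (F5S m t s)) \<le>
             real (card (hedges (turan3 n))) + 6 * real (ex3_bip (n div 3) (n div 3) t s)
             + 3 * real (ex3 (n div 3) (K3 t s s)) + (A * real n powr (3 - 2 * kst_exponent t s) + B * real n powr 2)"
proof -
  have m: "m > 0" and s: "s > 0" using ms by auto
  obtain C n0 where C: "C \<ge> 0" and n0: "\<And>(V :: nat set) E. hyper3 V E \<Longrightarrow> \<not> contains_copy (V, E) (F5S m t s) \<Longrightarrow> card V \<ge> n0 \<Longrightarrow>
     real (card V) ^ 3 / 27 - real (card V) ^ 2 \<le> real (card E) \<Longrightarrow>
     \<exists>a :: nat \<Rightarrow> nat. a 0 + a 1 + a 2 = card V \<and>
       real (card E) \<le> partition_bound t s a + C * real (card V) ^ 2"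
    by (rule exact_structure[OF ms(1) s ms(3)]) (rule that)
  define g where "g = kst_exponent t s"
  define D where "D = 12 * (kst_const t s + kst_const s s)"
  have D: "D \<ge> 0" by (simp add: D_def kst_const_def)
  have g: "g > 0" using kst_exponent_bounds[OF ms(2)] by (simp add: g_def)
  have "real (ex3 n (F5S m t s)) \<le>
             real (card (hedges (turan3 n))) + 6 * real (ex3_bip (n div 3) (n div 3) t s)
             + 3 * real (ex3 (n div 3) (K3 t s s)) + (675 * D ^ 2 * real n powr (3 - 2 * g) + (15 * D + C + 1) * real n powr 2)"
    if n: "n \<ge> max n0 2" for n
  proof -
    have np: "n > 0" "real n \<ge> 1" using n by auto
    obtain V E where hyp: "hyper3 (V :: nat set) E" and free: "\<not> contains_copy (V, E) (F5S m t s)"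
      and VE: "card V = n" "card E = ex3 n (F5S m t s)" using ex3_attained[OF F5S_nonempty[OF m]] by metis
    \<comment> \<open>The lower bound gives the extremal 3-graph the density on which the structural
      estimate depends.\<close>
    have "card (hedges (turan3 n)) \<le> card E" using ex3_F5S_lower[OF m ms(1,3) s, of n] VE by linarith
    then have big: "real (card V) ^ 3 / 27 - real (card V) ^ 2 \<le> real (card E)"
      using card_turan3_ge_real[of n] VE by simp
    have "n0 \<le> card V" using n VE by simp
    from n0[OF hyp free this big] obtain a :: "nat \<Rightarrow> nat" where a: "a 0 + a 1 + a 2 = n" and
      E: "real (card E) \<le> partition_bound t s a + C * real n ^ 2"
      unfolding VE(1) by blast
    \<comment> \<open>The change of the extremal numbers per vertex; K^2 / n is of order n^(3-2g),
      the main part of the error.\<close>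
    define K where "K = D * real n powr (2 - g)"
    have K: "K \<ge> 0" using D by (simp add: K_def)
    have an: "a i \<le> n" if "i < 3" for i
    proof -
      have "i = 0 \<or> i = 1 \<or> i = 2" using that by linarith
      then show ?thesis using a by auto
    qed
    have N: "n \<le> 4 * (n div 3 + 1)" "n div 3 \<le> n" by presburger simp
    have "partition_bound t s a \<le> real n ^ 3 / 27 + 6 * real (ex3_bip (n div 3) (n div 3) t s) + 3 * real (ex3 (n div 3) (K3 t s s)) + 675 * K ^ 2 / real n + 15 * K"
      unfolding partition_bound_def
    proof (rule unbalanced_loss[OF a np(1) refl _ _ K])
      fix i :: nat assume i: "i < 3"
      show "real (ex3 (a i) (K3 t s s)) \<le> real (ex3 (n div 3) (K3 t s s)) + real (a i - n div 3) * K"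
        unfolding K_def D_def g_def by (rule ex3_K3_growth[OF ms(3) s np(1) an[OF i] N(1)])
      fix j :: nat assume j: "j < 3"
      show "real (ex3_bip (a j) (a i) t s) \<le> real (ex3_bip (n div 3) (n div 3) t s) + (real (a j - n div 3) + real (a i - n div 3)) * K"
        unfolding K_def D_def g_def by (rule ex3_bip_growth[OF ms(3) s np(1) an[OF j] an[OF i] N])
    qed
    moreover have "675 * K ^ 2 / real n = 675 * D ^ 2 * real n powr (3 - 2 * g)"
    proof -
      have "(real n powr (2 - g)) ^ 2 / real n = real n powr (2 - g) * real n powr (2 - g) / real n powr 1"
        using np by (simp add: power2_eq_square)
      also have "\<dots> = real n powr (3 - 2 * g)" by (simp only: powr_add[symmetric] powr_diff[symmetric]) (simp add: algebra_simps)
      finally have "675 * D ^ 2 * ((real n powr (2 - g)) ^ 2 / real n) = 675 * D ^ 2 * real n powr (3 - 2 * g)" by simp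
      then show ?thesis by (simp add: K_def power_mult_distrib)
    qed
    moreover have "15 * K \<le> 15 * D * real n powr 2"
    proof -
      have "real n powr (2 - g) \<le> real n powr 2" using np g by (intro powr_mono) auto
      then show ?thesis unfolding K_def using D by (simp add: mult_left_mono)
    qed
    moreover have "real n ^ 3 / 27 \<le> real (card (hedges (turan3 n))) + real n powr 2"
      using card_turan3_ge_real[of n] np by simp
    moreover have "C * real n ^ 2 = C * real n powr 2" using np by simp
    moreover have "(15 * D + C + 1) * real n powr 2 = 15 * D * real n powr 2 + C * real n powr 2 + real n powr 2"
      by (simp add: algebra_simps)
    ultimately show ?thesis using E unfolding VE(2) by linarith
  qed
  then have "\<forall>\<^sub>F n in sequentially. real (ex3 n (F5S m t s)) \<le>
             real (card (hedges (turan3 n))) + 6 * real (ex3_bip (n div 3) (n div 3) t s)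
             + 3 * real (ex3 (n div 3) (K3 t s s)) + (675 * D ^ 2 * real n powr (3 - 2 * kst_exponent t s) + (15 * D + C + 1) * real n powr 2)"
    unfolding g_def by (rule eventually_sequentiallyI)
  then show thesis by (rule that)
qed

lemma powr_sum_smallo:
  fixes A B p q r :: real
  assumes "p < r" "q < r"
  shows "(\<lambda>n. A * real n powr p + B * real n powr q) \<in> o(\<lambda>n. real n powr r)"
proof -
  have l: "filterlim real at_top sequentially" by (rule filterlim_real_sequentially)
  have "(\<lambda>x::real. x powr p) \<in> o(\<lambda>x. x powr r)" "(\<lambda>x::real. x powr q) \<in> o(\<lambda>x. x powr r)"
    using assms by (simp_all add: powr_smallo_iff[OF filterlim_ident])
  then have "(\<lambda>n. real n powr p) \<in> o(\<lambda>n. real n powr r)" "(\<lambda>n. real n powr q) \<in> o(\<lambda>n. real n powr r)"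
    using landau_o.small.compose[OF _ l] by auto
  then show ?thesis
    by (intro sum_in_smallo; cases "A = 0"; cases "B = 0") (simp_all add: landau_o.small.cmult_in_iff)
qed

theorem theorem1p2:
  fixes m t s :: nat
  assumes "m > 0" and "t > 0" and "s > 0"
    and "t + s \<ge> 3" and "m \<ge> 2 * s" and "2 * s \<ge> 4"
  shows
    "(\<exists>g :: nat \<Rightarrow> real. g \<in> o(\<lambda>n. real n powr (3 - 1 / real s ^ 2)) \<and>
        (\<forall>\<^sub>F n in sequentially.
           real (ex3 n (F5S m t s)) \<le>
             real (card (hedges (turan3 n))) + 6 * real (ex3_bip (n div 3) (n div 3) t s)
             + 3 * real (ex3 (n div 3) (K3 t s s)) + g n)) \<and>
     (\<forall>\<^sub>F n in sequentially.
        ex3 n (F5S m t s) \<ge> card (hedges (turan3 n)) + 3 * ex3 (n div 3) (K3 t s s)) \<and>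
     (t = 1 \<longrightarrow>
       (\<exists>g :: nat \<Rightarrow> real. g \<in> o(\<lambda>n. real n powr (3 - 1 / real s)) \<and>
        (\<forall>\<^sub>F n in sequentially.
           real (ex3 n (F5S m 1 s)) \<le>
             real (card (hedges (turan3 n))) + 6 * real (ex3_bip (n div 3) (n div 3) 1 s)
             + 3 * real (ex3 (n div 3) (K3 1 s s)) + g n)))"
proof (intro conjI impI)
  have s2: "s \<ge> 2" using assms(6) by simp
  \<comment> \<open>The doubled saving 2g strictly exceeds 1/s^2 because g is positive and at least
    1/s^2; this turns the O-bound into the claimed o-bound.\<close>
  have ineq: "3 - 2 * kst_exponent t s < 3 - 1 / real s ^ 2" "2 < 3 - 1 / real s ^ 2"
    using kst_exponent_bounds[OF s2, of t] by linarith+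
  obtain A B where AB: "\<forall>\<^sub>F n in sequentially. real (ex3 n (F5S m t s)) \<le>
             real (card (hedges (turan3 n))) + 6 * real (ex3_bip (n div 3) (n div 3) t s)
             + 3 * real (ex3 (n div 3) (K3 t s s)) + (A * real n powr (3 - 2 * kst_exponent t s) + B * real n powr 2)"
    using ex3_F5S_upper[OF assms(5) s2 assms(2)] by blast
  then show "\<exists>g :: nat \<Rightarrow> real. g \<in> o(\<lambda>n. real n powr (3 - 1 / real s ^ 2)) \<and>
        (\<forall>\<^sub>F n in sequentially.
           real (ex3 n (F5S m t s)) \<le>
             real (card (hedges (turan3 n))) + 6 * real (ex3_bip (n div 3) (n div 3) t s)
             + 3 * real (ex3 (n div 3) (K3 t s s)) + g n)"
    by (intro exI[of _ "\<lambda>n. A * real n powr (3 - 2 * kst_exponent t s) + B * real n powr 2"] conjI powr_sum_smallo ineq)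
  show "\<forall>\<^sub>F n in sequentially. card (hedges (turan3 n)) + 3 * ex3 (n div 3) (K3 t s s) \<le> ex3 n (F5S m t s)"
    by (intro always_eventually allI ex3_F5S_lower assms)
  assume t: "t = 1"
  have "kst_exponent t s = 1 / real s" using t by (simp add: kst_exponent_def)
  then have ineq1: "3 - 2 * kst_exponent t s < 3 - 1 / real s" "2 < 3 - 1 / real s"
    using kst_exponent_bounds[OF s2, of t] by linarith+
  show "\<exists>g :: nat \<Rightarrow> real. g \<in> o(\<lambda>n. real n powr (3 - 1 / real s)) \<and>
        (\<forall>\<^sub>F n in sequentially.
           real (ex3 n (F5S m 1 s)) \<le>
             real (card (hedges (turan3 n))) + 6 * real (ex3_bip (n div 3) (n div 3) 1 s)
             + 3 * real (ex3 (n div 3) (K3 1 s s)) + g n)"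
    by (intro exI[of _ "\<lambda>n. A * real n powr (3 - 2 * kst_exponent t s) + B * real n powr 2"] conjI powr_sum_smallo ineq1)
      (use AB t in simp)
qed

end
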